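(* Let $\lambda$ be a partition of $n$, and let $\mu$ be a partition that is the reduced cycle type of some element of $S_n$. Then the central character $\omega_\mu^\lambda$ of $S_n$ (the scalar by which the sum of all elements of reduced cycle type $\mu$ in $S_n$ acts on the Specht module $S^\lambda$) is equal to the character symmetric function $f_\mu\in\mathcal{R}\otimes_{\mathbb Z}\Lambda$ evaluated at the contents of the $n$ boxes of $\lambda$, with the integer-valued polynomial variable $t$ evaluated at $n$.
   Context: $\mathcal{R}=\{f\in\mathbb{Q}[t]:f(m)\in\mathbb{Z}\text{ for all }m\in\mathbb{Z}\}$. The reduced cycle type of a permutation is the partition obtained from its cycle type by subtracting $1$ from each part and discarding zeros. $X_\mu\in Z(\mathbb{Z}S_n)$ is the sum of all elements of $S_n$ of reduced cycle type $\mu$ ($0$ if there are none). By a theorem of Farahat and Higman there are unique $\phi_{\mu,\nu}^\lambda\in\mathcal{R}$ with $X_\mu X_\nu=\sum_\lambda\phi_{\mu,\nu}^\lambda(n)X_\lambda$ in $Z(\mathbb{Z}S_n)$ for all $n\ge0$. $\mathrm{FH}$ is the free $\mathcal{R}$-module with basis $K_\mu$ (all partitions $\mu$) and $\mathcal{R}$-bilinear multiplication $K_\mu K_\nu=\sum_\lambda\phi_{\mu,\nu}^\lambda(t)K_\lambda$. $\Lambda=\mathbb{Z}[e_1,e_2,\dots]$ is the ring of symmetric functions ($e_r$ elementary), and $\Psi:\mathcal{R}\otimes_{\mathbb{Z}}\Lambda\to\mathrm{FH}$ is the $\mathcal{R}$-algebra isomorphism with $\Psi(e_r)=\sum_{\mu\vdash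 r}K_\mu$ for $r\geq 1$. The character symmetric function is $f_\mu=\Psi^{-1}(K_\mu)$. The content of the box in row $i$ (from the top) and column $j$ (from the left) of a Young diagram is $j-i$. $S^\lambda$ is the irreducible complex representation (Specht module) of $S_n$ labelled by $\lambda$. *)

theory Defs
  imports
    Complex_Main
    "HOL-Library.Multiset"
    "HOL-Library.Poly_Mapping"
    "HOL-Computational_Algebra.Polynomial"
    "HOL-Combinatorics.Permutations"
    "HOL-Combinatorics.Orbits"
begin

section \<open>Integer partitions and Young diagrams\<close>

typedef int_partition = "{M :: nat multiset. 0 \<notin># M}"
  morphisms parts Abs_int_partition
  by (rule exI[of _ "{#}"]) simp

definition psize :: "int_partition \<Rightarrow> nat" where
  "psize l = sum_mset (parts l)"

definition empty_partition :: int_partition where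
  "empty_partition = Abs_int_partition {#}"

definition row_lengths :: "int_partition \<Rightarrow> nat list" where
  "row_lengths l = rev (sorted_list_of_multiset (parts l))"

text \<open>Boxes are pairs (row, column), both counted from 0; the content is the same as
  for indices starting at 1.\<close>

definition diagram :: "int_partition \<Rightarrow> (nat \<times> nat) set" where
  "diagram l = {(i, j). i < length (row_lengths l) \<and> j < row_lengths l ! i}"

definition content :: "nat \<times> nat \<Rightarrow> int" where
  "content b = int (snd b) - int (fst b)"


section \<open>Class sums in the integral group ring of the symmetric group\<close>

text \<open>The symmetric group \<open>S\<^sub>n\<close> is \<open>{p. p permutes {1..n}}\<close> under composition.
  An element of its group ring over \<open>\<int>\<close> is its coefficient function.\<close>

definition cycle_type :: "nat \<Rightarrow> (nat \<Rightarrow> nat) \<Rightarrow> nat multiset" where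
  "cycle_type n p = image_mset card (mset_set (orbit p ` {1..n}))"

definition reduced_cycle_type :: "nat \<Rightarrow> (nat \<Rightarrow> nat) \<Rightarrow> int_partition" where
  "reduced_cycle_type n p =
     Abs_int_partition (filter_mset (\<lambda>k. k \<noteq> 0) (image_mset (\<lambda>k. k - 1) (cycle_type n p)))"

definition class_sum :: "nat \<Rightarrow> int_partition \<Rightarrow> (nat \<Rightarrow> nat) \<Rightarrow> int" where
  "class_sum n m p = (if p permutes {1..n} \<and> reduced_cycle_type n p = m then 1 else 0)"

definition group_ring_mult ::
    "nat \<Rightarrow> ((nat \<Rightarrow> nat) \<Rightarrow> int) \<Rightarrow> ((nat \<Rightarrow> nat) \<Rightarrow> int) \<Rightarrow> (nat \<Rightarrow> nat) \<Rightarrow> int" where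
  "group_ring_mult n a b p =
     (\<Sum>(q, r) \<in> {(q, r). q permutes {1..n} \<and> r permutes {1..n} \<and> q \<circ> r = p}. a q * b r)"


section \<open>The ring of integer-valued polynomials\<close>

typedef intval_poly = "{f :: rat poly. \<forall>m :: int. poly f (of_int m) \<in> \<int>}"
  morphisms rat_poly_of Abs_intval_poly
  by (rule exI[of _ 0]) simp

setup_lifting type_definition_intval_poly

instantiation intval_poly :: comm_ring_1
begin

lift_definition zero_intval_poly :: intval_poly is 0 by simp
lift_definition one_intval_poly :: intval_poly is 1 by simp
lift_definition plus_intval_poly :: "intval_poly \<Rightarrow> intval_poly \<Rightarrow> intval_poly" is "(+)" by simp
lift_definition minus_intval_poly :: "intval_poly \<Rightarrow> intval_poly \<Rightarrow> intval_poly" is "(-)" by simp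
lift_definition uminus_intval_poly :: "intval_poly \<Rightarrow> intval_poly" is uminus by simp
lift_definition times_intval_poly :: "intval_poly \<Rightarrow> intval_poly \<Rightarrow> intval_poly" is "(*)" by simp

instance
  by standard (transfer; simp add: algebra_simps)+

end

definition ieval :: "intval_poly \<Rightarrow> int \<Rightarrow> int" where
  "ieval f m = \<lfloor>poly (rat_poly_of f) (of_int m)\<rfloor>"

text \<open>The floor only changes the type:\<close>

lemma of_int_ieval: "of_int (ieval f m) = poly (rat_poly_of f) (of_int m)"
  using rat_poly_of[of f] by (auto simp: ieval_def elim!: Ints_cases)


section \<open>The Farahat--Higman algebra\<close>

text \<open>Scalar multiplication on a free module of finitely supported functions.\<close>

definition smul :: "'b \<Rightarrow> ('a \<Rightarrow>\<^sub>0 'b) \<Rightarrow> ('a \<Rightarrow>\<^sub>0 'b :: mult_zero)" where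
  "smul c x = Poly_Mapping.map ((*) c) x"

text \<open>\<open>fh_coeff m m'\<close> collects the structure polynomials for the product of the class sums
  of \<open>m\<close> and \<open>m'\<close>; only finitely many of them are nonzero.\<close>

definition fh_coeff :: "int_partition \<Rightarrow> int_partition \<Rightarrow> (int_partition \<Rightarrow>\<^sub>0 intval_poly)" where
  "fh_coeff m m' = (THE phi. \<forall>n.
     group_ring_mult n (class_sum n m) (class_sum n m') =
     (\<lambda>p. \<Sum>l\<in>Poly_Mapping.keys phi. ieval (Poly_Mapping.lookup phi l) (int n) * class_sum n l p))"

text \<open>\<open>fh\<close> is the free module with basis \<open>fhK\<close>. Its product is \<open>fh_mult\<close>.\<close>

type_synonym fh = "int_partition \<Rightarrow>\<^sub>0 intval_poly"

definition fhK :: "int_partition \<Rightarrow> fh" where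
  "fhK m = Poly_Mapping.single m 1"

definition fh_mult :: "fh \<Rightarrow> fh \<Rightarrow> fh" where
  "fh_mult x y = (\<Sum>m\<in>Poly_Mapping.keys x. \<Sum>m'\<in>Poly_Mapping.keys y.
     smul (Poly_Mapping.lookup x m * Poly_Mapping.lookup y m') (fh_coeff m m'))"


section \<open>Symmetric functions over the integer-valued polynomials\<close>

text \<open>Since \<open>\<Lambda> = \<int>[e\<^sub>1, e\<^sub>2, \<dots>]\<close>, its base change to the integer-valued polynomials is the
  polynomial ring over that ring in the variables \<open>e\<^sub>1, e\<^sub>2, \<dots>\<close>.
  A monomial is a finitely supported exponent vector, and its entry at
  index \<open>k\<close> is the exponent of the variable \<open>e\<^sub>r\<close> with \<open>r = k + 1\<close>.\<close>

type_synonym symfun = "(nat \<Rightarrow>\<^sub>0 nat) \<Rightarrow>\<^sub>0 intval_poly"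

definition esym :: "nat \<Rightarrow> symfun" where
  "esym r = (if r = 0 then 1 else Poly_Mapping.single (Poly_Mapping.single (r - 1) 1) 1)"

text \<open>The value of \<open>e\<^sub>r\<close> on the finite family of numbers \<open>c b\<close>, for \<open>b \<in> B\<close>.\<close>

definition esym_value :: "nat \<Rightarrow> ('b \<Rightarrow> int) \<Rightarrow> 'b set \<Rightarrow> int" where
  "esym_value r c B = (\<Sum>S \<in> {S. S \<subseteq> B \<and> card S = r}. \<Prod>b\<in>S. c b)"

definition symfun_eval :: "symfun \<Rightarrow> ('b \<Rightarrow> int) \<Rightarrow> 'b set \<Rightarrow> int \<Rightarrow> int" where
  "symfun_eval f c B t = (\<Sum>a\<in>Poly_Mapping.keys f. ieval (Poly_Mapping.lookup f a) t *
     (\<Prod>k\<in>Poly_Mapping.keys a. esym_value (k + 1) c B ^ Poly_Mapping.lookup a k))"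

definition is_Psi :: "(symfun \<Rightarrow> fh) \<Rightarrow> bool" where
  "is_Psi P \<longleftrightarrow> bij P
     \<and> (\<forall>f g. P (f + g) = P f + P g)
     \<and> (\<forall>c f. P (smul c f) = smul c (P f))
     \<and> (\<forall>f g. P (f * g) = fh_mult (P f) (P g))
     \<and> P 1 = fhK empty_partition
     \<and> (\<forall>r\<ge>1. P (esym r) = (\<Sum>m \<in> {m. psize m = r}. fhK m))"

definition Psi :: "symfun \<Rightarrow> fh" where
  "Psi = (THE P. is_Psi P)"

definition character_symfun :: "int_partition \<Rightarrow> symfun" where
  "character_symfun m = inv Psi (fhK m)"


section \<open>Specht modules and central characters\<close>

text \<open>The values of a tableau outside the diagram are irrelevant.\<close>

definition is_tableau :: "int_partition \<Rightarrow> (nat \<times> nat \<Rightarrow> nat) \<Rightarrow> bool" where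
  "is_tableau l T \<longleftrightarrow> bij_betw T (diagram l) {1..psize l}"

text \<open>A tabloid is a row-equivalence class of tableaux. It is represented by
  the sequence of the sets of entries of its rows.\<close>

type_synonym tabloid = "nat \<Rightarrow> nat set"

definition tabloid_of :: "int_partition \<Rightarrow> (nat \<times> nat \<Rightarrow> nat) \<Rightarrow> tabloid" where
  "tabloid_of l T = (\<lambda>i. T ` {b \<in> diagram l. fst b = i})"

definition column_stabilizer :: "int_partition \<Rightarrow> (nat \<times> nat \<Rightarrow> nat) \<Rightarrow> (nat \<Rightarrow> nat) set" where
  "column_stabilizer l T = {p. p permutes {1..psize l} \<and>
     (\<forall>j. p ` (T ` {b \<in> diagram l. snd b = j}) = T ` {b \<in> diagram l. snd b = j})}"

definition polytabloid :: "int_partition \<Rightarrow> (nat \<times> nat \<Rightarrow> nat) \<Rightarrow> (tabloid \<Rightarrow>\<^sub>0 complex)" where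
  "polytabloid l T = (\<Sum>p \<in> column_stabilizer l T.
     Poly_Mapping.single (tabloid_of l (p \<circ> T)) (of_int (sign p)))"

definition specht :: "int_partition \<Rightarrow> (tabloid \<Rightarrow>\<^sub>0 complex) set" where
  "specht l = module.span smul {polytabloid l T | T. is_tableau l T}"

definition perm_act :: "(nat \<Rightarrow> nat) \<Rightarrow> (tabloid \<Rightarrow>\<^sub>0 complex) \<Rightarrow> (tabloid \<Rightarrow>\<^sub>0 complex)" where
  "perm_act p v =
     (\<Sum>X\<in>Poly_Mapping.keys v. Poly_Mapping.single (\<lambda>i. p ` X i) (Poly_Mapping.lookup v X))"

definition group_ring_act ::
    "nat \<Rightarrow> ((nat \<Rightarrow> nat) \<Rightarrow> int) \<Rightarrow> (tabloid \<Rightarrow>\<^sub>0 complex) \<Rightarrow> (tabloid \<Rightarrow>\<^sub>0 complex)" where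
  "group_ring_act n a v = (\<Sum>p \<in> {p. p permutes {1..n}}. smul (of_int (a p)) (perm_act p v))"

definition central_character :: "int_partition \<Rightarrow> int_partition \<Rightarrow> complex" where
  "central_character l m =
     (THE c. \<forall>v\<in>specht l. group_ring_act (psize l) (class_sum (psize l) m) v = smul c v)"

end

theory Submission
  imports Defs
begin

text \<open>Let \<open>l\<close> be a partition of \<open>n\<close>. There are two ring homomorphisms from the symmetric
functions over the integer-valued polynomials to the complex numbers. One evaluates a
symmetric function at the contents of \<open>l\<close> and the polynomial variable at \<open>n\<close>. The other one
applies \<open>Psi\<close>, specializes the result to the group ring of \<open>S\<^sub>n\<close>, and takes the scalar by which
this central element acts on the Specht module. Both send a constant \<open>c\<close> to \<open>c(n)\<close>, so they are
equal as soon as they agree on the elementary symmetric functions. At the character symmetric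
function of \<open>m\<close>, the second one is the central character, because \<open>Psi\<close> sends this function to
the basis element of \<open>m\<close>. This argument rests on three facts.

The Farahat--Higman algebra is a commutative ring. The coefficient of \<open>p\<close> in a product of two
class sums of \<open>S\<^sub>n\<close> counts pairs \<open>(q, r)\<close> with \<open>q \<circ> r = p\<close>. For a given union \<open>U\<close> of the supports of \<open>q\<close>
and \<open>r\<close> the number of pairs depends on the cycle type of \<open>p\<close> and the size of \<open>U\<close> only, and the
number of sets \<open>U\<close> of a given size is a binomial coefficient in \<open>n\<close> (\<open>class_product_coeff\<close>,
\<open>fh_coeff_eq\<close>). An element of the algebra is determined by its specializations to all \<open>S\<^sub>n\<close>, so it
inherits the ring axioms from the group rings.

\<open>Psi\<close> is a well-defined isomorphism (\<open>bij_Psi_mono\<close>, \<open>Psi_eq\<close>). The rank \<open>perm_rank p\<close> is the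
minimal number of transpositions whose product is \<open>p\<close>. By a theorem of Jucys, the sum of all
permutations of rank \<open>r\<close> is \<open>e\<^sub>r\<close> of the Jucys--Murphy elements (\<open>rank_op_eq_JM_prod\<close>). Hence \<open>Psi\<close> is, up to terms of lower
degree, a composition of two maps: expand a product of the \<open>e\<^sub>r\<close> in monomial symmetric functions,
and expand a monomial symmetric function of the Jucys--Murphy elements in class sums. Both have
integer matrices that are unitriangular after conjugating partitions in the first one. For
the first matrix, the order is given by the sum of the squares of the parts
(\<open>elem_coeff_nonzero\<close>, \<open>elem_coeff_leading\<close>). For the second one, it is given by the number of parts: a
minimal factorization of \<open>p\<close> into transpositions \<open>(a b)\<close> with \<open>a < b\<close> uses at least as many different
values of \<open>b\<close> as \<open>p\<close> has nontrivial cycles, and in the case of equality these values are the maxima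
of the cycles (\<open>JM_prod_minimal\<close>, \<open>JM_prod_max_exponent\<close>). Lower-degree terms do not affect
bijectivity (\<open>lin_filtered_bij\<close>).

Class functions act on a polytabloid by a scalar (\<open>class_fun_act_scalar\<close>), since the signed
column sum maps every tabloid of the same shape to a multiple of the polytabloid. The scalar is
the coefficient of the tabloid of \<open>T\<close>. For the sum of all permutations of rank \<open>r\<close>, this is a signed
sum over the row and the column stabilizer of \<open>T\<close> (\<open>young_sum\<close>). Removing a corner box shows that it
obeys the recursion of \<open>e\<^sub>r\<close> in the contents (\<open>young_sum_remove\<close>, \<open>young_sum_eq\<close>).\<close>

section \<open>Cycles and rank of a permutation\<close>

abbreviation tr :: "'a \<Rightarrow> 'a \<Rightarrow> 'a \<Rightarrow> 'a" where "tr \<equiv> Transposition.transpose"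

definition supp :: "('a \<Rightarrow> 'a) \<Rightarrow> 'a set" where
  "supp p = {x. p x \<noteq> x}"

definition cycle_set :: "('a \<Rightarrow> 'a) \<Rightarrow> 'a set set" where
  "cycle_set p = orbit p ` supp p"

text \<open>The reduced cycle type without reference to an ambient \<open>S\<^sub>n\<close>: fixed points do not contribute.\<close>

definition reduced_type :: "('a \<Rightarrow> 'a) \<Rightarrow> nat multiset" where
  "reduced_type p = image_mset (\<lambda>C. card C - 1) (mset_set (cycle_set p))"

text \<open>The rank is the size of the reduced cycle type, and the degree that filters the
Farahat--Higman algebra.\<close>

definition perm_rank :: "('a \<Rightarrow> 'a) \<Rightarrow> nat" where
  "perm_rank p = (\<Sum>C\<in>cycle_set p. card C - 1)"

lemma perm_rank_eq: "perm_rank p = sum_mset (reduced_type p)"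
  by (simp add: perm_rank_def reduced_type_def sum_unfold_sum_mset)

lemma finite_supp: "permutation p \<Longrightarrow> finite (supp p)"
  by (simp add: permutation supp_def)

lemma finite_cycle_set: "permutation p \<Longrightarrow> finite (cycle_set p)"
  by (simp add: cycle_set_def finite_supp)

lemma size_reduced_type: "size (reduced_type p) = card (cycle_set p)"
  by (simp add: reduced_type_def)

lemma supp_subset_iff:
  assumes "permutation p" shows "supp p \<subseteq> S \<longleftrightarrow> p permutes S"
proof
  assume "supp p \<subseteq> S"
  then have "\<And>x. x \<notin> S \<Longrightarrow> p x = x" by (auto simp: supp_def)
  moreover have "bij p" using assms permutation_bijective by blast
  then have "\<forall>y. \<exists>!x. p x = y" by (metis bij_iff)
  ultimately show "p permutes S" by (simp add: permutes_def)
next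
  assume "p permutes S" then show "supp p \<subseteq> S" using permutes_not_in by (force simp: supp_def)
qed

lemma orbit_eq: "permutation p \<Longrightarrow> y \<in> orbit p x \<Longrightarrow> orbit p y = orbit p x"
  by (meson cyclic_on_orbit' orbit_cyclic_eq3)

lemma orbit_disjoint:
  "permutation p \<Longrightarrow> orbit p x \<inter> orbit p y \<noteq> {} \<Longrightarrow> orbit p x = orbit p y"
  by (metis disjoint_iff orbit_eq)

lemma finite_orbit_perm: "permutation p \<Longrightarrow> finite (orbit p x)"
  by (simp add: finite_orbit permutation_self_in_orbit)

lemma card_orbit_gt1:
  assumes "permutation p" shows "card (orbit p x) > 1 \<longleftrightarrow> x \<in> supp p"
proof -
  have x: "x \<in> orbit p x" and f: "finite (orbit p x)"
    using assms by (auto simp: permutation_self_in_orbit finite_orbit_perm)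
  have "card (orbit p x) = 1 \<longleftrightarrow> orbit p x = {x}"
    using x by (auto simp: card_1_singleton_iff)
  moreover have "card (orbit p x) \<noteq> 0" using x f by auto
  ultimately show ?thesis by (auto simp: supp_def orbit_eq_singleton_iff)
qed

lemma orbit_in_cycle_set:
  assumes "permutation p" shows "orbit p x \<in> cycle_set p \<longleftrightarrow> x \<in> supp p"
  using card_orbit_gt1[OF assms] unfolding cycle_set_def by (auto simp: image_iff) metis

lemma cyc_setE:
  assumes "C \<in> cycle_set p" "permutation p" "x \<in> C"
  shows "C = orbit p x" "x \<in> supp p"
proof -
  show 1: "C = orbit p x" using assms by (auto simp: cycle_set_def orbit_eq)
  then show "x \<in> supp p" using assms orbit_in_cycle_set by metis
qed

lemma Union_cycle_set:
  assumes "permutation p" shows "\<Union>(cycle_set p) = supp p"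
proof
  show "\<Union>(cycle_set p) \<subseteq> supp p" using cyc_setE(2)[OF _ assms] by blast
  show "supp p \<subseteq> \<Union>(cycle_set p)" using permutation_self_in_orbit[OF assms] by (auto simp: cycle_set_def)
qed

lemma cycle_set_disjoint:
  assumes "permutation p" "C \<in> cycle_set p" "D \<in> cycle_set p" "C \<noteq> D" shows "C \<inter> D = {}"
proof (rule ccontr)
  assume "C \<inter> D \<noteq> {}"
  then obtain x where "x \<in> C" "x \<in> D" by blast
  then show False using cyc_setE(1)[OF assms(2,1)] cyc_setE(1)[OF assms(3,1)] assms(4) by blast
qed

lemma cyc_card: "permutation p \<Longrightarrow> C \<in> cycle_set p \<Longrightarrow> finite C \<and> card C > 1"
  using card_orbit_gt1[of p] by (auto simp: cycle_set_def finite_orbit_perm)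

lemma zero_not_in_reduced_type: "permutation p \<Longrightarrow> 0 \<notin># reduced_type p"
  using cyc_card by (fastforce simp: reduced_type_def finite_cycle_set)

lemma card_supp:
  assumes "permutation p"
  shows "card (supp p) = perm_rank p + card (cycle_set p)"
proof -
  have "card (supp p) = (\<Sum>C\<in>cycle_set p. card C)"
    unfolding Union_cycle_set[OF assms, symmetric]
    using cycle_set_disjoint[OF assms] cyc_card[OF assms]
    by (intro card_Union_disjoint) (auto simp: pairwise_def disjnt_def)
  also have "\<dots> = (\<Sum>C\<in>cycle_set p. (card C - 1) + 1)"
    using cyc_card[OF assms] by (intro sum.cong) force+
  finally show ?thesis unfolding perm_rank_def sum.distrib by simp
qed

lemma reduced_cycle_type_eq:
  assumes "p permutes {1..n}"
  shows "parts (reduced_cycle_type n p) = reduced_type p"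
proof -
  have p: "permutation p" using assms by (meson finite_atLeastAtMost permutes_imp_permutation)
  have *: "{C \<in> orbit p ` {1..n}. card C - 1 \<noteq> 0} = cycle_set p"
  proof -
    have "supp p \<subseteq> {1..n}" using assms supp_subset_iff p by blast
    then show ?thesis using card_orbit_gt1[OF p] unfolding cycle_set_def by fastforce
  qed
  have "filter_mset (\<lambda>k. k \<noteq> 0) (image_mset (\<lambda>k. k - 1) (cycle_type n p)) =
     image_mset (\<lambda>C. card C - 1) (filter_mset (\<lambda>C. card C - 1 \<noteq> 0) (mset_set (orbit p ` {1..n})))"
    by (simp add: cycle_type_def filter_mset_image_mset multiset.map_comp comp_def not_le)
  also have "\<dots> = reduced_type p"
    unfolding reduced_type_def *[symmetric] by (subst filter_mset_mset_set) (auto simp: not_le)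
  finally show ?thesis
    unfolding reduced_cycle_type_def
    using zero_not_in_reduced_type[OF p] by (simp add: Abs_int_partition_inverse)
qed

lemma reduced_cycle_type_psize:
  "p permutes {1..n} \<Longrightarrow> psize (reduced_cycle_type n p) = perm_rank p"
  by (simp add: psize_def reduced_cycle_type_eq perm_rank_eq)

lemma orbit_conj:
  assumes "permutation p" "\<And>x. x \<in> orbit p a \<Longrightarrow> q (f x) = f (p x)"
  shows "orbit q (f a) = f ` orbit p a"
  using orbit_inverse[of a p q f] assms permutation_self_in_orbit by metis

lemma cycle_set_conj:
  assumes p: "permutation p" and f: "bij f"
  shows "cycle_set (f \<circ> p \<circ> inv f) = (`) f ` cycle_set p"
    and "supp (f \<circ> p \<circ> inv f) = f ` supp p"
proof -
  show s: "supp (f \<circ> p \<circ> inv f) = f ` supp p"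
    using f by (auto simp: supp_def bij_is_inj bij_inv_eq_iff image_iff inj_eq)
       (metis bij_inv_eq_iff)
  have o: "orbit (f \<circ> p \<circ> inv f) (f x) = f ` orbit p x" for x
    by (rule orbit_conj[OF p]) (use f in \<open>simp add: bij_is_inj\<close>)
  show "cycle_set (f \<circ> p \<circ> inv f) = (`) f ` cycle_set p"
    unfolding cycle_set_def s image_image o ..
qed

lemma reduced_type_conj:
  assumes p: "permutation p" and f: "bij f"
  shows "reduced_type (f \<circ> p \<circ> inv f) = reduced_type p"
proof -
  have inj: "inj_on ((`) f) (cycle_set p)" using f by (meson bij_is_inj inj_image_eq_iff inj_onI)
  have c: "card (f ` C) = card C" for C using f by (meson bij_is_inj card_image inj_on_subset subset_UNIV)
  show ?thesis unfolding reduced_type_def cycle_set_conj(1)[OF p f]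
    by (subst image_mset_mset_set[OF inj, symmetric]) (simp add: multiset.map_comp comp_def c)
qed

lemma reduced_type_commute:
  assumes "permutation p" "permutation q"
  shows "reduced_type (p \<circ> q) = reduced_type (q \<circ> p)"
proof -
  have "bij p" using assms permutation_bijective by blast
  then have "p \<circ> (q \<circ> p) \<circ> inv p = p \<circ> q"
    by (simp add: comp_assoc surj_iff[THEN iffD1] bij_is_surj)
  then show ?thesis using reduced_type_conj[of "q \<circ> p" p] assms \<open>bij p\<close> permutation_compose by metis
qed

lemma perm_rank_commute: "permutation p \<Longrightarrow> permutation q \<Longrightarrow> perm_rank (p \<circ> q) = perm_rank (q \<circ> p)"
  by (simp add: perm_rank_eq reduced_type_commute)

lemma supp_id [simp]: "supp id = {}" by (simp add: supp_def)

lemma perm_rank_id [simp]: "perm_rank id = 0" by (simp add: perm_rank_def cycle_set_def)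

lemma perm_rank_eq_0_iff:
  assumes "permutation p" shows "perm_rank p = 0 \<longleftrightarrow> p = id"
proof
  assume "perm_rank p = 0"
  then have "\<forall>C\<in>cycle_set p. card C - 1 = 0" using finite_cycle_set[OF assms] by (simp add: perm_rank_def)
  then have "cycle_set p = {}" using cyc_card[OF assms] by fastforce
  then show "p = id" by (auto simp: cycle_set_def supp_def)
qed auto

section \<open>Multiplication by a transposition\<close>

text \<open>Follow the \<open>p\<close>-orbit of \<open>a\<close>: it runs through the \<open>q\<close>-orbit of \<open>a\<close>, and where \<open>q\<close> would return to \<open>a\<close>, the
transposition leads to \<open>M\<close> instead.\<close>

lemma orbit_merge_aux:
  assumes q: "permutation q" and M: "M \<notin> orbit q a"
  defines "p \<equiv> tr a M \<circ> q"
  shows "orbit q a \<subseteq> orbit p a" "M \<in> orbit p a"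
proof -
  have p: "permutation p" unfolding p_def by (intro permutation_compose permutation_swap_id q)
  have aa: "a \<in> orbit q a" and pa: "a \<in> orbit p a" by (simp_all add: p q permutation_self_in_orbit)
  define n where "n = funpow_dist1 q a a"
  have n: "(q ^^ n) a = a" "n > 0" using funpow_dist1_prop[OF aa] by (auto simp: n_def)
  have less: "0 < i \<Longrightarrow> i < n \<Longrightarrow> (q ^^ i) a \<noteq> a" for i
    unfolding n_def by (rule funpow_dist1_least)
  have nM: "(q ^^ i) a \<noteq> M" for i using M funpow_in_orbit[OF aa] by metis
  have eq: "i < n \<Longrightarrow> (p ^^ i) a = (q ^^ i) a" for i
  proof (induction i)
    case (Suc i)
    then show ?case using less[of "Suc i"] nM[of "Suc i"] by (simp add: p_def)
  qed simp
  have "(p ^^ n) a = p ((p ^^ (n-1)) a)" using n(2) by (cases n) auto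
  also have "\<dots> = tr a M ((q ^^ n) a)" using eq[of "n-1"] n(2) by (cases n) (auto simp: p_def)
  finally have "(p ^^ n) a = M" using n by simp
  then show "M \<in> orbit p a" using funpow_in_orbit[OF pa] by metis
  show "orbit q a \<subseteq> orbit p a"
    unfolding orbit_conv_funpow_dist1[OF aa] n_def[symmetric]
    using eq funpow_in_orbit[OF pa] by (auto, metis)
qed

lemma orbit_merge:
  assumes q: "permutation q" and M: "M \<notin> orbit q a"
  defines "p \<equiv> tr a M \<circ> q"
  shows "orbit p a = orbit q a \<union> orbit q M" "orbit p M = orbit q a \<union> orbit q M"
    "x \<notin> orbit q a \<union> orbit q M \<Longrightarrow> orbit p x = orbit q x"
proof -
  have p: "permutation p" unfolding p_def by (intro permutation_compose permutation_swap_id q)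
  have a: "a \<notin> orbit q M" using M q by (metis orbit_eq permutation_self_in_orbit)
  have p2: "p = tr M a \<circ> q" by (simp add: p_def transpose_commute)
  have 1: "orbit q a \<subseteq> orbit p a" "M \<in> orbit p a"
    using orbit_merge_aux[OF q M] by (auto simp: p_def)
  have 2: "orbit q M \<subseteq> orbit p M" using orbit_merge_aux(1)[OF q a] by (simp add: p2)
  have 3: "orbit p M = orbit p a" by (rule orbit_eq[OF p 1(2)])
  have self: "a \<in> orbit q a" "M \<in> orbit q M" by (simp_all add: q permutation_self_in_orbit)
  have "y \<in> orbit q a \<union> orbit q M" if "y \<in> orbit p a" for y
    using that by induction (use self in \<open>auto simp: p_def Transposition.transpose_def intro: orbit.intros\<close>)
  then show "orbit p a = orbit q a \<union> orbit q M" using 1 2 3 by blast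
  then show "orbit p M = orbit q a \<union> orbit q M" using 3 by simp
  assume x: "x \<notin> orbit q a \<union> orbit q M"
  show "orbit p x = orbit q x"
  proof (rule orbit_cong)
    show "x \<in> orbit q x" by (simp_all add: q permutation_self_in_orbit)
    fix s assume "s \<in> orbit q x"
    then have "q s \<in> orbit q x" by (rule orbit.step)
    then have "q s \<noteq> a" "q s \<noteq> M" using x self by (metis UnI1 UnI2 orbit_eq q permutation_self_in_orbit)+
    then show "p s = q s" by (simp add: p_def)
  qed
qed

text \<open>Multiplication by a transposition of points in different orbits joins these two orbits, and
changes nothing else. All changes of rank and number of cycles below come from this.\<close>

lemma cycle_set_merge:
  assumes q: "permutation q" and M: "M \<notin> orbit q a"
  defines "p \<equiv> tr a M \<circ> q"
  shows "cycle_set p = insert (orbit q a \<union> orbit q M) (cycle_set q - {orbit q a, orbit q M})"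
    and "supp p = supp q \<union> orbit q a \<union> orbit q M"
    and "orbit q a \<union> orbit q M \<notin> cycle_set q"
proof -
  note om = orbit_merge[OF q M, folded p_def]
  have p: "permutation p" unfolding p_def by (intro permutation_compose permutation_swap_id q)
  have self: "\<And>x. x \<in> orbit q x" "\<And>x. x \<in> orbit p x" by (simp_all add: p q permutation_self_in_orbit)
  have aM: "a \<noteq> M" using M self by auto
  have pa: "p a \<noteq> a"
    using om(1) aM self by (metis UnI2 orbit_eq_singleton_iff singletonD)
  have sub: "x \<in> supp p" if "x \<in> orbit q a \<union> orbit q M" for x
  proof -
    have "orbit p x = orbit p a" using that om(1) orbit_eq[OF p] by blast
    then show ?thesis using card_orbit_gt1[OF p] pa by (metis mem_Collect_eq supp_def)
  qed
  have other: "x \<in> supp p \<longleftrightarrow> x \<in> supp q" if "x \<notin> orbit q a \<union> orbit q M" for x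
    using om(3)[OF that] card_orbit_gt1[OF p, of x] card_orbit_gt1[OF q, of x] by simp
  show s: "supp p = supp q \<union> orbit q a \<union> orbit q M" using sub other by blast
  have mem: "x \<in> orbit q a \<union> orbit q M \<longleftrightarrow> orbit q x = orbit q a \<or> orbit q x = orbit q M" for x
    using orbit_eq[OF q] self by blast
  have mem2: "orbit p x = orbit q a \<union> orbit q M" if "x \<in> orbit q a \<union> orbit q M" for x
    using that om(1) orbit_eq[OF p] by blast
  show "cycle_set p = insert (orbit q a \<union> orbit q M) (cycle_set q - {orbit q a, orbit q M})"
  proof (intro set_eqI iffI)
    fix C assume "C \<in> cycle_set p"
    then obtain x where x: "x \<in> supp p" "C = orbit p x" by (auto simp: cycle_set_def)
    show "C \<in> insert (orbit q a \<union> orbit q M) (cycle_set q - {orbit q a, orbit q M})"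
    proof (cases "x \<in> orbit q a \<union> orbit q M")
      case True then show ?thesis using x mem2 by blast
    next
      case False then show ?thesis using x other[OF False] om(3)[OF False] mem[of x]
        by (auto simp: cycle_set_def)
    qed
  next
    fix C assume C: "C \<in> insert (orbit q a \<union> orbit q M) (cycle_set q - {orbit q a, orbit q M})"
    then consider "C = orbit q a \<union> orbit q M" | x where "x \<in> supp q" "C = orbit q x" "orbit q x \<noteq> orbit q a" "orbit q x \<noteq> orbit q M"
      by (auto simp: cycle_set_def)
    then show "C \<in> cycle_set p"
    proof cases
      case 1
      then have "C = orbit p a" using om by simp
      then show ?thesis using sub[of a] self by (auto simp: cycle_set_def)
    next
      case 2
      then have "x \<notin> orbit q a \<union> orbit q M" using mem by blast
      then have "C = orbit p x" "x \<in> supp p" using 2 om(3)[of x] other[of x] by simp_all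
      then show ?thesis by (simp add: cycle_set_def)
    qed
  qed
  show "orbit q a \<union> orbit q M \<notin> cycle_set q"
    using cyc_setE(1)[OF _ q, of "orbit q a \<union> orbit q M" a] self M by blast
qed

text \<open>A weight that vanishes on fixed points can be summed without distinguishing whether the
merged orbits are trivial. The weights \<open>k - 1\<close>, \<open>[k > 1]\<close> and \<open>[k - 1 = j]\<close> give the rank, the number
of nontrivial cycles and the multiplicities in the cycle type.\<close>

lemma merge_sum:
  fixes f :: "nat \<Rightarrow> nat"
  assumes q: "permutation q" and M: "M \<notin> orbit q a" and f: "f 1 = 0"
  defines "p \<equiv> tr a M \<circ> q"
  shows "(\<Sum>C\<in>cycle_set p. f (card C)) + f (card (orbit q a)) + f (card (orbit q M)) =
     (\<Sum>C\<in>cycle_set q. f (card C)) + f (card (orbit q a) + card (orbit q M))"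
proof -
  note cm = cycle_set_merge[OF q M, folded p_def]
  have ne: "orbit q a \<noteq> orbit q M" using M permutation_self_in_orbit[OF q] by metis
  have fin: "finite (cycle_set q)" using q by (rule finite_cycle_set)
  have triv: "f (card (orbit q x)) = 0" if "orbit q x \<notin> cycle_set q" for x
  proof -
    have "orbit q x = {x}" using that q orbit_in_cycle_set[OF q, of x] by (simp add: supp_def orbit_eq_singleton_iff)
    then show ?thesis using f by simp
  qed
  have "(\<Sum>C\<in>cycle_set q. f (card C)) = (\<Sum>C\<in>cycle_set q \<union> {orbit q a, orbit q M}. f (card C))"
    by (rule sum.mono_neutral_left) (use fin triv in auto)
  also have "\<dots> = (\<Sum>C\<in>cycle_set q - {orbit q a, orbit q M}. f (card C)) + (\<Sum>C\<in>{orbit q a, orbit q M}. f (card C))"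
    using fin by (subst sum.union_disjoint[symmetric]) (auto intro!: sum.cong)
  finally have 1: "(\<Sum>C\<in>cycle_set q. f (card C)) = (\<Sum>C\<in>cycle_set q - {orbit q a, orbit q M}. f (card C))
     + f (card (orbit q a)) + f (card (orbit q M))" using ne by simp
  have disj: "orbit q a \<inter> orbit q M = {}" using ne orbit_disjoint[OF q] by blast
  have "card (orbit q a \<union> orbit q M) = card (orbit q a) + card (orbit q M)"
    by (rule card_Un_disjoint) (auto simp: finite_orbit_perm q disj)
  then show ?thesis using 1 cm fin by simp
qed

lemma perm_rank_merge:
  assumes q: "permutation q" and M: "M \<notin> orbit q a"
  shows "perm_rank (tr a M \<circ> q) = Suc (perm_rank q)"
proof -
  have "card (orbit q a) > 0" "card (orbit q M) > 0"
    using orbit_nonempty finite_orbit_perm[OF q] by (metis card_gt_0_iff)+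
  then show ?thesis using merge_sum[OF q M, of "\<lambda>k. k - 1"] by (simp add: perm_rank_def)
qed

lemma card_cycle_set_merge:
  assumes q: "permutation q" and M: "M \<notin> orbit q a"
  shows "card (cycle_set (tr a M \<circ> q)) + of_bool (a \<in> supp q) + of_bool (M \<in> supp q) = Suc (card (cycle_set q))"
proof -
  let ?f = "\<lambda>k. of_bool (k > 1) :: nat"
  have c: "(\<Sum>C\<in>cycle_set p. ?f (card C)) = card (cycle_set p)" if "permutation p" for p :: "'a \<Rightarrow> 'a"
  proof -
    have "(\<Sum>C\<in>cycle_set p. ?f (card C)) = (\<Sum>C\<in>cycle_set p. 1)"
      using cyc_card[OF that] by (intro sum.cong) auto
    then show ?thesis by simp
  qed
  have p: "permutation (tr a M \<circ> q)" by (intro permutation_compose permutation_swap_id q)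
  have "card (orbit q a) > 0" "card (orbit q M) > 0"
    using orbit_nonempty finite_orbit_perm[OF q] by (metis card_gt_0_iff)+
  then show ?thesis using merge_sum[OF q M, of ?f] c[OF p] c[OF q]
     card_orbit_gt1[OF q, of a] card_orbit_gt1[OF q, of M]
    by (auto simp: of_bool_def split: if_splits)
qed

text \<open>The converse of merging: starting at \<open>M\<close>, the orbit under the product closes up one step before
it would reach \<open>a\<close>.\<close>

lemma orbit_split:
  assumes p: "permutation p" and aM: "a \<noteq> M" "a \<in> orbit p M"
  shows "M \<notin> orbit (tr a M \<circ> p) a"
proof -
  define q where "q = tr a M \<circ> p"
  have q: "permutation q" unfolding q_def by (intro permutation_compose permutation_swap_id p)
  define k where "k = funpow_dist p M a"
  have k: "(p ^^ k) M = a" unfolding k_def using aM by (intro funpow_dist_prop)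
  have less: "i < k \<Longrightarrow> (p ^^ i) M \<noteq> a" for i unfolding k_def by (rule funpow_dist_least)
  have neqM: "0 < i \<Longrightarrow> i \<le> k \<Longrightarrow> (p ^^ i) M \<noteq> M" for i
  proof -
    assume i: "0 < i" "i \<le> k"
    have "(p ^^ i) M \<noteq> (p ^^ 0) M"
      by (rule funpow_neq_less_funpow_dist[OF aM(2)]) (use i in \<open>auto simp: k_def\<close>)
    then show ?thesis by simp
  qed
  have kpos: "k > 0" using k aM by (cases k) auto
  have eq: "i < k \<Longrightarrow> (q ^^ i) M = (p ^^ i) M" for i
  proof (induction i)
    case (Suc i)
    then show ?case using less[of "Suc i"] neqM[of "Suc i"] by (simp add: q_def)
  qed simp
  have "(q ^^ k) M = q ((q ^^ (k-1)) M)" using kpos by (cases k) auto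
  also have "\<dots> = tr a M ((p ^^ k) M)" using eq[of "k-1"] kpos by (cases k) (auto simp: q_def)
  finally have "(q ^^ k) M = M" using k by simp
  then have "orbit q M = {(q ^^ m) M | m. m < k}" by (rule orbit_altdef_bounded[OF _ kpos])
  then have "a \<notin> orbit q M" using eq less by (smt (verit) mem_Collect_eq)
  then show ?thesis unfolding q_def[symmetric] using q by (metis orbit_eq permutation_self_in_orbit)
qed

lemma perm_rank_split:
  assumes p: "permutation p" and aM: "a \<noteq> M" "a \<in> orbit p M"
  shows "perm_rank p = Suc (perm_rank (tr a M \<circ> p))"
proof -
  have "permutation (tr a M \<circ> p)" by (intro permutation_compose permutation_swap_id p)
  from perm_rank_merge[OF this orbit_split[OF assms]] show ?thesis by (simp add: comp_assoc[symmetric])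
qed

lemma perm_rank_insert_left:
  assumes "permutation q" "q M = M" "a \<noteq> M"
  shows "perm_rank (tr a M \<circ> q) = Suc (perm_rank q)"
proof (rule perm_rank_merge[OF assms(1)])
  have "orbit q M = {M}" using assms by (simp add: orbit_eq_singleton_iff)
  then show "M \<notin> orbit q a" using assms permutation_self_in_orbit[OF assms(1), of a] orbit_eq[OF assms(1)] by (metis singletonD)
qed

lemma perm_rank_insert_right:
  assumes "permutation q" "q M = M" "a \<noteq> M"
  shows "perm_rank (q \<circ> tr a M) = Suc (perm_rank q)"
  using perm_rank_insert_left[OF assms] perm_rank_commute[OF assms(1) permutation_swap_id, of a M] by simp

section \<open>The signed sum over row and column stabilizers\<close>

text \<open>Row and column stabilizers of a tableau, when \<open>f\<close> is the row or the column of an entry. With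
constant \<open>f\<close> it is the whole symmetric group of \<open>X\<close>.\<close>

definition stab :: "nat set \<Rightarrow> (nat \<Rightarrow> nat) \<Rightarrow> (nat \<Rightarrow> nat) set" where
  "stab X f = {p. p permutes X \<and> (\<forall>x. f (p x) = f x)}"

lemma stabD: "p \<in> stab X f \<Longrightarrow> p permutes X" "p \<in> stab X f \<Longrightarrow> f (p x) = f x"
  by (auto simp: stab_def)

lemma stab_permutation: "finite X \<Longrightarrow> p \<in> stab X f \<Longrightarrow> permutation p"
  by (auto simp: stab_def permutation_permutes)

lemma finite_stab: "finite X \<Longrightarrow> finite (stab X f)"
  by (rule finite_subset[OF _ finite_permutations[of X]]) (auto simp: stab_def)

lemma stab_comp: "p \<in> stab X f \<Longrightarrow> q \<in> stab X f \<Longrightarrow> p \<circ> q \<in> stab X f"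
  by (auto simp: stab_def permutes_compose)

lemma stab_inv:
  assumes "p \<in> stab X f" shows "inv p \<in> stab X f"
proof -
  have p: "p permutes X" using assms by (simp add: stab_def)
  have "f (inv p x) = f x" for x
    using stabD(2)[OF assms, of "inv p x"] permutes_inverses(1)[OF p, of x] by simp
  then show ?thesis using p by (simp add: stab_def permutes_inv)
qed

lemma stab_id: "id \<in> stab X f" by (simp add: stab_def)

lemma stab_tr: "a \<in> X \<Longrightarrow> b \<in> X \<Longrightarrow> f a = f b \<Longrightarrow> tr a b \<in> stab X f"
  by (auto simp: stab_def permutes_swap_id Transposition.transpose_def)

lemma tr_comp_cancel [simp]: "tr a b \<circ> (tr a b \<circ> p) = p" "(p \<circ> tr a b) \<circ> tr a b = p"
  by (auto simp: fun_eq_iff)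

lemma stab_mono:
  assumes "X \<subseteq> Y" shows "stab X f \<subseteq> stab Y f"
  unfolding stab_def using permutes_subset[OF _ assms] by blast

text \<open>Cosets of the stabilizer of the point \<open>x0\<close>: the first factor is determined by the preimage of \<open>x0\<close>.\<close>

lemma stab_decompose_right:
  assumes x0: "x0 \<in> X"
  shows "bij_betw (\<lambda>(a, p). p \<circ> tr a x0) ({a\<in>X. f a = f x0} \<times> stab (X - {x0}) f) (stab X f)"
proof (rule bij_betw_byWitness[where f' = "\<lambda>p. (inv p x0, p \<circ> tr (inv p x0) x0)"])
  show "\<forall>ap\<in>{a\<in>X. f a = f x0} \<times> stab (X - {x0}) f.
    (\<lambda>p. (inv p x0, p \<circ> tr (inv p x0) x0)) ((\<lambda>(a, p). p \<circ> tr a x0) ap) = ap"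
  proof clarify
    fix a p assume p: "p \<in> stab (X - {x0}) f"
    have pp: "p permutes X - {x0}" "p x0 = x0" using stabD(1)[OF p] by (auto simp: permutes_not_in)
    have "bij (p \<circ> tr a x0)" using permutes_bij[OF pp(1)] by (intro bij_comp) auto
    then have "inv (p \<circ> tr a x0) x0 = a" by (intro inv_f_eq bij_is_inj) (auto simp: pp)
    then show "inv (p \<circ> tr a x0) x0 = a \<and> p \<circ> tr a x0 \<circ> tr (inv (p \<circ> tr a x0) x0) x0 = p" by simp
  qed
  show "\<forall>p\<in>stab X f. (\<lambda>(a, p). p \<circ> tr a x0) (inv p x0, p \<circ> tr (inv p x0) x0) = p" by simp
  show "(\<lambda>(a, p). p \<circ> tr a x0) ` ({a\<in>X. f a = f x0} \<times> stab (X - {x0}) f) \<subseteq> stab X f"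
  proof clarify
    fix a p assume "a \<in> X" "f a = f x0" "p \<in> stab (X - {x0}) f"
    then show "p \<circ> tr a x0 \<in> stab X f"
      using stab_mono[of "X - {x0}" X f] by (intro stab_comp stab_tr x0) auto
  qed
  show "(\<lambda>p. (inv p x0, p \<circ> tr (inv p x0) x0)) ` stab X f \<subseteq> {a\<in>X. f a = f x0} \<times> stab (X - {x0}) f"
  proof (rule image_subsetI)
    fix p assume p: "p \<in> stab X f"
    have pp: "p permutes X" using stabD(1)[OF p] .
    let ?a = "inv p x0"
    have a: "?a \<in> X" "f ?a = f x0" using stab_inv[OF p] x0 by (auto simp: stab_def permutes_in_image)
    have t: "p \<circ> tr ?a x0 \<in> stab X f" using stab_tr[OF a(1) x0 a(2)] p by (intro stab_comp)
    have "p \<circ> tr ?a x0 permutes X - {x0}"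
      by (rule permutes_superset[of _ X], rule stabD(1)[OF t]) (auto simp: permutes_inverses[OF pp])
    then have "p \<circ> tr ?a x0 \<in> stab (X - {x0}) f" using t unfolding stab_def by blast
    then show "(?a, p \<circ> tr ?a x0) \<in> {a\<in>X. f a = f x0} \<times> stab (X - {x0}) f"
      using a by blast
  qed
qed

text \<open>The same for cosets on the other side, by the image of \<open>x0\<close>.\<close>

lemma stab_decompose_left:
  assumes x0: "x0 \<in> X"
  shows "bij_betw (\<lambda>(b, p). tr x0 b \<circ> p) ({b\<in>X. f b = f x0} \<times> stab (X - {x0}) f) (stab X f)"
proof (rule bij_betw_byWitness[where f' = "\<lambda>p. (p x0, tr x0 (p x0) \<circ> p)"])
  show "\<forall>ap\<in>{a\<in>X. f a = f x0} \<times> stab (X - {x0}) f.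
    (\<lambda>p. (p x0, tr x0 (p x0) \<circ> p)) ((\<lambda>(b, p). tr x0 b \<circ> p) ap) = ap"
  proof clarify
    fix b p assume p: "p \<in> stab (X - {x0}) f"
    have "p x0 = x0" using stabD(1)[OF p] by (auto simp: permutes_not_in)
    then show "(tr x0 b \<circ> p) x0 = b \<and> tr x0 ((tr x0 b \<circ> p) x0) \<circ> (tr x0 b \<circ> p) = p" by simp
  qed
  show "\<forall>p\<in>stab X f. (\<lambda>(b, p). tr x0 b \<circ> p) (p x0, tr x0 (p x0) \<circ> p) = p" by simp
  show "(\<lambda>(b, p). tr x0 b \<circ> p) ` ({a\<in>X. f a = f x0} \<times> stab (X - {x0}) f) \<subseteq> stab X f"
  proof clarify
    fix b p assume "b \<in> X" "f b = f x0" "p \<in> stab (X - {x0}) f"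
    then show "tr x0 b \<circ> p \<in> stab X f"
      using stab_mono[of "X - {x0}" X f] by (intro stab_comp stab_tr x0) auto
  qed
  show "(\<lambda>p. (p x0, tr x0 (p x0) \<circ> p)) ` stab X f \<subseteq> {a\<in>X. f a = f x0} \<times> stab (X - {x0}) f"
  proof (rule image_subsetI)
    fix p assume p: "p \<in> stab X f"
    have pp: "p permutes X" using stabD(1)[OF p] .
    have a: "p x0 \<in> X" "f (p x0) = f x0" using stabD(2)[OF p, of x0] x0 permutes_in_image[OF pp] by blast+
    have t: "tr x0 (p x0) \<circ> p \<in> stab X f" by (intro stab_comp stab_tr x0 a(1) a(2)[symmetric] p)
    have "tr x0 (p x0) \<circ> p permutes X - {x0}"
      by (rule permutes_superset[of _ X], rule stabD(1)[OF t]) auto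
    then have "tr x0 (p x0) \<circ> p \<in> stab (X - {x0}) f" using t unfolding stab_def by blast
    then show "(p x0, tr x0 (p x0) \<circ> p) \<in> {a\<in>X. f a = f x0} \<times> stab (X - {x0}) f"
      using a by blast
  qed
qed

lemma stab_sum_comp_right:
  assumes "g \<in> stab X f"
  shows "(\<Sum>p\<in>stab X f. F (p \<circ> g)) = (\<Sum>p\<in>stab X f. F p)"
proof (rule sum.reindex_bij_witness[where i = "\<lambda>p. p \<circ> inv g" and j = "\<lambda>p. p \<circ> g"])
  have "g permutes X" using assms by (simp add: stab_def)
  note g = permutes_inv_o[OF this]
  fix p assume p: "p \<in> stab X f"
  show "p \<circ> g \<circ> inv g = p" "p \<circ> inv g \<circ> g = p" using g by (simp_all add: comp_assoc)
  show "p \<circ> g \<in> stab X f" "p \<circ> inv g \<in> stab X f" using p assms by (auto intro: stab_comp stab_inv)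
qed simp

lemma stab_sum_comp_left:
  assumes "g \<in> stab X f"
  shows "(\<Sum>p\<in>stab X f. F (g \<circ> p)) = (\<Sum>p\<in>stab X f. F p)"
proof (rule sum.reindex_bij_witness[where i = "\<lambda>p. inv g \<circ> p" and j = "\<lambda>p. g \<circ> p"])
  have "g permutes X" using assms by (simp add: stab_def)
  note g = permutes_inv_o[OF this]
  fix p assume p: "p \<in> stab X f"
  show "inv g \<circ> (g \<circ> p) = p" "g \<circ> (inv g \<circ> p) = p" using g by (simp_all add: comp_assoc[symmetric])
  show "g \<circ> p \<in> stab X f" "inv g \<circ> p \<in> stab X f" using p assms by (auto intro: stab_comp stab_inv)
qed simp

text \<open>The coefficient of rank \<open>r\<close> in the product of the sum over the row stabilizer and the signed sum
over the column stabilizer. It will turn out to be the scalar by which the sum of all permutations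
of rank \<open>r\<close> acts on the Specht module.\<close>

definition young_sum :: "nat set \<Rightarrow> (nat \<Rightarrow> nat) \<Rightarrow> (nat \<Rightarrow> nat) \<Rightarrow> nat \<Rightarrow> int" where
  "young_sum X rw cl r = (\<Sum>h\<in>stab X rw. \<Sum>q\<in>stab X cl. sign q * of_bool (perm_rank (h \<circ> q) = r))"

text \<open>The points \<open>a\<close>, \<open>b\<close>, \<open>d\<close> are three corners of a rectangle of boxes, \<open>d\<close> being in the row of \<open>b\<close> and the
column of \<open>a\<close>. Both ways to write \<open>(a b)\<close> as a conjugate of a transposition along a side of the
rectangle lead to the same sum for \<open>(a d) (d b)\<close>, but with opposite signs.\<close>

lemma sum_stab_vanish:
  fixes F :: "(nat \<Rightarrow> nat) \<Rightarrow> int"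
  assumes fin: "finite X" and "a \<in> X" "b \<in> X" "d \<in> X" "rw d = rw b" "cl d = cl a" "a \<noteq> b" "a \<noteq> d" "b \<noteq> d"
  shows "(\<Sum>h\<in>stab X rw. \<Sum>q\<in>stab X cl. sign q * F (h \<circ> tr a b \<circ> q)) = 0"
proof -
  let ?S = "\<lambda>s. (\<Sum>h\<in>stab X rw. \<Sum>q\<in>stab X cl. sign q * F (h \<circ> s \<circ> q))"
  have db: "tr d b \<in> stab X rw" and ad: "tr a d \<in> stab X cl" using assms by (auto intro: stab_tr)
  (* the row transposition (d b) is absorbed into h, the column transposition (a d) into q *)
  have e1: "tr a b = tr d b \<circ> (tr a d \<circ> tr d b)" and e2: "tr a b = (tr a d \<circ> tr d b) \<circ> tr a d"
    using assms by (auto simp: fun_eq_iff Transposition.transpose_def)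
  have "?S (tr a b) = (\<Sum>h\<in>stab X rw. (\<lambda>h. \<Sum>q\<in>stab X cl. sign q * F (h \<circ> (tr a d \<circ> tr d b) \<circ> q)) (h \<circ> tr d b))"
    unfolding e1 by (simp add: comp_assoc)
  also have "\<dots> = ?S (tr a d \<circ> tr d b)" by (rule stab_sum_comp_right[OF db])
  finally have 1: "?S (tr a b) = ?S (tr a d \<circ> tr d b)" .
  have "?S (tr a b) = (\<Sum>h\<in>stab X rw. \<Sum>q\<in>stab X cl. (\<lambda>q. - sign q * F (h \<circ> (tr a d \<circ> tr d b) \<circ> q)) (tr a d \<circ> q))"
    unfolding e2 using assms stab_permutation[OF fin, of _ cl]
    by (intro sum.cong refl) (simp add: comp_assoc sign_compose permutation_swap_id sign_swap_id)
  also have "\<dots> = (\<Sum>h\<in>stab X rw. \<Sum>q\<in>stab X cl. - sign q * F (h \<circ> (tr a d \<circ> tr d b) \<circ> q))"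
    by (intro sum.cong refl stab_sum_comp_left[OF ad])
  also have "\<dots> = - ?S (tr a d \<circ> tr d b)" by (simp add: sum_negf)
  finally show ?thesis using 1 by simp
qed

text \<open>Factor \<open>x0\<close> out of both stabilizers: \<open>h = h' (a x0)\<close> with \<open>a\<close> in the row of \<open>x0\<close>, and \<open>q = (x0 b) q'\<close> with \<open>b\<close>
in its column. The pair \<open>a = b = x0\<close> gives the sum without \<open>x0\<close>. If exactly one of \<open>a\<close>, \<open>b\<close> differs
from \<open>x0\<close>, the point \<open>x0\<close> is inserted into a cycle, and the rank goes up by one, with a sign for a
column. These terms count the other boxes in the row minus those in the column, that is the
content of \<open>x0\<close>. The remaining terms cancel.\<close>

lemma young_sum_remove:
  assumes fin: "finite X" and x0: "x0 \<in> X"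
    and corner: "\<And>a b. a \<in> X \<Longrightarrow> b \<in> X \<Longrightarrow> a \<noteq> x0 \<Longrightarrow> b \<noteq> x0 \<Longrightarrow> rw a = rw x0 \<Longrightarrow> cl b = cl x0 \<Longrightarrow>
       \<exists>d\<in>X. rw d = rw b \<and> cl d = cl a"
    and inj: "inj_on (\<lambda>x. (rw x, cl x)) X"
  shows "young_sum X rw cl r = young_sum (X - {x0}) rw cl r +
    (int (card {a \<in> X - {x0}. rw a = rw x0}) - int (card {b \<in> X - {x0}. cl b = cl x0})) *
      (if r = 0 then 0 else young_sum (X - {x0}) rw cl (r - 1))"
proof -
  let ?X = "X - {x0}"
  let ?R = "{a \<in> X. rw a = rw x0}" and ?C = "{b \<in> X. cl b = cl x0}"
  let ?R' = "{a \<in> ?X. rw a = rw x0}" and ?C' = "{b \<in> ?X. cl b = cl x0}"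
  define Y where "Y = (if r = 0 then 0 else young_sum ?X rw cl (r - 1))"
  have Y: "Y = (\<Sum>h\<in>stab ?X rw. \<Sum>q\<in>stab ?X cl. sign q * of_bool (Suc (perm_rank (h \<circ> q)) = r))"
    by (cases r) (auto simp: Y_def young_sum_def)
  define G where "G a b = (\<Sum>h\<in>stab ?X rw. \<Sum>q\<in>stab ?X cl.
     sign (tr x0 b \<circ> q) * of_bool (perm_rank ((h \<circ> tr a x0) \<circ> (tr x0 b \<circ> q)) = r))" for a b
  have fX: "finite ?X" using fin by simp
  note perm = stab_permutation[OF fX]
  have fixed: "p x0 = x0" if "p \<in> stab ?X f" for p f using stabD(1)[OF that] by (simp add: permutes_not_in)
  have "young_sum X rw cl r = (\<Sum>(a,h)\<in>?R \<times> stab ?X rw.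
       \<Sum>(b,q)\<in>?C \<times> stab ?X cl. sign (tr x0 b \<circ> q) * of_bool (perm_rank ((h \<circ> tr a x0) \<circ> (tr x0 b \<circ> q)) = r))"
    unfolding young_sum_def
    by (subst sum.reindex_bij_betw[OF stab_decompose_right[OF x0, of rw], symmetric],
        subst sum.reindex_bij_betw[OF stab_decompose_left[OF x0, of cl], symmetric])
       (simp add: case_prod_unfold)
  also have "\<dots> = (\<Sum>a\<in>?R. \<Sum>b\<in>?C. G a b)"
    unfolding G_def sum.cartesian_product[symmetric]
    by (rule sum.cong[OF refl], rule sum.swap)
  also have "?R = insert x0 ?R'" using x0 by auto
  also have "?C = insert x0 ?C'" using x0 by auto
  finally have 0: "young_sum X rw cl r = G x0 x0 + (\<Sum>b\<in>?C'. G x0 b) + (\<Sum>a\<in>?R'. G a x0) + (\<Sum>a\<in>?R'. \<Sum>b\<in>?C'. G a b)"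
    using fin by (simp add: sum.distrib)
  have G00: "G x0 x0 = young_sum ?X rw cl r" unfolding G_def young_sum_def by simp
  have Ga0: "G a x0 = Y" if "a \<in> ?R'" for a
    unfolding G_def Y
  proof (intro sum.cong refl)
    fix h q assume h: "h \<in> stab ?X rw" and q: "q \<in> stab ?X cl"
    have "perm_rank (h \<circ> tr a x0 \<circ> q) = perm_rank (q \<circ> h \<circ> tr a x0)"
      using perm_rank_commute[of "h \<circ> tr a x0" q] perm[OF h] perm[OF q]
      by (simp add: comp_assoc permutation_compose permutation_swap_id)
    also have "\<dots> = Suc (perm_rank (q \<circ> h))"
      by (rule perm_rank_insert_right) (use perm[OF h] perm[OF q] fixed[OF h] fixed[OF q] that in \<open>auto simp: permutation_compose\<close>)
    also have "perm_rank (q \<circ> h) = perm_rank (h \<circ> q)" using perm h q by (intro perm_rank_commute)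
    finally have "perm_rank (h \<circ> tr a x0 \<circ> q) = Suc (perm_rank (h \<circ> q))" .
    then show "sign (tr x0 x0 \<circ> q) * of_bool (perm_rank (h \<circ> tr a x0 \<circ> (tr x0 x0 \<circ> q)) = r) =
           sign q * of_bool (Suc (perm_rank (h \<circ> q)) = r)" unfolding transpose_same id_comp by simp
  qed
  have G0b: "G x0 b = - Y" if "b \<in> ?C'" for b
    unfolding G_def Y sum_negf[symmetric]
  proof (intro sum.cong refl)
    fix h q assume h: "h \<in> stab ?X rw" and q: "q \<in> stab ?X cl"
    have "perm_rank (h \<circ> (tr x0 b \<circ> q)) = perm_rank (q \<circ> h \<circ> tr b x0)"
      using perm_rank_commute[of "h \<circ> tr b x0" q] perm[OF h] perm[OF q]
      by (simp add: comp_assoc permutation_compose permutation_swap_id transpose_commute[of x0])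
    also have "\<dots> = Suc (perm_rank (q \<circ> h))"
      by (rule perm_rank_insert_right) (use perm[OF h] perm[OF q] fixed[OF h] fixed[OF q] that in \<open>auto simp: permutation_compose\<close>)
    also have "perm_rank (q \<circ> h) = perm_rank (h \<circ> q)" using perm h q by (intro perm_rank_commute)
    finally have e: "perm_rank (h \<circ> (tr x0 b \<circ> q)) = Suc (perm_rank (h \<circ> q))" .
    show "sign (tr x0 b \<circ> q) * of_bool (perm_rank (h \<circ> tr x0 x0 \<circ> (tr x0 b \<circ> q)) = r) =
           - (sign q * of_bool (Suc (perm_rank (h \<circ> q)) = r))" unfolding transpose_same comp_id e using that perm[OF q]
      by (auto simp: sign_compose permutation_swap_id sign_swap_id)
  qed
  (* (a x0) (x0 b) = (a b) (a x0), so x0 is inserted into a cycle of a product with (a b) in the middle *)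
  have Gab: "G a b = 0" if a: "a \<in> ?R'" and b: "b \<in> ?C'" for a b
  proof -
    obtain d where d: "d \<in> X" "rw d = rw b" "cl d = cl a" using corner[of a b] a b by auto
    have ne: "a \<noteq> b" using a b inj x0 by (auto simp: inj_on_def)
    have ad: "a \<noteq> d" using a b inj x0 d ne by (auto simp: inj_on_def)
    have bd: "b \<noteq> d" using a b inj x0 d ne by (auto simp: inj_on_def)
    have dx: "d \<noteq> x0" using a b inj x0 d ne by (auto simp: inj_on_def)
    have "G a b = - (\<Sum>h\<in>stab ?X rw. \<Sum>q\<in>stab ?X cl. sign q * of_bool (Suc (perm_rank (h \<circ> tr a b \<circ> q)) = r))"
      unfolding G_def sum_negf[symmetric]
    proof (intro sum.cong refl)
      fix h q assume h: "h \<in> stab ?X rw" and q: "q \<in> stab ?X cl"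
      have e: "tr a x0 \<circ> tr x0 b = tr a b \<circ> tr a x0"
        using a b ne by (auto simp: fun_eq_iff Transposition.transpose_def)
      have "perm_rank (h \<circ> tr a x0 \<circ> (tr x0 b \<circ> q)) = perm_rank (h \<circ> (tr a x0 \<circ> tr x0 b) \<circ> q)"
        by (simp add: comp_assoc)
      also have "\<dots> = perm_rank ((h \<circ> tr a b \<circ> tr a x0) \<circ> q)" unfolding e by (simp add: comp_assoc)
      also have "\<dots> = perm_rank ((q \<circ> h \<circ> tr a b) \<circ> tr a x0)" using perm h q
        by (subst perm_rank_commute) (auto simp: permutation_compose permutation_swap_id comp_assoc)
      also have "\<dots> = Suc (perm_rank (q \<circ> h \<circ> tr a b))"
        by (rule perm_rank_insert_right) (use perm[OF h] perm[OF q] fixed[OF h] fixed[OF q] a b in \<open>auto simp: permutation_compose permutation_swap_id\<close>)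
      also have "perm_rank (q \<circ> h \<circ> tr a b) = perm_rank (q \<circ> (h \<circ> tr a b))" by (simp add: comp_assoc)
      also have "\<dots> = perm_rank (h \<circ> tr a b \<circ> q)" using perm h q
        by (subst perm_rank_commute) (auto simp: permutation_compose permutation_swap_id)
      finally have e: "perm_rank (h \<circ> tr a x0 \<circ> (tr x0 b \<circ> q)) = Suc (perm_rank (h \<circ> tr a b \<circ> q))" .
      show "sign (tr x0 b \<circ> q) * of_bool (perm_rank (h \<circ> tr a x0 \<circ> (tr x0 b \<circ> q)) = r) =
           - (sign q * of_bool (Suc (perm_rank (h \<circ> tr a b \<circ> q)) = r))" unfolding e using b perm[OF q]
        by (auto simp: sign_compose permutation_swap_id sign_swap_id)
    qed
    also have "\<dots> = 0"
      using sum_stab_vanish[OF fX, of a b d rw cl "\<lambda>p. of_bool (Suc (perm_rank p) = r)"] a b d ne ad bd dx by simp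
    finally show ?thesis .
  qed
  have "(\<Sum>b\<in>?C'. G x0 b) = - int (card ?C') * Y" using G0b by simp
  moreover have "(\<Sum>a\<in>?R'. G a x0) = int (card ?R') * Y" using Ga0 by simp
  moreover have "(\<Sum>a\<in>?R'. \<Sum>b\<in>?C'. G a b) = 0" using Gab by simp
  ultimately show ?thesis unfolding 0 G00 Y_def[symmetric] by (simp add: algebra_simps)
qed

lemma esym_value_0:
  assumes "finite B" shows "esym_value 0 c B = 1"
proof -
  have "{S. S \<subseteq> B \<and> card S = 0} = {{}}" using finite_subset[OF _ assms] by auto
  then show ?thesis by (simp add: esym_value_def)
qed

text \<open>Split the subsets according to whether they contain \<open>x\<close>.\<close>

lemma esym_value_insert:
  assumes "finite B" "x \<notin> B"
  shows "esym_value (Suc r) c (insert x B) = esym_value (Suc r) c B + c x * esym_value r c B"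
proof -
  have eq: "{S. S \<subseteq> insert x B \<and> card S = Suc r} = {S. S \<subseteq> B \<and> card S = Suc r} \<union> insert x ` {S. S \<subseteq> B \<and> card S = r}"
    (is "?L = ?A \<union> ?B")
  proof (intro set_eqI iffI)
    fix S assume S: "S \<in> ?L"
    show "S \<in> ?A \<union> ?B"
    proof (cases "x \<in> S")
      case True
      then have "S = insert x (S - {x})" by auto
      moreover have "card (S - {x}) = r" "S - {x} \<subseteq> B" using S True by auto
      ultimately show ?thesis by blast
    qed (use S in auto)
  next
    fix S assume "S \<in> ?A \<union> ?B"
    then show "S \<in> ?L" using assms by (auto simp: card_insert_if finite_subset subset_iff)
  qed
  have fin: "finite {S. S \<subseteq> B \<and> P S}" for P using assms by (auto intro: finite_subset[of _ "Pow B"])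
  have inj: "inj_on (insert x) {S. S \<subseteq> B \<and> card S = r}" using assms(2) by (auto simp: inj_on_def)
  have "esym_value (Suc r) c (insert x B) = (\<Sum>S\<in>?A. prod c S) + (\<Sum>S\<in>?B. prod c S)"
    unfolding esym_value_def eq using assms fin by (intro sum.union_disjoint) auto
  also have "(\<Sum>S\<in>?B. prod c S) = (\<Sum>S\<in>{S. S \<subseteq> B \<and> card S = r}. c x * prod c S)"
    using assms by (subst sum.reindex[OF inj]) (auto intro!: sum.cong prod.insert finite_subset[OF _ assms(1)])
  finally show ?thesis by (simp add: esym_value_def sum_distrib_left)
qed

text \<open>The hypotheses say that \<open>rw\<close> and \<open>cl\<close> label \<open>X\<close> by the boxes of a Young diagram. The last box of the
last row is a corner, and its removal leaves a Young diagram, so the recursions agree.\<close>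

lemma young_sum_eq:
  assumes "finite X" "inj_on (\<lambda>x. (rw x, cl x)) X"
    and "\<And>x i j. x \<in> X \<Longrightarrow> i \<le> rw x \<Longrightarrow> j \<le> cl x \<Longrightarrow> \<exists>y\<in>X. rw y = i \<and> cl y = j"
  shows "young_sum X rw cl r = esym_value r (\<lambda>x. int (cl x) - int (rw x)) X"
  using assms
proof (induction "card X" arbitrary: X r)
  case 0
  then have X: "X = {}" by simp
  have "stab {} f = {id}" for f by (auto simp: stab_def)
  have "{S. S = {} \<and> card S = r} = (if r = 0 then {{}} else {} :: nat set set)" by auto
  then show ?case using X \<open>\<And>f. stab {} f = {id}\<close> by (auto simp: young_sum_def esym_value_def)
next
  case (Suc k)
  have ne: "X \<noteq> {}" and fin: "finite X" using Suc by auto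
  define R where "R = Max (rw ` X)"
  define C where "C = Max (cl ` {x\<in>X. rw x = R})"
  have "R \<in> rw ` X" unfolding R_def using ne fin by (intro Max_in) auto
  then have ne2: "{x\<in>X. rw x = R} \<noteq> {}" by auto
  then have "C \<in> cl ` {x\<in>X. rw x = R}" unfolding C_def using fin by (intro Max_in) auto
  then obtain x0 where x0: "x0 \<in> X" "rw x0 = R" "cl x0 = C" by auto
  have maxR: "rw x \<le> R" if "x \<in> X" for x unfolding R_def using that fin by auto
  have maxC: "cl x \<le> C" if "x \<in> X" "rw x = R" for x unfolding C_def using that fin by auto
  note inj = Suc.prems(2) and down = Suc.prems(3)
  have injD: "x = y" if "x \<in> X" "y \<in> X" "rw x = rw y" "cl x = cl y" for x y
    using inj that by (auto simp: inj_on_def)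
  let ?X = "X - {x0}"
  have card: "card ?X = k" using Suc.hyps(2) x0 fin by simp
  have down': "\<exists>y\<in>?X. rw y = i \<and> cl y = j" if ij: "x \<in> ?X" "i \<le> rw x" "j \<le> cl x" for x i j
  proof -
    obtain y where y: "y \<in> X" "rw y = i" "cl y = j" using down[of x i j] ij by blast
    have "y \<noteq> x0"
    proof
      assume "y = x0"
      then have "rw x = R" using maxR[of x] that y x0 by auto
      then have "cl x = C" using maxC[of x] that y x0 \<open>y = x0\<close> by auto
      then show False using injD[of x x0] that x0 \<open>rw x = R\<close> by auto
    qed
    then show ?thesis using y by auto
  qed
  have IH: "young_sum ?X rw cl r = esym_value r (\<lambda>x. int (cl x) - int (rw x)) ?X" for r
    using Suc.hyps(1)[of ?X r] card fin inj down' by (auto simp: inj_on_diff)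
  have cr: "card {a \<in> ?X. rw a = rw x0} = C"
  proof -
    have "bij_betw cl {a \<in> ?X. rw a = rw x0} {..<C}"
    proof (rule bij_betw_imageI)
      show "inj_on cl {a \<in> ?X. rw a = rw x0}" using injD by (auto intro!: inj_onI)
      have "cl x < C" if "x \<in> ?X" "rw x = rw x0" for x
        using maxC[of x] that x0 injD[of x x0] by fastforce
      moreover have "\<exists>x\<in>?X. rw x = rw x0 \<and> cl x = j" if j: "j < C" for j
      proof -
        obtain y where "y \<in> X" "rw y = rw x0" "cl y = j" using down[of x0 "rw x0" j] j x0 by auto
        then show ?thesis using that x0 by auto
      qed
      ultimately show "cl ` {a \<in> ?X. rw a = rw x0} = {..<C}" by (auto simp: image_iff)
    qed
    then show ?thesis using bij_betw_same_card by fastforce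
  qed
  have cc: "card {a \<in> ?X. cl a = cl x0} = R"
  proof -
    have "bij_betw rw {a \<in> ?X. cl a = cl x0} {..<R}"
    proof (rule bij_betw_imageI)
      show "inj_on rw {a \<in> ?X. cl a = cl x0}" using injD by (auto intro!: inj_onI)
      have "rw x < R" if "x \<in> ?X" "cl x = cl x0" for x
        using maxR[of x] that x0 injD[of x x0] by fastforce
      moreover have "\<exists>x\<in>?X. cl x = cl x0 \<and> rw x = j" if j: "j < R" for j
      proof -
        obtain y where "y \<in> X" "rw y = j" "cl y = cl x0" using down[of x0 j "cl x0"] j x0 by auto
        then show ?thesis using that x0 by auto
      qed
      ultimately show "rw ` {a \<in> ?X. cl a = cl x0} = {..<R}" by (auto simp: image_iff)
    qed
    then show ?thesis using bij_betw_same_card by fastforce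
  qed
  have rem: "young_sum X rw cl r = young_sum ?X rw cl r + (int C - int R) * (if r = 0 then 0 else young_sum ?X rw cl (r - 1))"
    unfolding cr[symmetric] cc[symmetric]
  proof (rule young_sum_remove[OF fin x0(1) _ inj])
    fix a b assume "a \<in> X" "b \<in> X" "a \<noteq> x0" "b \<noteq> x0" "rw a = rw x0" "cl b = cl x0"
    then show "\<exists>d\<in>X. rw d = rw b \<and> cl d = cl a"
      using down[of x0 "rw b" "cl a"] maxR[of b] maxC[of a] x0 by auto
  qed
  show ?case
  proof (cases r)
    case 0
    then show ?thesis using rem IH[of 0] fin by (simp add: esym_value_0)
  next
    case (Suc s)
    have "X = insert x0 ?X" using x0 by auto
    then have "esym_value (Suc s) (\<lambda>x. int (cl x) - int (rw x)) X = esym_value (Suc s) (\<lambda>x. int (cl x) - int (rw x)) ?X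
       + (int C - int R) * esym_value s (\<lambda>x. int (cl x) - int (rw x)) ?X"
      using esym_value_insert[of ?X x0 s "\<lambda>x. int (cl x) - int (rw x)"] fin x0 by simp
    then show ?thesis using rem IH Suc by simp
  qed
qed

section \<open>Jucys--Murphy operators\<close>

text \<open>Left multiplication by the Jucys--Murphy element \<open>J\<^sub>b = \<Sum>\<^sub>a\<^sub><\<^sub>b (a b)\<close>. Elements of the group ring of all
finitary permutations are represented by their coefficient functions, and infinite support is
harmless for this operator.\<close>

definition JM_op :: "nat \<Rightarrow> ((nat \<Rightarrow> nat) \<Rightarrow> int) \<Rightarrow> (nat \<Rightarrow> nat) \<Rightarrow> int" where
  "JM_op b f p = (\<Sum>a\<in>{1..<b}. f (tr a b \<circ> p))"

text \<open>The operator of the monomial with exponents \<open>\<beta>\<close> in \<open>J\<^sub>1, \<dots>, J\<^sub>N\<close>.\<close>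

primrec JM_prod :: "nat \<Rightarrow> (nat \<Rightarrow> nat) \<Rightarrow> ((nat \<Rightarrow> nat) \<Rightarrow> int) \<Rightarrow> (nat \<Rightarrow> nat) \<Rightarrow> int" where
  "JM_prod 0 \<beta> f = f"
| "JM_prod (Suc N) \<beta> f = (JM_op (Suc N) ^^ \<beta> (Suc N)) (JM_prod N \<beta> f)"

definition ind :: "nat set \<Rightarrow> nat \<Rightarrow> nat" where "ind S i = of_bool (i \<in> S)"

text \<open>For \<open>y < a < b\<close>, conjugation by \<open>(y a)\<close> permutes the transpositions \<open>(x b)\<close> with \<open>x < b\<close>.\<close>

lemma JM_op_commute_less:
  assumes "a < b" shows "JM_op a (JM_op b f) = JM_op b (JM_op a f)"
proof
  fix p :: "nat \<Rightarrow> nat"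
  have b: "b \<notin> {1..<a}" using assms by auto
  have e: "tr y a \<circ> (tr x b \<circ> p) = tr (tr y a x) b \<circ> (tr y a \<circ> p)" if "y \<in> {1..<a}" "x \<in> {1..<b}" for x y
    using that assms by (auto simp: fun_eq_iff Transposition.transpose_def)
  have "JM_op b (JM_op a f) p = (\<Sum>y\<in>{1..<a}. \<Sum>x\<in>{1..<b}. f (tr y a \<circ> (tr x b \<circ> p)))"
    unfolding JM_op_def by (rule sum.swap)
  also have "\<dots> = (\<Sum>y\<in>{1..<a}. \<Sum>x\<in>{1..<b}. f (tr (tr y a x) b \<circ> (tr y a \<circ> p)))"
    by (intro sum.cong refl) (simp add: e)
  also have "\<dots> = (\<Sum>y\<in>{1..<a}. \<Sum>x\<in>{1..<b}. f (tr x b \<circ> (tr y a \<circ> p)))"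
  proof (rule sum.cong[OF refl])
    fix y assume y: "y \<in> {1..<a}"
    have "bij_betw (tr y a) {1..<b} {1..<b}" using y assms by (intro bij_betw_transpose_iff) auto
    then show "(\<Sum>x\<in>{1..<b}. f (tr (tr y a x) b \<circ> (tr y a \<circ> p))) = (\<Sum>x\<in>{1..<b}. f (tr x b \<circ> (tr y a \<circ> p)))"
      by (rule sum.reindex_bij_betw)
  qed
  finally show "JM_op a (JM_op b f) p = JM_op b (JM_op a f) p" by (simp add: JM_op_def)
qed

lemma JM_op_commute: "JM_op a (JM_op b f) = JM_op b (JM_op a f)"
  using JM_op_commute_less[of a b f] JM_op_commute_less[of b a f] by (metis nat_neq_iff)

lemma JM_op_pow_commute: "(JM_op a ^^ k) (JM_op b f) = JM_op b ((JM_op a ^^ k) f)"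
  by (induction k) (simp_all add: JM_op_commute[of a b])

lemma JM_op_pow_pow_commute: "(JM_op a ^^ k) ((JM_op b ^^ l) f) = (JM_op b ^^ l) ((JM_op a ^^ k) f)"
  by (induction l) (simp_all add: JM_op_pow_commute)

lemma JM_prod_JM_op_commute: "JM_prod N \<beta> ((JM_op b ^^ k) f) = (JM_op b ^^ k) (JM_prod N \<beta> f)"
  by (induction N) (simp_all add: JM_op_pow_pow_commute)

lemma JM_prod_add: "JM_prod N \<beta> (JM_prod N \<gamma> f) = JM_prod N (\<lambda>i. \<beta> i + \<gamma> i) f"
proof (induction N)
  case (Suc N)
  then show ?case by (simp add: JM_prod_JM_op_commute funpow_add) (rule JM_op_pow_pow_commute)
qed simp

lemma JM_prod_cong: "(\<And>i. i \<in> {1..N} \<Longrightarrow> \<beta> i = \<gamma> i) \<Longrightarrow> JM_prod N \<beta> f = JM_prod N \<gamma> f"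
  by (induction N) simp_all

lemma JM_op_linear: "JM_op b (\<lambda>p. \<Sum>i\<in>I. c i * f i p) = (\<lambda>p. \<Sum>i\<in>I. c i * JM_op b (f i) p)"
proof
  fix p
  have "JM_op b (\<lambda>p. \<Sum>i\<in>I. c i * f i p) p = (\<Sum>i\<in>I. \<Sum>a\<in>{1..<b}. c i * f i (tr a b \<circ> p))"
    unfolding JM_op_def by (rule sum.swap)
  then show "JM_op b (\<lambda>p. \<Sum>i\<in>I. c i * f i p) p = (\<Sum>i\<in>I. c i * JM_op b (f i) p)"
    by (simp add: JM_op_def sum_distrib_left)
qed

lemma JM_op_pow_linear: "(JM_op b ^^ k) (\<lambda>p. \<Sum>i\<in>I. c i * f i p) = (\<lambda>p. \<Sum>i\<in>I. c i * (JM_op b ^^ k) (f i) p)"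
  by (induction k) (simp_all add: JM_op_linear)

lemma JM_prod_linear: "JM_prod N \<beta> (\<lambda>p. \<Sum>i\<in>I. c i * f i p) = (\<lambda>p. \<Sum>i\<in>I. c i * JM_prod N \<beta> (f i) p)"
  by (induction N) (simp_all add: JM_op_pow_linear)

lemma JM_prod_zero: "(\<And>i. i \<in> {1..N} \<Longrightarrow> \<beta> i = 0) \<Longrightarrow> JM_prod N \<beta> f = f"
  by (induction N) simp_all

lemma JM_prod_single: "M \<in> {1..N} \<Longrightarrow> JM_prod N (ind {M}) f = JM_op M f"
proof (induction N)
  case (Suc N)
  show ?case
  proof (cases "M = Suc N")
    case True
    then show ?thesis using JM_prod_zero[of N "\<lambda>a. of_bool (a = Suc N)" f] by (simp add: ind_def[abs_def])
  qed (use Suc in \<open>auto simp: ind_def\<close>)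
qed simp

lemma JM_prod_peel:
  assumes "M \<in> {1..N}" "\<beta> M > 0"
  shows "JM_prod N \<beta> f = JM_op M (JM_prod N (\<lambda>i. \<beta> i - ind {M} i) f)"
proof -
  have "JM_prod N \<beta> f = JM_prod N (\<lambda>i. ind {M} i + (\<beta> i - ind {M} i)) f"
    by (rule JM_prod_cong) (use assms in \<open>auto simp: ind_def\<close>)
  then show ?thesis using JM_prod_add JM_prod_single[OF assms(1)] by metis
qed

text \<open>Left multiplication by the sum of all permutations of rank \<open>r\<close> in \<open>S\<^sub>N\<close>.\<close>

definition rank_op :: "nat \<Rightarrow> nat \<Rightarrow> ((nat \<Rightarrow> nat) \<Rightarrow> int) \<Rightarrow> (nat \<Rightarrow> nat) \<Rightarrow> int" where
  "rank_op N r f p = (\<Sum>q | q permutes {1..N}. of_bool (perm_rank q = r) * f (inv q \<circ> p))"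

lemma permutes_atLeastAtMost_permutation: "p permutes {1..n} \<Longrightarrow> permutation p" for p :: "nat \<Rightarrow> nat"
  by (meson finite_atLeastAtMost permutes_imp_permutation)

text \<open>A permutation of \<open>{1..N+1}\<close> is uniquely \<open>(N+1 b) q\<close> with \<open>q\<close> in \<open>S\<^sub>N\<close>, and it has the rank of \<open>q\<close>, plus one
if \<open>b \<noteq> N+1\<close>.\<close>

lemma rank_op_Suc:
  "rank_op (Suc N) r f p = rank_op N r f p + (if r = 0 then 0 else JM_op (Suc N) (rank_op N (r - 1) f) p)"
proof -
  let ?M = "Suc N"
  have X: "stab X (\<lambda>_. 0) = {q. q permutes X}" for X by (auto simp: stab_def)
  have e: "{1..?M} - {?M} = {1..N}" by auto
  have bij: "bij_betw (\<lambda>(b, q). tr ?M b \<circ> q) ({1..?M} \<times> {q. q permutes {1..N}}) {q. q permutes {1..?M}}"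
    using stab_decompose_left[of ?M "{1..?M}" "\<lambda>_. 0"] unfolding X e by (simp only: simp_thms Collect_mem_eq) simp
  have t: "of_bool (perm_rank (tr ?M b \<circ> q) = r) * f (inv (tr ?M b \<circ> q) \<circ> p) =
     of_bool (perm_rank q + of_bool (b \<noteq> ?M) = r) * f (inv q \<circ> (tr b ?M \<circ> p))"
    if "q permutes {1..N}" for b q
  proof -
    have pq: "permutation q" using that by (rule permutes_atLeastAtMost_permutation)
    have "q ?M = ?M" using that by (simp add: permutes_not_in)
    then have "perm_rank (tr ?M b \<circ> q) = perm_rank q + of_bool (b \<noteq> ?M)"
      using perm_rank_insert_left[OF pq, of ?M b] by (cases "b = ?M") (auto simp: transpose_commute)
    moreover have "inv (tr ?M b \<circ> q) = inv q \<circ> tr b ?M"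
      using o_inv_distrib[of "tr ?M b" q] permutes_bij[OF that] by (simp add: transpose_commute)
    ultimately show ?thesis by (simp add: comp_assoc)
  qed
  have "rank_op ?M r f p = (\<Sum>b\<in>{1..?M}. \<Sum>q | q permutes {1..N}. of_bool (perm_rank q + of_bool (b \<noteq> ?M) = r) * f (inv q \<circ> (tr b ?M \<circ> p)))"
    unfolding rank_op_def sum.reindex_bij_betw[OF bij, symmetric] sum.cartesian_product
    by (intro sum.cong refl) (auto simp only: mem_Times_iff split_beta fst_conv snd_conv mem_Collect_eq t)
  also have "{1..?M} = insert ?M {1..<?M}" by auto
  also have "(\<Sum>b\<in>insert ?M {1..<?M}. \<Sum>q | q permutes {1..N}. of_bool (perm_rank q + of_bool (b \<noteq> ?M) = r) * f (inv q \<circ> (tr b ?M \<circ> p)))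
    = rank_op N r f p + (\<Sum>b\<in>{1..<?M}. \<Sum>q | q permutes {1..N}. of_bool (Suc (perm_rank q) = r) * f (inv q \<circ> (tr b ?M \<circ> p)))"
    by (simp add: rank_op_def)
  also have "(\<Sum>b\<in>{1..<?M}. \<Sum>q | q permutes {1..N}. of_bool (Suc (perm_rank q) = r) * f (inv q \<circ> (tr b ?M \<circ> p))) =
     (if r = 0 then 0 else JM_op ?M (rank_op N (r - 1) f) p)"
    by (cases r) (auto simp: JM_op_def rank_op_def)
  finally show ?thesis .
qed

lemma subsets_Suc: "{S. S \<subseteq> {1..Suc N} \<and> P S} = {S. S \<subseteq> {1..N} \<and> P S} \<union> insert (Suc N) ` {S. S \<subseteq> {1..N} \<and> P (insert (Suc N) S)}"
proof (intro set_eqI iffI)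
  fix S assume S: "S \<in> {S. S \<subseteq> {1..Suc N} \<and> P S}"
  show "S \<in> {S. S \<subseteq> {1..N} \<and> P S} \<union> insert (Suc N) ` {S. S \<subseteq> {1..N} \<and> P (insert (Suc N) S)}"
  proof (cases "Suc N \<in> S")
    case True
    then have e: "S = insert (Suc N) (S - {Suc N})" by auto
    have "S - {Suc N} \<subseteq> {1..N}" using S by (auto simp: le_Suc_eq subset_iff)
    then show ?thesis using S e by (metis (mono_tags, lifting) UnCI image_eqI mem_Collect_eq)
  next
    case False
    then have "S \<subseteq> {1..N}" using S by (auto simp: le_Suc_eq subset_iff)
    then show ?thesis using S by auto
  qed
qed auto

text \<open>The theorem of Jucys: both sides satisfy the recursion of the elementary symmetric functions
when the variable \<open>J\<^sub>N\<^sub>+\<^sub>1\<close> is added.\<close>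

lemma rank_op_eq_JM_prod:
  "rank_op N r f p = (\<Sum>S | S \<subseteq> {1..N} \<and> card S = r. JM_prod N (ind S) f p)"
proof (induction N arbitrary: r p)
  case 0
  have e: "{S. S = {} \<and> card S = r} = (if r = 0 then {{}} else {} :: nat set set)" by auto
  show ?case by (auto simp: rank_op_def e)
next
  case (Suc N)
  have fin: "finite {S. S \<subseteq> {1..N} \<and> P S}" for P by (auto intro: finite_subset[of _ "Pow {1..N}"])
  have inj: "inj_on (insert (Suc N)) {S. S \<subseteq> {1..N} \<and> P S}" for P
  proof (rule inj_onI)
    fix A B assume "A \<in> {S. S \<subseteq> {1..N} \<and> P S}" "B \<in> {S. S \<subseteq> {1..N} \<and> P S}" "insert (Suc N) A = insert (Suc N) B"
    moreover from this have "Suc N \<notin> A" "Suc N \<notin> B" by auto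
    ultimately show "A = B" by (simp add: insert_ident)
  qed
  have "(\<Sum>S | S \<subseteq> {1..Suc N} \<and> card S = r. JM_prod (Suc N) (ind S) f p) =
    (\<Sum>S | S \<subseteq> {1..N} \<and> card S = r. JM_prod (Suc N) (ind S) f p) +
    (\<Sum>S\<in>insert (Suc N) ` {S. S \<subseteq> {1..N} \<and> card (insert (Suc N) S) = r}. JM_prod (Suc N) (ind S) f p)"
    unfolding subsets_Suc by (rule sum.union_disjoint) (use fin in auto)
  also have "(\<Sum>S | S \<subseteq> {1..N} \<and> card S = r. JM_prod (Suc N) (ind S) f p) = rank_op N r f p"
    unfolding Suc.IH by (intro sum.cong refl) (auto simp: ind_def)
  also have "(\<Sum>S\<in>insert (Suc N) ` {S. S \<subseteq> {1..N} \<and> card (insert (Suc N) S) = r}. JM_prod (Suc N) (ind S) f p) =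
     (\<Sum>S | S \<subseteq> {1..N} \<and> card (insert (Suc N) S) = r. JM_prod (Suc N) (ind (insert (Suc N) S)) f p)"
    by (subst sum.reindex[OF inj]) simp
  also have "\<dots> = (\<Sum>S | S \<subseteq> {1..N} \<and> card (insert (Suc N) S) = r. JM_op (Suc N) (JM_prod N (ind S) f) p)"
  proof (intro sum.cong refl)
    fix S :: "nat set"
    have "JM_prod N (ind (insert (Suc N) S)) f = JM_prod N (ind S) f" by (rule JM_prod_cong) (auto simp: ind_def)
    then show "JM_prod (Suc N) (ind (insert (Suc N) S)) f p = JM_op (Suc N) (JM_prod N (ind S) f) p" by (simp add: ind_def)
  qed
  also have "\<dots> = (if r = 0 then 0 else JM_op (Suc N) (rank_op N (r - 1) f) p)"
  proof (cases r)
    case 0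
    have "card (insert (Suc N) S) \<noteq> 0" if "S \<subseteq> {1..N}" for S using that finite_subset[OF that] by auto
    then have e: "{S. S \<subseteq> {1..N} \<and> card (insert (Suc N) S) = r} = {}" using 0 by auto
    show ?thesis unfolding e using 0 by simp
  next
    case (Suc s)
    have c: "card (insert (Suc N) S) = Suc (card S)" if "S \<subseteq> {1..N}" for S
    proof -
      have "Suc N \<notin> S" using that by auto
      then show ?thesis using finite_subset[OF that] by simp
    qed
    have e: "{S. S \<subseteq> {1..N} \<and> card (insert (Suc N) S) = r} = {S. S \<subseteq> {1..N} \<and> card S = s}"
      using c Suc by auto
    have g: "rank_op N s f = (\<lambda>p. \<Sum>S | S \<subseteq> {1..N} \<and> card S = s. 1 * JM_prod N (ind S) f p)"
      using Suc.IH by (auto simp: fun_eq_iff)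
    show ?thesis unfolding e using Suc g JM_op_linear[of "Suc N" "\<lambda>_. 1" "\<lambda>S. JM_prod N (ind S) f"] by simp
  qed
  finally show ?case unfolding rank_op_Suc by simp
qed

section \<open>Products of elementary symmetric functions in the Jucys--Murphy operators\<close>

definition exponents :: "nat \<Rightarrow> nat \<Rightarrow> (nat \<Rightarrow> nat) set" where
  "exponents N d = {\<beta>. (\<forall>i. i \<notin> {1..N} \<longrightarrow> \<beta> i = 0) \<and> sum \<beta> {1..N} = d}"

lemma finite_exponents: "finite (exponents N d)"
proof (rule finite_subset)
  show "exponents N d \<subseteq> {f. \<forall>x. (x \<in> {1..N} \<longrightarrow> f x \<in> {0..d}) \<and> (x \<notin> {1..N} \<longrightarrow> f x = 0)}"
    unfolding exponents_def by (auto intro: member_le_sum)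
qed (rule finite_set_of_finite_funs; simp)

text \<open>The coefficient of the monomial with exponents \<open>\<beta>\<close> in the product of the elementary symmetric
functions with indices \<open>rs\<close>: choose a squarefree monomial of degree \<open>r\<close>, for every \<open>r\<close>.\<close>

fun elem_coeff :: "nat list \<Rightarrow> (nat \<Rightarrow> nat) \<Rightarrow> int" where
  "elem_coeff [] \<beta> = of_bool (\<forall>i. \<beta> i = 0)"
| "elem_coeff (r # rs) \<beta> = (\<Sum>S | S \<subseteq> {i. \<beta> i > 0} \<and> card S = r. elem_coeff rs (\<lambda>i. \<beta> i - ind S i))"

definition delta :: "(nat \<Rightarrow> nat) \<Rightarrow> int" where "delta p = of_bool (p = id)"

lemma exponents_supp: "\<beta> \<in> exponents N d \<Longrightarrow> {i. \<beta> i > 0} \<subseteq> {1..N}"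
  by (force simp: exponents_def)

lemma sum_ind: "S \<subseteq> {1..N} \<Longrightarrow> sum (ind S) {1..N} = card S"
  unfolding ind_def by (simp add: Int_absorb1 of_bool_def sum.If_cases)

lemma exponents_add_ind: "\<beta> \<in> exponents N d \<Longrightarrow> S \<subseteq> {1..N} \<Longrightarrow> (\<lambda>i. ind S i + \<beta> i) \<in> exponents N (card S + d)"
  using sum_ind by (auto simp: exponents_def sum.distrib ind_def)

lemma exponents_diff_ind:
  assumes "\<beta> \<in> exponents N d" "S \<subseteq> {i. \<beta> i > 0}" "card S + e = d"
  shows "(\<lambda>i. \<beta> i - ind S i) \<in> exponents N e"
proof -
  have S: "S \<subseteq> {1..N}" using assms exponents_supp by blast
  have le: "ind S i \<le> \<beta> i" for i using assms(2) by (auto simp: ind_def of_bool_def)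
  have "sum (\<lambda>i. ind S i + (\<beta> i - ind S i)) {1..N} = sum \<beta> {1..N}"
    using le by (intro sum.cong) auto
  then show ?thesis using assms sum_ind[OF S] by (auto simp: exponents_def sum.distrib)
qed

text \<open>Expand the product of elementary symmetric functions of the commuting Jucys--Murphy operators
into monomials.\<close>

lemma foldr_rank_op:
  "foldr (rank_op N) rs delta p = (\<Sum>\<beta>\<in>exponents N (sum_list rs). elem_coeff rs \<beta> * JM_prod N \<beta> delta p)"
proof (induction rs arbitrary: p)
  case Nil
  have e: "exponents N 0 = {\<lambda>_. 0}" by (fastforce simp: exponents_def fun_eq_iff)
  show ?case by (simp add: e JM_prod_zero)
next
  case (Cons r rs)
  let ?d = "sum_list rs"
  have f: "foldr (rank_op N) rs delta = (\<lambda>p. \<Sum>\<beta>\<in>exponents N ?d. elem_coeff rs \<beta> * JM_prod N \<beta> delta p)"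
    using Cons by auto
  have fin: "finite {S. S \<subseteq> {1..N} \<and> P S}" for P by (auto intro: finite_subset[of _ "Pow {1..N}"])
  have "foldr (rank_op N) (r # rs) delta p = (\<Sum>S | S \<subseteq> {1..N} \<and> card S = r. \<Sum>\<beta>\<in>exponents N ?d. elem_coeff rs \<beta> * JM_prod N (\<lambda>i. ind S i + \<beta> i) delta p)"
    by (simp add: f rank_op_eq_JM_prod JM_prod_linear JM_prod_add)
  also have "\<dots> = (\<Sum>(S,\<beta>)\<in>{S. S \<subseteq> {1..N} \<and> card S = r} \<times> exponents N ?d. elem_coeff rs \<beta> * JM_prod N (\<lambda>i. ind S i + \<beta> i) delta p)"
    by (rule sum.cartesian_product)
  also have "\<dots> = (\<Sum>(\<gamma>,S)\<in>(SIGMA \<gamma>:exponents N (r + ?d). {S. S \<subseteq> {i. \<gamma> i > 0} \<and> card S = r}).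
     elem_coeff rs (\<lambda>i. \<gamma> i - ind S i) * JM_prod N \<gamma> delta p)"
  proof (rule sum.reindex_bij_witness[where i = "\<lambda>(\<gamma>,S). (S, \<lambda>i. \<gamma> i - ind S i)" and j = "\<lambda>(S,\<beta>). (\<lambda>i. ind S i + \<beta> i, S)"])
    fix x assume "x \<in> {S. S \<subseteq> {1..N} \<and> card S = r} \<times> exponents N ?d"
    then obtain S \<beta> where x: "x = (S, \<beta>)" "S \<subseteq> {1..N}" "card S = r" "\<beta> \<in> exponents N ?d" by auto
    show "(case case x of (S, \<beta>) \<Rightarrow> (\<lambda>i. ind S i + \<beta> i, S) of (\<gamma>, S) \<Rightarrow> (S, \<lambda>i. \<gamma> i - ind S i)) = x"
      by (simp add: x)
    have "S \<subseteq> {i. 0 < ind S i + \<beta> i}" by (auto simp: ind_def)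
    then show "(case x of (S, \<beta>) \<Rightarrow> (\<lambda>i. ind S i + \<beta> i, S)) \<in> (SIGMA \<gamma>:exponents N (r + ?d). {S. S \<subseteq> {i. \<gamma> i > 0} \<and> card S = r})"
      using exponents_add_ind[OF x(4,2)] x by simp
    show "(case case x of (S, \<beta>) \<Rightarrow> (\<lambda>i. ind S i + \<beta> i, S) of (\<gamma>, S) \<Rightarrow> elem_coeff rs (\<lambda>i. \<gamma> i - ind S i) * JM_prod N \<gamma> delta p) =
      (case x of (S, \<beta>) \<Rightarrow> elem_coeff rs \<beta> * JM_prod N (\<lambda>i. ind S i + \<beta> i) delta p)" by (simp add: x)
  next
    fix x assume "x \<in> (SIGMA \<gamma>:exponents N (r + ?d). {S. S \<subseteq> {i. \<gamma> i > 0} \<and> card S = r})"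
    then obtain \<gamma> S where x: "x = (\<gamma>, S)" "\<gamma> \<in> exponents N (r + ?d)" "S \<subseteq> {i. \<gamma> i > 0}" "card S = r" by auto
    have e: "(\<lambda>i. ind S i + (\<gamma> i - ind S i)) = \<gamma>" using x(3) by (auto simp: fun_eq_iff ind_def of_bool_def)
    show "(case case x of (\<gamma>, S) \<Rightarrow> (S, \<lambda>i. \<gamma> i - ind S i) of (S, \<beta>) \<Rightarrow> (\<lambda>i. ind S i + \<beta> i, S)) = x"
      by (simp add: x e)
    show "(case x of (\<gamma>, S) \<Rightarrow> (S, \<lambda>i. \<gamma> i - ind S i)) \<in> {S. S \<subseteq> {1..N} \<and> card S = r} \<times> exponents N ?d"
      using exponents_diff_ind[OF x(2,3), of ?d] exponents_supp[OF x(2)] x by auto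
  qed
  also have "\<dots> = (\<Sum>\<gamma>\<in>exponents N (r + ?d). \<Sum>S | S \<subseteq> {i. \<gamma> i > 0} \<and> card S = r. elem_coeff rs (\<lambda>i. \<gamma> i - ind S i) * JM_prod N \<gamma> delta p)"
    by (rule sum.Sigma[symmetric]) (auto simp: finite_exponents intro: finite_subset[OF _ fin[of "\<lambda>S. card S = r"]] dest: exponents_supp)
  finally show ?case by (simp add: sum_distrib_right)
qed

section \<open>Minimal factorizations into transpositions\<close>

definition exponent_type :: "nat \<Rightarrow> (nat \<Rightarrow> nat) \<Rightarrow> nat multiset" where
  "exponent_type N \<beta> = filter_mset (\<lambda>k. k \<noteq> 0) (image_mset \<beta> (mset_set {1..N}))"

lemma exponent_type_altdef: "exponent_type N \<beta> = image_mset \<beta> (mset_set {i\<in>{1..N}. \<beta> i \<noteq> 0})"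
  by (simp add: exponent_type_def filter_mset_image_mset filter_mset_mset_set)

lemma sum_mset_exponent_type: "sum_mset (exponent_type N \<beta>) = sum \<beta> {1..N}"
proof -
  have "sum_mset (exponent_type N \<beta>) = sum \<beta> {i\<in>{1..N}. \<beta> i \<noteq> 0}"
    unfolding exponent_type_altdef by (simp add: sum_unfold_sum_mset)
  also have "\<dots> = sum \<beta> {1..N}" by (rule sum.mono_neutral_left) auto
  finally show ?thesis .
qed

lemma size_exponent_type: "\<beta> \<in> exponents N d \<Longrightarrow> size (exponent_type N \<beta>) = card {i. \<beta> i > 0}"
proof -
  assume "\<beta> \<in> exponents N d"
  then have "{i\<in>{1..N}. \<beta> i \<noteq> 0} = {i. \<beta> i > 0}" by (force simp: exponents_def)
  then show ?thesis by (simp add: exponent_type_altdef)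
qed

text \<open>The exponents of the only Jucys--Murphy monomial in the equality case below: every cycle
contributes its rank at its maximal element, and other points contribute nothing.\<close>

definition max_exponent :: "(nat \<Rightarrow> nat) \<Rightarrow> nat \<Rightarrow> nat" where
  "max_exponent p b = (if Max (orbit p b) = b then card (orbit p b) - 1 else 0)"

lemma Max_orbit:
  assumes "permutation p" shows "Max (orbit p x) \<in> orbit p x" "orbit p (Max (orbit p x)) = orbit p x"
proof -
  show "Max (orbit p x) \<in> orbit p x" using assms by (intro Max_in finite_orbit_perm orbit_nonempty)
  then show "orbit p (Max (orbit p x)) = orbit p x" by (rule orbit_eq[OF assms])
qed

lemma max_exponent_supp:
  assumes "permutation p"
  shows "{b. max_exponent p b > 0} = Max ` cycle_set p" "inj_on Max (cycle_set p)"
    "C \<in> cycle_set p \<Longrightarrow> max_exponent p (Max C) = card C - 1"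
proof -
  have C: "C = orbit p (Max C) \<and> Max C \<in> supp p" if C: "C \<in> cycle_set p" for C
  proof -
    obtain x where "x \<in> supp p" "C = orbit p x" using C by (auto simp: cycle_set_def)
    then have "Max C \<in> C" "C = orbit p (Max C)" using Max_orbit[OF assms] by auto
    then show ?thesis using cyc_setE(2)[OF C assms] by blast
  qed
  show "inj_on Max (cycle_set p)" using C by (metis inj_onI)
  show 1: "C \<in> cycle_set p \<Longrightarrow> max_exponent p (Max C) = card C - 1" for C
    using C by (metis max_exponent_def)
  show "{b. max_exponent p b > 0} = Max ` cycle_set p"
  proof (intro set_eqI iffI)
    fix b assume "b \<in> {b. max_exponent p b > 0}"
    then have "Max (orbit p b) = b" "card (orbit p b) > 1" by (auto simp: max_exponent_def split: if_splits)
    then show "b \<in> Max ` cycle_set p" using orbit_in_cycle_set[OF assms] card_orbit_gt1[OF assms] by (metis imageI)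
  next
    fix b assume "b \<in> Max ` cycle_set p"
    then show "b \<in> {b. max_exponent p b > 0}" using 1 cyc_card[OF assms] by fastforce
  qed
qed

lemma card_max_exponent_supp: "permutation p \<Longrightarrow> card {b. max_exponent p b > 0} = card (cycle_set p)"
  by (simp add: max_exponent_supp card_image)

lemma exponent_type_max_exponent:
  assumes "p permutes {1..N}" shows "exponent_type N (max_exponent p) = reduced_type p"
    "max_exponent p \<in> exponents N (perm_rank p)"
proof -
  have p: "permutation p" using assms by (rule permutes_atLeastAtMost_permutation)
  have sub: "{b. max_exponent p b > 0} \<subseteq> {1..N}"
  proof -
    have "b \<in> supp p" if "max_exponent p b > 0" for b
      using that card_orbit_gt1[OF p, of b] by (auto simp: max_exponent_def split: if_splits)
    then show ?thesis using supp_subset_iff[OF p] assms by blast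
  qed
  then have e: "{i\<in>{1..N}. max_exponent p i \<noteq> 0} = Max ` cycle_set p" using max_exponent_supp(1)[OF p] by auto
  show 1: "exponent_type N (max_exponent p) = reduced_type p"
    unfolding exponent_type_altdef e reduced_type_def image_mset_mset_set[OF max_exponent_supp(2)[OF p], symmetric]
      multiset.map_comp comp_def
    using max_exponent_supp(3)[OF p] finite_cycle_set[OF p] by (intro image_mset_cong) auto
  show "max_exponent p \<in> exponents N (perm_rank p)"
    using sub sum_mset_exponent_type[of N "max_exponent p"] unfolding 1 perm_rank_eq exponents_def by force
qed

text \<open>A nonzero coefficient comes from a factorization, and \<open>(a M)\<close> is its first transposition.\<close>

lemma JM_prod_nonzero_peel:
  assumes "M \<in> {1..N}" "\<beta> M > 0" "JM_prod N \<beta> f p \<noteq> 0"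
  obtains a where "a \<in> {1..<M}" "JM_prod N (\<lambda>i. \<beta> i - ind {M} i) f (tr a M \<circ> p) \<noteq> 0"
proof -
  have "(\<Sum>a\<in>{1..<M}. JM_prod N (\<lambda>i. \<beta> i - ind {M} i) f (tr a M \<circ> p)) \<noteq> 0"
    using JM_prod_peel[where \<beta> = \<beta> and M = M, OF assms(1,2), of f] assms(3) by (simp add: JM_op_def)
  then show ?thesis using that by (meson sum.neutral)
qed

lemma exponents_peel:
  assumes "\<beta> \<in> exponents N (Suc d)"
  obtains M where "M \<in> {1..N}" "\<beta> M > 0" "\<And>i. i > M \<Longrightarrow> \<beta> i = 0"
    "(\<lambda>i. \<beta> i - ind {M} i) \<in> exponents N d"
proof -
  define S where "S = {i. \<beta> i > 0}"
  have sub: "S \<subseteq> {1..N}" using exponents_supp[OF assms] by (simp add: S_def)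
  then have fin: "finite S" by (rule finite_subset) simp
  have "S \<noteq> {}"
  proof
    assume "S = {}"
    then have "sum \<beta> {1..N} = 0" by (auto simp: S_def)
    then show False using assms by (simp add: exponents_def)
  qed
  then obtain M where M: "M = Max S" "M \<in> S" using fin Max_in by blast
  show ?thesis
  proof (rule that)
    show "M \<in> {1..N}" "\<beta> M > 0" using M(2) sub by (auto simp: S_def)
    show "\<beta> i = 0" if "i > M" for i
    proof (rule ccontr)
      assume "\<beta> i \<noteq> 0"
      then have "i \<in> S" by (simp add: S_def)
      then show False using Max_ge[OF fin] that M(1) by fastforce
    qed
    show "(\<lambda>i. \<beta> i - ind {M} i) \<in> exponents N d"
      by (rule exponents_diff_ind[OF assms]) (use M in \<open>auto simp: S_def\<close>)
  qed
qed

lemma exponents_0: "\<beta> \<in> exponents N 0 \<Longrightarrow> \<beta> = (\<lambda>_. 0)"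
proof
  fix i assume "\<beta> \<in> exponents N 0" then show "\<beta> i = 0" by (cases "i \<in> {1..N}") (auto simp: exponents_def)
qed

lemma tr_comp_permutes:
  assumes "tr a M \<circ> p permutes S" "a \<in> S" "M \<in> S" shows "p permutes S"
proof -
  have "tr a M \<circ> (tr a M \<circ> p) permutes S" by (rule permutes_compose[OF assms(1) permutes_swap_id[OF assms(2,3)]])
  then show ?thesis unfolding tr_comp_cancel .
qed

text \<open>A product of \<open>d\<close> transpositions of points of \<open>{1..K}\<close> permutes these points and has rank at most \<open>d\<close>.\<close>

lemma JM_prod_nonzero_permutes:
  assumes "\<beta> \<in> exponents N d" "\<And>i. i > K \<Longrightarrow> \<beta> i = 0" "JM_prod N \<beta> delta p \<noteq> 0"
  shows "p permutes {1..K} \<and> perm_rank p \<le> d"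
  using assms
proof (induction d arbitrary: \<beta> p)
  case 0
  then have "JM_prod N \<beta> delta = delta" using exponents_0 by (intro JM_prod_zero) auto
  then have "delta p \<noteq> 0" using 0(3) by simp
  then have "p = id" by (simp add: delta_def)
  then show ?case by (metis permutes_id perm_rank_id le_refl)
next
  case (Suc d)
  obtain M where M: "M \<in> {1..N}" "\<beta> M > 0" "(\<lambda>i. \<beta> i - ind {M} i) \<in> exponents N d"
    using exponents_peel[OF Suc.prems(1)] by metis
  obtain a where a: "a \<in> {1..<M}" "JM_prod N (\<lambda>i. \<beta> i - ind {M} i) delta (tr a M \<circ> p) \<noteq> 0"
    using JM_prod_nonzero_peel[where \<beta> = \<beta> and M = M, OF M(1,2) Suc.prems(3)] .
  have MK: "M \<le> K" using M(2) Suc.prems(2)[of M] by (cases "M \<le> K") auto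
  have "tr a M \<circ> p permutes {1..K} \<and> perm_rank (tr a M \<circ> p) \<le> d"
    by (rule Suc.IH[OF M(3) _ a(2)]) (simp add: Suc.prems(2))
  then have IH: "tr a M \<circ> p permutes {1..K}" "perm_rank (tr a M \<circ> p) \<le> d" by blast+
  have p: "p permutes {1..K}" by (rule tr_comp_permutes[OF IH(1)]) (use MK a(1) in auto)
  then have pp: "permutation p" "permutation (tr a M \<circ> p)"
    using IH(1) permutes_atLeastAtMost_permutation by auto
  have "perm_rank p \<le> Suc d"
  proof (cases "a \<in> orbit p M")
    case True
    then show ?thesis using perm_rank_split[OF pp(1), of a M] a IH by auto
  next
    case False
    then have "M \<notin> orbit p a" using pp(1) by (metis orbit_eq permutation_self_in_orbit)
    then show ?thesis using perm_rank_merge[OF pp(1), of M a] IH by auto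
  qed
  then show ?case using p by simp
qed

lemma split_facts:
  assumes p: "permutation p" and aM: "a \<noteq> M" "a \<in> orbit p M"
  defines "q \<equiv> tr a M \<circ> p"
  shows "permutation q" "perm_rank p = Suc (perm_rank q)" "M \<notin> orbit q a"
    "supp p = supp q \<union> orbit q a \<union> orbit q M"
    "card (cycle_set p) + of_bool (a \<in> supp q) + of_bool (M \<in> supp q) = Suc (card (cycle_set q))"
    "orbit p M = orbit q a \<union> orbit q M" "\<And>x. x \<notin> orbit p M \<Longrightarrow> orbit p x = orbit q x"
    "a \<in> supp q \<longleftrightarrow> p a \<noteq> M"
proof -
  show q: "permutation q" unfolding q_def by (intro permutation_compose permutation_swap_id p)
  have e: "tr a M \<circ> q = p" by (simp add: q_def)
  show M: "M \<notin> orbit q a" unfolding q_def using orbit_split[OF p aM] .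
  show "perm_rank p = Suc (perm_rank q)" using perm_rank_split[OF p aM] by (simp add: q_def)
  show "supp p = supp q \<union> orbit q a \<union> orbit q M" using cycle_set_merge(2)[OF q M] unfolding e .
  show "card (cycle_set p) + of_bool (a \<in> supp q) + of_bool (M \<in> supp q) = Suc (card (cycle_set q))"
    using card_cycle_set_merge[OF q M] unfolding e .
  show o: "orbit p M = orbit q a \<union> orbit q M" using orbit_merge(2)[OF q M] unfolding e .
  show "x \<notin> orbit p M \<Longrightarrow> orbit p x = orbit q x" for x using orbit_merge(3)[OF q M, of x] unfolding e o .
  show "a \<in> supp q \<longleftrightarrow> p a \<noteq> M"
    using aM(1) by (auto simp: supp_def q_def Transposition.transpose_def)
qed

text \<open>If \<open>M\<close> is the largest moved point and \<open>a\<close> its preimage, multiplication by \<open>(a M)\<close> takes \<open>a\<close> out of the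
cycle of \<open>M\<close> and makes it a fixed point, so the exponent at \<open>M\<close> drops by one.\<close>

lemma max_exponent_split:
  assumes p: "permutation p" and aM: "a \<noteq> M" "a \<in> orbit p M" "p a = M" and mx: "\<And>x. x \<in> supp p \<Longrightarrow> x \<le> M"
  shows "max_exponent p = (\<lambda>i. ind {M} i + max_exponent (tr a M \<circ> p) i)"
proof
  fix b
  let ?q = "tr a M \<circ> p"
  note sf = split_facts[OF p aM(1,2)]
  have "a \<notin> supp ?q" using sf(8) aM(3) by simp
  then have oa: "orbit ?q a = {a}" by (simp add: supp_def orbit_eq_singleton_iff)
  have oM: "orbit p M = insert a (orbit ?q M)" using sf(6) oa by simp
  have self: "M \<in> orbit ?q M" "a \<in> orbit ?q a" "M \<in> orbit p M" using p sf(1) by (simp_all add: permutation_self_in_orbit)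
  have ne: "a \<notin> orbit ?q M" using sf(1,3) orbit_eq self by metis
  have fin: "finite (orbit ?q M)" "finite (orbit p M)" using p sf(1) by (simp_all add: finite_orbit_perm)
  have sub: "orbit p M \<subseteq> supp p" using sf(4,6) by auto
  have mxp: "Max (orbit p M) = M" using mx sub self fin by (intro Max_eqI) auto
  have mxq: "Max (orbit ?q M) = M" using mx sub self fin oM by (intro Max_eqI) auto
  have op: "orbit p x = orbit p M" if "x \<in> orbit p M" for x using that orbit_eq[OF p] by blast
  have oq: "orbit ?q x = orbit ?q M" if "x \<in> orbit ?q M" for x using that orbit_eq[OF sf(1)] by blast
  consider "b \<notin> orbit p M" | "b = a" | "b \<in> orbit ?q M" "b \<noteq> a" using oM by blast
  then show "max_exponent p b = ind {M} b + max_exponent ?q b"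
  proof cases
    case 1
    then have "b \<noteq> M" using self by auto
    then show ?thesis using sf(7)[OF 1] by (simp add: max_exponent_def ind_def)
  next
    case 2
    then have "orbit p b = orbit p M" using op[of a] oM by simp
    then show ?thesis using 2 aM(1) mxp oa by (simp add: max_exponent_def ind_def)
  next
    case 3
    then have e: "orbit p b = orbit p M" "orbit ?q b = orbit ?q M" using op[of b] oq[of b] oM by auto
    have "card (orbit p M) = Suc (card (orbit ?q M))" using oM ne fin by simp
    moreover have "card (orbit ?q M) > 0" using fin self by (auto simp: card_gt_0_iff)
    ultimately show ?thesis unfolding max_exponent_def e mxp mxq by (cases "b = M") (simp_all add: ind_def)
  qed
qed

lemma tr_comp_cases:
  assumes "permutation p" "a \<noteq> M" "perm_rank (tr a M \<circ> p) \<le> d" "perm_rank p = Suc d"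
  shows "a \<in> orbit p M" "perm_rank (tr a M \<circ> p) = d"
proof -
  show "a \<in> orbit p M"
  proof (rule ccontr)
    assume "a \<notin> orbit p M"
    then have "M \<notin> orbit p a" using assms(1) by (metis orbit_eq permutation_self_in_orbit)
    then show False using perm_rank_merge[OF assms(1), of M a] assms by auto
  qed
  then show "perm_rank (tr a M \<circ> p) = d" using perm_rank_split[OF assms(1,2)] assms by auto
qed

lemma ind_supp:
  assumes "\<beta> M > 0"
  shows "{i. \<beta> i > 0} = insert M {i. \<beta> i - ind {M} i > 0}"
  using assms by (auto simp: ind_def)

text \<open>In a factorization of minimal length, every transposition joins two orbits, if the product is
built from the right. Peeling off the first factor \<open>(a M)\<close>, where \<open>M\<close> is the largest point with a
nonzero exponent, splits the cycle of \<open>M\<close>. The number of cycles drops only if both pieces are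
trivial; then \<open>M\<close> no longer occurs as the larger point of a transposition. In the case of equality \<open>a\<close>
has to become a fixed point, so that it is the preimage of \<open>M\<close>.\<close>

lemma JM_prod_minimal:
  assumes "\<beta> \<in> exponents N d" "JM_prod N \<beta> delta p \<noteq> 0" "perm_rank p = d"
  shows "{i. \<beta> i > 0} \<subseteq> supp p \<and> card (cycle_set p) \<le> card {i. \<beta> i > 0} \<and>
    (card (cycle_set p) = card {i. \<beta> i > 0} \<longrightarrow> \<beta> = max_exponent p)"
  using assms
proof (induction d arbitrary: \<beta> p)
  case 0
  then have b: "\<beta> = (\<lambda>_. 0)" using exponents_0 by auto
  have "p permutes {1..N}" using JM_prod_nonzero_permutes[OF 0(1) _ 0(2), of N] 0(1) by (auto simp: exponents_def)
  then have "p = id" using perm_rank_eq_0_iff 0 permutes_atLeastAtMost_permutation by blast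
  then show ?case using b by (auto simp: cycle_set_def supp_def max_exponent_def fun_eq_iff orbit_eq_singleton_iff[THEN iffD2])
next
  case (Suc d)
  obtain M where M: "M \<in> {1..N}" "\<beta> M > 0" "\<And>i. i > M \<Longrightarrow> \<beta> i = 0" "(\<lambda>i. \<beta> i - ind {M} i) \<in> exponents N d"
    using exponents_peel[OF Suc.prems(1)] by metis
  let ?b = "\<lambda>i. \<beta> i - ind {M} i"
  obtain a where a: "a \<in> {1..<M}" "JM_prod N ?b delta (tr a M \<circ> p) \<noteq> 0"
    using JM_prod_nonzero_peel[where \<beta> = \<beta> and M = M, OF M(1,2) Suc.prems(2)] .
  define q where "q = tr a M \<circ> p"
  note a = a[folded q_def]
  have pM: "p permutes {1..M}" using JM_prod_nonzero_permutes[OF Suc.prems(1) M(3) Suc.prems(2)] by simp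
  then have p: "permutation p" by (rule permutes_atLeastAtMost_permutation)
  have "perm_rank q \<le> d" using JM_prod_nonzero_permutes[OF M(4) _ a(2), of M] M(3) by simp
  then have ao: "a \<in> orbit p M" and rq: "perm_rank q = d" using tr_comp_cases[OF p, of a M d, folded q_def] a(1) Suc.prems(3) by auto
  have aM: "a \<noteq> M" using a(1) by auto
  note sf = split_facts[OF p aM ao, folded q_def]
  note IH = Suc.IH[OF M(4) a(2) rq]
  have mx: "x \<le> M" if "x \<in> supp p" for x using that pM supp_subset_iff[OF p, of "{1..M}"] by auto
  have self: "M \<in> orbit q M" using sf(1) by (simp add: permutation_self_in_orbit)
  have ins: "{i. \<beta> i > 0} = insert M {i. ?b i > 0}" by (rule ind_supp[where \<beta> = \<beta> and M = M, OF M(2)])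
  have finb: "finite {i. ?b i > 0}" using exponents_supp[OF M(4)] by (rule finite_subset) simp
  have sub: "{i. \<beta> i > 0} \<subseteq> supp p" unfolding ins using IH sf(4) self by blast
  (* the number of points with a nonzero exponent changes only if M does not occur any more *)
  have key: "card (cycle_set p) \<le> card {i. \<beta> i > 0} \<and> (card (cycle_set p) = card {i. \<beta> i > 0} \<longrightarrow> p a = M \<and> card (cycle_set q) = card {i. ?b i > 0})"
  proof (cases "?b M > 0")
    case True
    then have "M \<in> supp q" using IH by auto
    moreover have "{i. \<beta> i > 0} = {i. ?b i > 0}" using ins True by auto
    ultimately show ?thesis using sf(5,8) IH by (auto simp: of_bool_def split: if_splits)
  next
    case False
    then have "card {i. \<beta> i > 0} = Suc (card {i. ?b i > 0})" unfolding ins using finb by simp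
    then show ?thesis using sf(5,8) IH by (auto simp: of_bool_def split: if_splits)
  qed
  have "\<beta> = max_exponent p" if eq: "card (cycle_set p) = card {i. \<beta> i > 0}"
  proof -
    have b: "?b = max_exponent q" using IH key eq by auto
    have "max_exponent p = (\<lambda>i. ind {M} i + max_exponent q i)" using max_exponent_split[OF p aM ao _ mx, folded q_def] key eq by auto
    then have "max_exponent p = (\<lambda>i. ind {M} i + ?b i)" unfolding b[symmetric] .
    also have "\<dots> = \<beta>" using M(2) by (auto simp: ind_def fun_eq_iff)
    finally show ?thesis ..
  qed
  then show ?case using key sub by blast
qed

text \<open>With the exponents of the equality case there is exactly one factorization: the first factor must
be \<open>(a M)\<close> for the largest moved point \<open>M\<close> and its preimage \<open>a\<close>. Any other choice would leave too many
cycles for the remaining exponents.\<close>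

lemma JM_prod_max_exponent:
  assumes "p permutes {1..N}" "perm_rank p = d"
  shows "JM_prod N (max_exponent p) delta p = 1"
  using assms
proof (induction d arbitrary: p)
  case 0
  then have "p = id" using perm_rank_eq_0_iff permutes_atLeastAtMost_permutation by blast
  then have "max_exponent p = (\<lambda>_. 0)" by (auto simp: max_exponent_def fun_eq_iff orbit_eq_singleton_iff[THEN iffD2])
  then have "JM_prod N (max_exponent p) delta = delta" by (intro JM_prod_zero) auto
  moreover have "delta p = 1" using \<open>p = id\<close> by (simp add: delta_def)
  ultimately show ?case by simp
next
  case (Suc d)
  have p: "permutation p" using Suc.prems(1) by (rule permutes_atLeastAtMost_permutation)
  have subN: "supp p \<subseteq> {1..N}" using supp_subset_iff[OF p] Suc.prems(1) by simp
  have ne: "supp p \<noteq> {}" using Suc.prems(2) by (auto simp: perm_rank_def cycle_set_def)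
  define M where "M = Max (supp p)"
  have M: "M \<in> supp p" unfolding M_def using finite_supp[OF p] ne by (intro Max_in)
  have mx: "x \<le> M" if "x \<in> supp p" for x unfolding M_def using that finite_supp[OF p] by auto
  have MN: "M \<in> {1..N}" using M subN by auto
  define a0 where "a0 = inv p M"
  have pinv: "p a0 = M" unfolding a0_def using permutes_inverses[OF Suc.prems(1)] by simp
  have a0M: "a0 \<noteq> M" using pinv M by (auto simp: supp_def)
  have a0s: "a0 \<in> supp p" using pinv a0M by (auto simp: supp_def)
  have a0o: "a0 \<in> orbit p M"
  proof -
    have "M \<in> orbit p a0" using orbit.base[of p a0] pinv by simp
    then show ?thesis using p by (metis orbit_eq permutation_self_in_orbit)
  qed
  have a0r: "a0 \<in> {1..<M}" using a0s a0M mx[of a0] subN by force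
  note sf0 = split_facts[OF p a0M a0o]
  have ms: "max_exponent p = (\<lambda>i. ind {M} i + max_exponent (tr a0 M \<circ> p) i)"
    by (rule max_exponent_split[OF p a0M a0o pinv]) (rule mx)
  let ?b = "max_exponent (tr a0 M \<circ> p)"
  have pos: "max_exponent p M > 0" unfolding ms by (simp add: ind_def)
  have eb: "(\<lambda>i. max_exponent p i - ind {M} i) = ?b" unfolding ms by auto
  have q0: "tr a0 M \<circ> p permutes {1..N}"
    using a0s M subN by (intro permutes_compose[OF Suc.prems(1)] permutes_swap_id) auto
  have r0: "perm_rank (tr a0 M \<circ> p) = d" using sf0(2) Suc.prems(2) by simp
  have bex: "?b \<in> exponents N d" using exponent_type_max_exponent(2)[OF q0] r0 by simp
  (* a factor other than (a0 M) leaves a cycle of a that the exponents of b cannot account for *)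
  have zero: "JM_prod N ?b delta (tr a M \<circ> p) = 0" if a: "a \<in> {1..<M}" "a \<noteq> a0" for a
  proof (rule ccontr)
    let ?q = "tr a M \<circ> p"
    assume nz: "JM_prod N ?b delta ?q \<noteq> 0"
    have bN: "?b i = 0" if "i > N" for i using bex that by (auto simp: exponents_def)
    have "perm_rank ?q \<le> d" using JM_prod_nonzero_permutes[OF bex bN nz] by simp
    then have ao: "a \<in> orbit p M" and rq: "perm_rank ?q = d" using tr_comp_cases[OF p] a(1) Suc.prems(2) by auto
    have aM: "a \<noteq> M" using a by auto
    note sf = split_facts[OF p aM ao]
    note min = JM_prod_minimal[OF bex nz rq]
    have "p a \<noteq> M" using a(2) pinv permutes_inj[OF Suc.prems(1)] by (auto dest: injD)
    then have as: "a \<in> supp ?q" using sf(8) by simp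
    have ins: "{i. max_exponent p i > 0} = insert M {i. ?b i > 0}"
    proof -
      have "max_exponent p i - ind {M} i = ?b i" for i unfolding ms by simp
      then show ?thesis using ind_supp[of "max_exponent p" M, OF pos] by simp
    qed
    have finb: "finite {i. ?b i > 0}" using exponents_supp[OF bex] by (rule finite_subset) simp
    have c: "card (insert M {i. ?b i > 0}) = card (cycle_set p)" using card_max_exponent_supp[OF p] unfolding ins .
    show False
    proof (cases "M \<in> supp ?q")
      case True
      have "card {i. ?b i > 0} \<le> card (insert M {i. ?b i > 0})" by (rule card_insert_le)
      then show ?thesis using True as sf(5) min c by simp
    next
      case False
      then have "M \<notin> {i. ?b i > 0}" using min by blast
      then have "card (insert M {i. ?b i > 0}) = Suc (card {i. ?b i > 0})" using finb by simp
      then show ?thesis using False as sf(5) min c by simp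
    qed
  qed
  have "JM_prod N (max_exponent p) delta p = (\<Sum>a\<in>{1..<M}. JM_prod N ?b delta (tr a M \<circ> p))"
    using JM_prod_peel[where \<beta> = "max_exponent p" and M = M, OF MN pos, of delta] unfolding eb by (simp add: JM_op_def)
  also have "\<dots> = (\<Sum>a\<in>{a0}. JM_prod N ?b delta (tr a M \<circ> p))"
    using a0r zero by (intro sum.mono_neutral_right) auto
  also have "\<dots> = JM_prod N ?b delta (tr a0 M \<circ> p)" by simp
  also have "\<dots> = 1" by (rule Suc.IH[OF q0 r0])
  finally show ?case .
qed

section \<open>Conjugate partitions\<close>

text \<open>The conjugate of the partition with weakly decreasing parts \<open>r # rs\<close>, built by adding a first column
of length \<open>r\<close> to the conjugate of \<open>rs\<close>.\<close>

fun conjugate :: "nat list \<Rightarrow> nat multiset" where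
  "conjugate [] = {#}"
| "conjugate (r # rs) = image_mset Suc (conjugate rs) + replicate_mset (r - size (conjugate rs)) 1"

text \<open>Removing the first column of a Young diagram whose rows are the elements of \<open>M\<close>.\<close>

definition drop_column :: "nat multiset \<Rightarrow> nat multiset" where
  "drop_column M = filter_mset (\<lambda>k. k \<noteq> 0) (image_mset (\<lambda>k. k - 1) M)"

definition sum_sq :: "nat multiset \<Rightarrow> nat" where "sum_sq M = (\<Sum>x\<in>#M. x ^ 2)"

definition descending :: "nat list \<Rightarrow> bool" where "descending rs \<longleftrightarrow> sorted_wrt (\<ge>) rs \<and> 0 \<notin> set rs"

lemma descending_Cons: "descending (r # rs) \<longleftrightarrow> r > 0 \<and> (\<forall>x\<in>set rs. x \<le> r) \<and> descending rs"
  by (auto simp: descending_def)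

lemma descending_Nil [simp]: "descending []" by (simp add: descending_def)

lemma zero_notin_conjugate: "0 \<notin># conjugate rs" by (induction rs) (auto simp: in_replicate_mset)

lemma size_conjugate: "descending rs \<Longrightarrow> size (conjugate rs) = (case rs of [] \<Rightarrow> 0 | r # _ \<Rightarrow> r)"
proof (induction rs)
  case (Cons r rs)
  then have "size (conjugate rs) \<le> r" by (cases rs) (auto simp: descending_Cons)
  then show ?case by simp
qed simp

lemma size_conjugate_le: "descending (r # rs) \<Longrightarrow> size (conjugate rs) \<le> r"
  using size_conjugate[of rs] by (cases rs) (auto simp: descending_Cons)

lemma sum_conjugate_aux: "sum_mset (image_mset Suc M) = sum_mset M + size M"
  by (induction M) auto

lemma sum_conjugate: "descending rs \<Longrightarrow> sum_mset (conjugate rs) = sum_list rs"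
proof (induction rs)
  case (Cons r rs)
  then show ?case using size_conjugate_le[of r rs] by (simp add: sum_conjugate_aux descending_Cons)
qed simp

lemma sum_sq_conjugate_aux: "sum_sq (image_mset Suc M) = sum_sq M + 2 * sum_mset M + size M"
  by (induction M) (auto simp: sum_sq_def power2_eq_square)

lemma sum_sq_replicate: "sum_sq (replicate_mset k 1) = k" by (simp add: sum_sq_def)

lemma sum_sq_add: "sum_sq (A + B) = sum_sq A + sum_sq B" by (simp add: sum_sq_def)

text \<open>Squares grow by \<open>(x + 1)\<^sup>2 - x\<^sup>2 = 2 x + 1\<close> in each of the \<open>r\<close> rows, including the new ones with \<open>x = 0\<close>.\<close>

lemma sum_sq_conjugate: "descending (r # rs) \<Longrightarrow> sum_sq (conjugate (r # rs)) = sum_sq (conjugate rs) + 2 * sum_list rs + r"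
  using size_conjugate_le[of r rs] sum_conjugate[of rs] by (simp add: sum_sq_add sum_sq_conjugate_aux sum_sq_replicate descending_Cons del: One_nat_def)

lemma drop_column_Suc: "drop_column (image_mset Suc M + replicate_mset k 1) = filter_mset (\<lambda>k. k \<noteq> 0) M"
  by (simp add: drop_column_def multiset.map_comp comp_def)

lemma filter_nonzero: "0 \<notin># M \<Longrightarrow> filter_mset (\<lambda>k. k \<noteq> (0 :: nat)) M = M"
  by (induction M) auto

lemma drop_column_conjugate: "drop_column (conjugate (r # rs)) = conjugate rs"
proof -
  have "filter_mset (\<lambda>k. k \<noteq> 0) (conjugate rs) = conjugate rs" by (rule filter_nonzero) (rule zero_notin_conjugate)
  then show ?thesis unfolding conjugate.simps drop_column_Suc .
qed

lemma Suc_drop_column: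
  assumes "0 \<notin># M"
  shows "image_mset Suc (drop_column M) + replicate_mset (size M - size (drop_column M)) 1 = M" "size (drop_column M) \<le> size M"
proof -
  have "size (drop_column M) \<le> size M \<and> image_mset Suc (drop_column M) + replicate_mset (size M - size (drop_column M)) 1 = M"
    using assms
  proof (induction M)
    case empty then show ?case by (simp add: drop_column_def)
  next
    case (add x M)
    then have IH: "size (drop_column M) \<le> size M" "image_mset Suc (drop_column M) + replicate_mset (size M - size (drop_column M)) 1 = M"
      and x: "x > 0" by auto
    show ?case
    proof (cases "x = 1")
      case True
      then have "drop_column (add_mset x M) = drop_column M" by (simp add: drop_column_def)
      then show ?thesis using IH True by (simp add: Suc_diff_le)
    next
      case False
      then have "drop_column (add_mset x M) = add_mset (x - 1) (drop_column M)" using x by (simp add: drop_column_def)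
      then show ?thesis using IH x by simp
    qed
  qed
  then show "image_mset Suc (drop_column M) + replicate_mset (size M - size (drop_column M)) 1 = M" "size (drop_column M) \<le> size M" by auto
qed

lemma conjugate_inj: "descending rs \<Longrightarrow> descending ss \<Longrightarrow> conjugate rs = conjugate ss \<Longrightarrow> rs = ss"
proof (induction rs arbitrary: ss)
  case Nil
  then show ?case using size_conjugate[of ss] by (cases ss) (auto simp: descending_Cons)
next
  case (Cons r rs)
  have sr: "size (conjugate (r # rs)) = r" using size_conjugate[OF Cons.prems(1)] by simp
  have "ss \<noteq> []"
  proof
    assume "ss = []"
    then have "r = 0" using sr Cons.prems(3) by (metis conjugate.simps(1) size_empty)
    then show False using Cons.prems(1) by (simp add: descending_Cons)
  qed
  then obtain s ss' where s: "ss = s # ss'" by (cases ss) auto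
  have "size (conjugate (r # rs)) = r" "size (conjugate (s # ss')) = s"
    using size_conjugate[OF Cons.prems(1)] size_conjugate[OF Cons.prems(2)] unfolding s by simp_all
  then have "r = s" using Cons.prems(3) s by metis
  moreover have "conjugate rs = conjugate ss'" using drop_column_conjugate[of r rs] drop_column_conjugate[of s ss'] Cons.prems(3) s by metis
  ultimately show ?case using Cons s by (simp add: descending_Cons)
qed

lemma conjugate_surj: "0 \<notin># M \<Longrightarrow> \<exists>rs. descending rs \<and> conjugate rs = M"
proof (induction "sum_mset M" arbitrary: M rule: less_induct)
  case less
  show ?case
  proof (cases "M = {#}")
    case True then show ?thesis by (intro exI[of _ "[]"]) simp
  next
    case False
    note sd = Suc_drop_column[OF less.prems]
    have "sum_mset M = sum_mset (drop_column M) + size (drop_column M) + (size M - size (drop_column M))"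
      by (subst sd(1)[symmetric]) (simp add: sum_conjugate_aux)
    moreover have "size M > 0" using False by (simp add: nonempty_has_size)
    ultimately have "sum_mset (drop_column M) < sum_mset M" using sd(2) by linarith
    then obtain rs where rs: "descending rs" "conjugate rs = drop_column M" using less(1)[of "drop_column M"] by (auto simp: drop_column_def)
    have "\<forall>x\<in>set rs. x \<le> size M"
      using rs size_conjugate[OF rs(1)] sd(2) by (cases rs) (auto simp: descending_Cons)
    then have "descending (size M # rs)" using rs(1) \<open>size M > 0\<close> by (simp add: descending_Cons)
    moreover have "conjugate (size M # rs) = M" using rs(2) sd(1) by simp
    ultimately show ?thesis by blast
  qed
qed

section \<open>Leading terms of products of elementary symmetric functions\<close>

lemma sum_sq_exponent_type: "sum_sq (exponent_type N \<beta>) = (\<Sum>i\<in>{1..N}. (\<beta> i)\<^sup>2)"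
proof -
  have "sum_sq (exponent_type N \<beta>) = (\<Sum>i\<in>{i\<in>{1..N}. \<beta> i \<noteq> 0}. (\<beta> i)\<^sup>2)"
    unfolding exponent_type_altdef sum_sq_def by (simp add: sum_unfold_sum_mset multiset.map_comp comp_def)
  also have "\<dots> = (\<Sum>i\<in>{1..N}. (\<beta> i)\<^sup>2)" by (rule sum.mono_neutral_left) auto
  finally show ?thesis .
qed

lemma drop_column_exponent_type:
  assumes "\<beta> \<in> exponents N d"
  shows "exponent_type N (\<lambda>i. \<beta> i - ind {i. \<beta> i > 0} i) = drop_column (exponent_type N \<beta>)"
proof -
  have "image_mset (\<lambda>i. \<beta> i - ind {i. \<beta> i > 0} i) (mset_set {1..N}) = image_mset (\<lambda>k. k - 1) (image_mset \<beta> (mset_set {1..N}))"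
    by (auto simp: multiset.map_comp comp_def ind_def intro!: image_mset_cong)
  moreover have "filter_mset (\<lambda>k. k \<noteq> 0) (image_mset (\<lambda>k. k - 1) M) =
     filter_mset (\<lambda>k. k \<noteq> 0) (image_mset (\<lambda>k. k - 1) (filter_mset (\<lambda>k. k \<noteq> 0) M))" for M :: "nat multiset"
    by (induction M) auto
  ultimately show ?thesis unfolding exponent_type_def drop_column_def by metis
qed

lemma ind_le: "S \<subseteq> {i. \<beta> i > 0} \<Longrightarrow> ind S i \<le> \<beta> i"
  by (auto simp: ind_def of_bool_def)

text \<open>Adding a squarefree monomial with support \<open>S\<close> of size \<open>r\<close> to the exponents \<open>b\<close> raises the sum of squares
by \<open>2 \<Sum>\<^sub>S b + r\<close>. This is at most \<open>2 \<Sum> b + r\<close>, with equality if and only if \<open>S\<close> contains the support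
of \<open>b\<close>. So the maximum is attained when the supports are nested, and then the exponents form the
conjugate partition. The sum of squares thus replaces the dominance order.\<close>

lemma elem_coeff_nonzero:
  assumes "descending rs" "\<beta> \<in> exponents N (sum_list rs)" "elem_coeff rs \<beta> \<noteq> 0"
  shows "sum_sq (exponent_type N \<beta>) \<le> sum_sq (conjugate rs) \<and> (sum_sq (exponent_type N \<beta>) = sum_sq (conjugate rs) \<longrightarrow> exponent_type N \<beta> = conjugate rs)"
  using assms
proof (induction rs arbitrary: \<beta>)
  case Nil
  have "\<beta> \<in> exponents N 0" using Nil.prems(2) by simp
  then have "\<beta> = (\<lambda>_. 0)" by (rule exponents_0)
  then have "exponent_type N \<beta> = {#}" by (simp add: exponent_type_altdef)
  then show ?case by simp
next
  case (Cons r rs)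
  obtain S where S: "S \<subseteq> {i. \<beta> i > 0}" "card S = r" "elem_coeff rs (\<lambda>i. \<beta> i - ind S i) \<noteq> 0"
    using Cons.prems(3) by (auto elim!: sum.not_neutral_contains_not_neutral)
  let ?b = "\<lambda>i. \<beta> i - ind S i"
  have SN: "S \<subseteq> {1..N}" using S(1) exponents_supp[OF Cons.prems(2)] by blast
  have b: "?b \<in> exponents N (sum_list rs)" by (rule exponents_diff_ind[OF Cons.prems(2) S(1)]) (simp add: S)
  have rs: "descending rs" using Cons.prems(1) by (simp add: descending_Cons)
  note IH = Cons.IH[OF rs b S(3)]
  have eq: "\<beta> i = ?b i + ind S i" for i using ind_le[OF S(1), of i] by simp
  have "(\<Sum>i\<in>{1..N}. (\<beta> i)\<^sup>2) = (\<Sum>i\<in>{1..N}. (?b i)\<^sup>2 + 2 * (?b i * ind S i) + ind S i)"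
  proof (rule sum.cong[OF refl])
    fix i
    have "(\<beta> i)\<^sup>2 = (?b i + ind S i)\<^sup>2" using eq[of i] by metis
    also have "\<dots> = (?b i)\<^sup>2 + 2 * (?b i * ind S i) + (ind S i)\<^sup>2" by (simp add: power2_sum)
    also have "(ind S i)\<^sup>2 = ind S i" by (simp add: ind_def)
    finally show "(\<beta> i)\<^sup>2 = (?b i)\<^sup>2 + 2 * (?b i * ind S i) + ind S i" .
  qed
  also have "\<dots> = (\<Sum>i\<in>{1..N}. (?b i)\<^sup>2) + 2 * (\<Sum>i\<in>{1..N}. ?b i * ind S i) + r"
    using sum_ind[OF SN] S(2) by (simp add: sum.distrib sum_distrib_left)
  finally have sqe: "sum_sq (exponent_type N \<beta>) = sum_sq (exponent_type N ?b) + 2 * (\<Sum>i\<in>{1..N}. ?b i * ind S i) + r"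
    unfolding sum_sq_exponent_type .
  have le: "(\<Sum>i\<in>{1..N}. ?b i * ind S i) \<le> (\<Sum>i\<in>{1..N}. ?b i)"
    by (rule sum_mono) (auto simp: ind_def)
  have sb: "(\<Sum>i\<in>{1..N}. ?b i) = sum_list rs" using b by (simp add: exponents_def)
  note sc = sum_sq_conjugate[OF Cons.prems(1)]
  have 1: "sum_sq (exponent_type N \<beta>) \<le> sum_sq (conjugate (r # rs))" using sqe le sb IH sc by linarith
  have "exponent_type N \<beta> = conjugate (r # rs)" if e: "sum_sq (exponent_type N \<beta>) = sum_sq (conjugate (r # rs))"
  proof -
    have e1: "sum_sq (exponent_type N ?b) = sum_sq (conjugate rs)" "(\<Sum>i\<in>{1..N}. ?b i * ind S i) = (\<Sum>i\<in>{1..N}. ?b i)"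
      using e sqe le sb IH sc by linarith+
    have "?b i * ind S i = ?b i" if "i \<in> {1..N}" for i
      by (rule sum_mono_inv[OF e1(2) _ that]) (auto simp: ind_def)
    then have z: "?b i = 0" if "i \<in> {1..N}" "i \<notin> S" for i
    proof -
      have "?b i * ind S i = ?b i" using that(1) by fact
      then show ?thesis using that(2) by (simp add: ind_def)
    qed
    have supp: "{i\<in>{1..N}. \<beta> i \<noteq> 0} = S"
    proof (intro set_eqI iffI)
      fix i assume i: "i \<in> {i\<in>{1..N}. \<beta> i \<noteq> 0}"
      then show "i \<in> S" using z[of i] by (cases "i \<in> S") (auto simp: ind_def)
    qed (use S(1) SN in blast)
    have supp2: "{i\<in>{1..N}. ?b i \<noteq> 0} = {i\<in>S. ?b i \<noteq> 0}"
    proof (intro set_eqI iffI)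
      fix i assume i: "i \<in> {i\<in>{1..N}. ?b i \<noteq> 0}"
      then show "i \<in> {i\<in>S. ?b i \<noteq> 0}" using z[of i] by (cases "i \<in> S") simp_all
    qed (use SN in blast)
    have finS: "finite S" using SN finite_subset by blast
    have bb: "exponent_type N ?b = image_mset ?b (mset_set {i\<in>S. ?b i \<noteq> 0})" unfolding exponent_type_altdef supp2 ..
    have SS: "mset_set S = mset_set {i\<in>S. ?b i \<noteq> 0} + mset_set {i\<in>S. ?b i = 0}"
      using finS by (subst mset_set_Union[symmetric]) (auto intro!: arg_cong[where f = mset_set])
    have "exponent_type N \<beta> = image_mset (\<lambda>i. Suc (?b i)) (mset_set S)"
      unfolding exponent_type_altdef supp using finS S(1) by (intro image_mset_cong) (auto simp: ind_def)
    then have "exponent_type N \<beta> = image_mset (\<lambda>i. Suc (?b i)) (mset_set {i\<in>S. ?b i \<noteq> 0}) + image_mset (\<lambda>i. Suc (?b i)) (mset_set {i\<in>S. ?b i = 0})"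
      by (simp only: SS image_mset_union)
    moreover have "image_mset (\<lambda>i. Suc (?b i)) (mset_set {i\<in>S. ?b i \<noteq> 0}) = image_mset Suc (exponent_type N ?b)"
      unfolding bb by (simp add: multiset.map_comp comp_def)
    moreover have "image_mset (\<lambda>i. Suc (?b i)) (mset_set {i\<in>S. ?b i = 0}) = image_mset (\<lambda>i. 1) (mset_set {i\<in>S. ?b i = 0})"
      using finS by (intro image_mset_cong) auto
    moreover have "\<dots> = replicate_mset (card {i\<in>S. ?b i = 0}) 1" by (simp add: image_mset_const_eq)
    moreover have "card {i\<in>S. ?b i = 0} = r - size (exponent_type N ?b)"
    proof -
      have "card S = card {i\<in>S. ?b i \<noteq> 0} + card {i\<in>S. ?b i = 0}"
        using finS by (subst card_Un_disjoint[symmetric]) (auto intro!: arg_cong[where f = card])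
      then show ?thesis unfolding bb using S(2) by simp
    qed
    ultimately show ?thesis using IH e1(1) by (simp only: conjugate.simps)
  qed
  then show ?case using 1 by blast
qed

text \<open>The largest index comes first, so the first support has the size of the whole support of \<open>\<beta>\<close> and must
be equal to it. Hence there is exactly one choice in each step.\<close>

lemma elem_coeff_leading:
  assumes "descending rs" "\<beta> \<in> exponents N (sum_list rs)" "exponent_type N \<beta> = conjugate rs"
  shows "elem_coeff rs \<beta> = 1"
  using assms
proof (induction rs arbitrary: \<beta>)
  case Nil
  have "\<beta> \<in> exponents N 0" using Nil.prems(2) by simp
  then have "\<beta> = (\<lambda>_. 0)" by (rule exponents_0)
  then show ?case by simp
next
  case (Cons r rs)
  let ?S = "{i. \<beta> i > 0}"
  have rs: "descending rs" using Cons.prems(1) by (simp add: descending_Cons)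
  have fin: "finite ?S" using exponents_supp[OF Cons.prems(2)] by (rule finite_subset) simp
  have cS: "card ?S = r" using size_exponent_type[OF Cons.prems(2)] Cons.prems(3) size_conjugate[OF Cons.prems(1)] by simp
  have "{S. S \<subseteq> ?S \<and> card S = r} = {?S}"
    using cS fin by (auto dest: card_subset_eq[OF fin])
  then have "elem_coeff (r # rs) \<beta> = elem_coeff rs (\<lambda>i. \<beta> i - ind ?S i)" by simp
  also have "\<dots> = 1"
  proof (rule Cons.IH[OF rs])
    show "(\<lambda>i. \<beta> i - ind ?S i) \<in> exponents N (sum_list rs)"
      by (rule exponents_diff_ind[OF Cons.prems(2)]) (simp_all add: cS)
    show "exponent_type N (\<lambda>i. \<beta> i - ind ?S i) = conjugate rs"
      unfolding drop_column_exponent_type[OF Cons.prems(2)] Cons.prems(3) drop_column_conjugate ..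
  qed
  finally show ?case .
qed

lemma elem_coeff_permute:
  assumes "bij \<pi>" shows "elem_coeff rs (\<beta> \<circ> \<pi>) = elem_coeff rs \<beta>"
proof (induction rs arbitrary: \<beta>)
  case Nil
  have "(\<forall>i. \<beta> (\<pi> i) = 0) \<longleftrightarrow> (\<forall>i. \<beta> i = 0)" using assms by (metis bij_pointE)
  then show ?case by simp
next
  case (Cons r rs)
  have inj: "inj \<pi>" using assms by (rule bij_is_inj)
  have bij: "bij_betw ((`) \<pi>) {S. S \<subseteq> {i. (\<beta> \<circ> \<pi>) i > 0} \<and> card S = r} {S. S \<subseteq> {i. \<beta> i > 0} \<and> card S = r}"
  proof (rule bij_betw_byWitness[where f' = "\<lambda>S. \<pi> -` S"])
    show "\<forall>S\<in>{S. S \<subseteq> {i. (\<beta> \<circ> \<pi>) i > 0} \<and> card S = r}. \<pi> -` \<pi> ` S = S" using inj by (simp add: inj_vimage_image_eq)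
    show "\<forall>S\<in>{S. S \<subseteq> {i. \<beta> i > 0} \<and> card S = r}. \<pi> ` (\<pi> -` S) = S" using assms by (simp add: bij_is_surj)
    show "(`) \<pi> ` {S. S \<subseteq> {i. (\<beta> \<circ> \<pi>) i > 0} \<and> card S = r} \<subseteq> {S. S \<subseteq> {i. \<beta> i > 0} \<and> card S = r}"
      using inj by (auto simp: card_image inj_on_subset)
    show "(\<lambda>S. \<pi> -` S) ` {S. S \<subseteq> {i. \<beta> i > 0} \<and> card S = r} \<subseteq> {S. S \<subseteq> {i. (\<beta> \<circ> \<pi>) i > 0} \<and> card S = r}"
      using assms by (auto simp: card_vimage_inj bij_is_inj bij_is_surj)
  qed
  have e: "(\<lambda>i. (\<beta> \<circ> \<pi>) i - ind S i) = (\<lambda>i. \<beta> i - ind (\<pi> ` S) i) \<circ> \<pi>" for S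
    using inj by (auto simp: fun_eq_iff ind_def inj_image_mem_iff)
  show ?case
    unfolding elem_coeff.simps sum.reindex_bij_betw[OF bij, symmetric] e Cons ..
qed

lemma exponent_type_mono:
  assumes "\<beta> \<in> exponents N d" "N \<le> N'" shows "exponent_type N' \<beta> = exponent_type N \<beta>" "\<beta> \<in> exponents N' d"
proof -
  have z: "\<beta> i = 0" if "i \<notin> {1..N}" for i using assms(1) that by (simp add: exponents_def)
  have "{i\<in>{1..N'}. \<beta> i \<noteq> 0} = {i\<in>{1..N}. \<beta> i \<noteq> 0}" using z assms(2) by fastforce
  then show "exponent_type N' \<beta> = exponent_type N \<beta>" by (simp add: exponent_type_altdef)
  have "sum \<beta> {1..N'} = sum \<beta> {1..N}"
    by (rule sum.mono_neutral_right) (use z assms(2) in auto)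
  then show "\<beta> \<in> exponents N' d" using assms by (auto simp: exponents_def)
qed

text \<open>Padded with zeros, exponents with the same nonzero values are permutations of each other, and
elementary symmetric functions are symmetric.\<close>

lemma elem_coeff_exponent_type:
  assumes "\<beta> \<in> exponents N d" "\<gamma> \<in> exponents N' d'" "exponent_type N \<beta> = exponent_type N' \<gamma>"
  shows "elem_coeff rs \<beta> = elem_coeff rs \<gamma>"
proof -
  define K where "K = max N N'"
  have b: "\<beta> \<in> exponents K d" "\<gamma> \<in> exponents K d'" "exponent_type K \<beta> = exponent_type K \<gamma>"
    using exponent_type_mono[OF assms(1), of K] exponent_type_mono[OF assms(2), of K] assms(3) by (auto simp: K_def)
  have c: "image_mset f (mset_set {1..K}) = exponent_type K f + replicate_mset (K - size (exponent_type K f)) 0" for f :: "nat \<Rightarrow> nat"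
  proof -
    have "M = filter_mset (\<lambda>k. k \<noteq> 0) M + replicate_mset (size M - size (filter_mset (\<lambda>k. k \<noteq> 0) M)) 0" for M :: "nat multiset"
    proof (induction M)
      case (add x M)
      have "size (filter_mset (\<lambda>k. k \<noteq> 0) M) \<le> size M" by (rule size_filter_mset_lesseq)
      then show ?case using add by (cases "x = 0") (auto simp: Suc_diff_le)
    qed simp
    from this[of "image_mset f (mset_set {1..K})"] show ?thesis by (simp add: exponent_type_def)
  qed
  have "image_mset \<beta> (mset_set {1..K}) = image_mset \<gamma> (mset_set {1..K})" unfolding c b(3) ..
  then obtain \<pi> where pi: "\<pi> permutes {1..K}" "\<forall>x\<in>{1..K}. \<beta> x = \<gamma> (\<pi> x)"
    using image_mset_eq_implies_permutes[of "{1..K}" \<beta> \<gamma>] by auto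
  have "\<beta> = \<gamma> \<circ> \<pi>"
  proof
    fix i show "\<beta> i = (\<gamma> \<circ> \<pi>) i"
    proof (cases "i \<in> {1..K}")
      case False
      then have "\<beta> i = 0" "\<gamma> i = 0" using b(1,2) by (simp_all add: exponents_def)
      then show ?thesis using pi(1) False by (simp add: permutes_not_in)
    qed (use pi in auto)
  qed
  then show ?thesis using elem_coeff_permute[OF permutes_bij[OF pi(1)]] by simp
qed

definition mset_expo :: "nat multiset \<Rightarrow> nat \<Rightarrow> nat" where
  "mset_expo M i = (let L = sorted_list_of_multiset M in if i \<in> {1..length L} then L ! (i - 1) else 0)"

lemma mset_expo:
  assumes "0 \<notin># M"
  shows "exponent_type (size M) (mset_expo M) = M" "mset_expo M \<in> exponents (size M) (sum_mset M)"
proof -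
  define L where "L = sorted_list_of_multiset M"
  have L: "mset L = M" "length L = size M" by (simp_all add: L_def flip: size_mset)
  have "image_mset (mset_expo M) (mset_set {1..size M}) = image_mset (\<lambda>i. L ! (i - 1)) (mset_set {1..size M})"
    by (intro image_mset_cong) (simp add: mset_expo_def Let_def L(2) flip: L_def)
  also have "{1..size M} = Suc ` {0..<size M}" by (simp add: atLeastLessThanSuc_atLeastAtMost)
  also have "image_mset (\<lambda>i. L ! (i - 1)) (mset_set (Suc ` {0..<size M})) = image_mset ((!) L) (mset_set {0..<length L})"
    by (subst image_mset_mset_set[symmetric]) (auto simp: multiset.map_comp comp_def L)
  also have "\<dots> = mset L" by (metis map_nth mset_map mset_upt)
  finally have "image_mset (mset_expo M) (mset_set {1..size M}) = M" using L by (simp add: atLeastLessThanSuc_atLeastAtMost)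
  then show 1: "exponent_type (size M) (mset_expo M) = M" using filter_nonzero[OF assms] by (simp add: exponent_type_def)
  show "mset_expo M \<in> exponents (size M) (sum_mset M)"
    using sum_mset_exponent_type[of "size M" "mset_expo M"] unfolding 1 by (auto simp: exponents_def mset_expo_def Let_def L(2) simp flip: L_def)
qed

section \<open>Permutations of equal cycle type are conjugate\<close>

text \<open>Iterating \<open>p\<close> from \<open>x\<close> is periodic with the size of the orbit as minimal period.\<close>

lemma funpow_orbit_eq_iff:
  assumes "permutation p"
  shows "(p ^^ i) x = (p ^^ j) x \<longleftrightarrow> i mod card (orbit p x) = j mod card (orbit p x)"
proof -
  have x: "x \<in> orbit p x" using assms by (simp add: permutation_self_in_orbit)
  define k where "k = funpow_dist1 p x x"
  have inj: "inj_on (\<lambda>n. (p ^^ n) x) {0..<k}" unfolding k_def by (rule inj_on_funpow_dist1[OF x])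
  have k: "card (orbit p x) = k"
    using card_image[OF inj] orbit_conv_funpow_dist1[OF x] by (simp add: k_def)
  have k0: "k > 0" by (simp add: k_def)
  have px: "(p ^^ k) x = x" unfolding k_def by (rule funpow_dist1_prop[OF x])
  have m: "(p ^^ (i mod k)) x = (p ^^ i) x" for i using px by (rule funpow_mod_eq)
  show ?thesis unfolding k using inj_on_eq_iff[OF inj, of "i mod k" "j mod k"] k0 by (simp add: m)
qed

text \<open>Send \<open>p\<^sup>i x\<close> to \<open>p'\<^sup>i x'\<close>; this is well defined since the periods are equal.\<close>

lemma orbit_intertwine:
  assumes p: "permutation p" and p': "permutation p'" and c: "card (orbit p x) = card (orbit p' x')"
  shows "\<exists>\<pi>. bij_betw \<pi> (orbit p x) (orbit p' x') \<and> (\<forall>y\<in>orbit p x. \<pi> (p y) = p' (\<pi> y))"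
proof -
  define \<pi> where "\<pi> y = (p' ^^ (SOME i. (p ^^ i) x = y)) x'" for y
  have eq: "(p ^^ i) x = (p ^^ j) x \<longleftrightarrow> (p' ^^ i) x' = (p' ^^ j) x'" for i j
    using funpow_orbit_eq_iff[OF p] funpow_orbit_eq_iff[OF p'] c by simp
  have pi: "\<pi> ((p ^^ i) x) = (p' ^^ i) x'" for i
  proof -
    have "(p ^^ (SOME j. (p ^^ j) x = (p ^^ i) x)) x = (p ^^ i) x" by (rule someI) simp
    then show ?thesis unfolding \<pi>_def eq .
  qed
  have o: "orbit p x = {(p ^^ n) x | n. True}" "orbit p' x' = {(p' ^^ n) x' | n. True}"
    using p p' by (simp_all add: orbit_altdef_permutation)
  have "inj_on \<pi> (orbit p x)" unfolding o by (rule inj_onI) (auto simp: pi eq)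
  moreover have "\<pi> ` orbit p x = orbit p' x'" unfolding o
  proof (intro set_eqI iffI)
    fix z assume "z \<in> {(p' ^^ n) x' |n. True}"
    then obtain n where "z = \<pi> ((p ^^ n) x)" using pi by auto
    then show "z \<in> \<pi> ` {(p ^^ n) x |n. True}" by blast
  qed (auto simp: pi)
  moreover have "\<pi> (p y) = p' (\<pi> y)" if y: "y \<in> orbit p x" for y
  proof -
    obtain i where "y = (p ^^ i) x" using y o by auto
    then show ?thesis using pi[of "Suc i"] pi[of i] by simp
  qed
  ultimately show ?thesis by (auto simp: bij_betw_def)
qed

lemma image_mset_eq_imp_bij:
  assumes "finite A" "finite B" "image_mset f (mset_set A) = image_mset f' (mset_set B)"
  shows "\<exists>g. bij_betw g A B \<and> (\<forall>a\<in>A. f' (g a) = f a)"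
  using assms
proof (induction A arbitrary: B rule: finite_induct)
  case empty
  then have "B = {}" by (simp add: mset_set_empty_iff)
  then show ?case by (auto simp: bij_betw_def)
next
  case (insert a A)
  then have "f a \<in># image_mset f' (mset_set B)" by (metis finite.insertI image_mset_add_mset insert.hyps(1) mset_set.insert union_single_eq_member)
  then obtain b where b: "b \<in> B" "f' b = f a" using insert.prems(1) by auto
  have B: "B = insert b (B - {b})" using b by auto
  have "add_mset (f a) (image_mset f (mset_set A)) = image_mset f' (mset_set (insert b (B - {b})))"
    using insert B by simp
  also have "\<dots> = add_mset (f a) (image_mset f' (mset_set (B - {b})))"
    using insert.prems(1) b by (subst mset_set.insert) auto
  finally obtain g where g: "bij_betw g A (B - {b})" "\<forall>a\<in>A. f' (g a) = f a"
    using insert.IH[of "B - {b}"] insert.prems(1) by auto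
  have "bij_betw (g(a := b)) A (B - {b})"
    using g(1) insert.hyps(2) by (subst bij_betw_cong[of A _ g]) auto
  then have "bij_betw (g(a := b)) (insert a A) (insert b (B - {b}))"
    using insert.hyps(2) notIn_Un_bij_betw[of a A "g(a := b)" "B - {b}"] by simp
  moreover have "\<forall>x\<in>insert a A. f' ((g(a := b)) x) = f x" using g(2) b by auto
  ultimately show ?case using B by metis
qed

lemma supp_intertwine:
  assumes p: "permutation p" and p': "permutation p'" and t: "reduced_type p = reduced_type p'"
  shows "\<exists>\<pi>. bij_betw \<pi> (supp p) (supp p') \<and> (\<forall>y\<in>supp p. \<pi> (p y) = p' (\<pi> y))"
proof -
  obtain g where g: "bij_betw g (cycle_set p) (cycle_set p')" "\<And>C. C \<in> cycle_set p \<Longrightarrow> card (g C) - 1 = card C - 1"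
    using image_mset_eq_imp_bij[OF finite_cycle_set[OF p] finite_cycle_set[OF p'], of "\<lambda>C. card C - 1" "\<lambda>C. card C - 1"] t
    by (auto simp: reduced_type_def)
  have gC: "g C \<in> cycle_set p'" if "C \<in> cycle_set p" for C using g(1) that by (auto simp: bij_betw_def)
  have "\<exists>\<pi>. bij_betw \<pi> C (g C) \<and> (\<forall>y\<in>C. \<pi> (p y) = p' (\<pi> y))" if C: "C \<in> cycle_set p" for C
  proof -
    obtain x where x: "C = orbit p x" using C by (auto simp: cycle_set_def)
    obtain x' where x': "g C = orbit p' x'" using gC[OF C] by (auto simp: cycle_set_def)
    have "card C = card (g C)" using g(2)[OF C] cyc_card[OF p C] cyc_card[OF p' gC[OF C]] by linarith
    then show ?thesis using orbit_intertwine[OF p p', of x x'] x x' by auto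
  qed
  then obtain h where h: "\<And>C. C \<in> cycle_set p \<Longrightarrow> bij_betw (h C) C (g C)"
     "\<And>C y. C \<in> cycle_set p \<Longrightarrow> y \<in> C \<Longrightarrow> h C (p y) = p' (h C y)" by metis
  define \<pi> where "\<pi> y = h (orbit p y) y" for y
  have oC: "orbit p y \<in> cycle_set p" if "y \<in> supp p" for y using that by (simp add: cycle_set_def)
  have self: "y \<in> orbit p y" for y using p by (rule permutation_self_in_orbit)
  have mem: "\<pi> y \<in> g (orbit p y)" if "y \<in> supp p" for y
    unfolding \<pi>_def using h(1)[OF oC[OF that]] self by (auto simp: bij_betw_def)
  have "inj_on \<pi> (supp p)"
  proof (rule inj_onI)
    fix y z assume yz: "y \<in> supp p" "z \<in> supp p" "\<pi> y = \<pi> z"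
    have "g (orbit p y) \<inter> g (orbit p z) \<noteq> {}" using mem[OF yz(1)] mem[OF yz(2)] yz(3) by auto
    then have "g (orbit p y) = g (orbit p z)" using cycle_set_disjoint[OF p'] gC oC yz by blast
    then have "orbit p y = orbit p z" using g(1) oC yz by (auto simp: bij_betw_def inj_on_def)
    then show "y = z" using h(1)[OF oC[OF yz(1)]] self[of y] self[of z] yz(3) by (auto simp: \<pi>_def bij_betw_def inj_on_def)
  qed
  moreover have "\<pi> ` supp p = supp p'"
  proof (intro set_eqI iffI)
    fix z assume "z \<in> \<pi> ` supp p"
    then obtain y where y: "y \<in> supp p" "z = \<pi> y" by auto
    then show "z \<in> supp p'" using cyc_setE(2)[OF gC[OF oC[OF y(1)]] p' mem[OF y(1)]] by simp
  next
    fix z assume z: "z \<in> supp p'"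
    then have "orbit p' z \<in> g ` cycle_set p" using g(1) by (auto simp: bij_betw_def cycle_set_def)
    then obtain C where C: "C \<in> cycle_set p" "orbit p' z = g C" by auto
    then have "z \<in> h C ` C" using h(1)[OF C(1)] permutation_self_in_orbit[OF p', of z] by (auto simp: bij_betw_def)
    then obtain y where y: "y \<in> C" "z = h C y" by auto
    then show "z \<in> \<pi> ` supp p" using cyc_setE[OF C(1) p y(1)] by (auto simp: \<pi>_def)
  qed
  moreover have "\<pi> (p y) = p' (\<pi> y)" if y: "y \<in> supp p" for y
    using h(2)[OF oC[OF y] self] permutation_orbit_step[OF p, of y] by (simp add: \<pi>_def)
  ultimately show ?thesis by (auto simp: bij_betw_def)
qed

lemma bij_extend:
  assumes "finite A" "finite B" "bij_betw f A' B'" "A' \<subseteq> A" "B' \<subseteq> B" "card A = card B"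
  shows "\<exists>g. bij_betw g A B \<and> (\<forall>x\<in>A'. g x = f x)"
proof -
  have fin: "finite A'" "finite B'" using assms finite_subset by blast+
  have "card (A - A') = card (B - B')"
    using assms bij_betw_same_card[OF assms(3)] fin by (simp add: card_Diff_subset)
  then obtain h where h: "bij_betw h (A - A') (B - B')" using assms finite_same_card_bij by blast
  define g where "g x = (if x \<in> A' then f x else h x)" for x
  have "bij_betw g A' B'" using assms(3) by (subst bij_betw_cong[of _ _ f]) (auto simp: g_def)
  moreover have "bij_betw g (A - A') (B - B')" using h by (subst bij_betw_cong[of _ _ h]) (auto simp: g_def)
  ultimately have "bij_betw g (A' \<union> (A - A')) (B' \<union> (B - B'))" by (rule bij_betw_combine) auto
  then show ?thesis using assms by (intro exI[of _ g]) (auto simp: g_def Un_absorb1)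
qed

text \<open>The conjugating permutation can be chosen to match given finite sets of the same size that
contain the supports. This is what makes the counting of factorizations with given support
depend on sizes only.\<close>

lemma same_type_conjugate:
  assumes p: "permutation p" and p': "permutation p'" and t: "reduced_type p = reduced_type p'"
    and U: "finite U" "finite U'" "supp p \<subseteq> U" "supp p' \<subseteq> U'" "card U = card U'"
  shows "\<exists>\<pi>. permutation \<pi> \<and> \<pi> ` U = U' \<and> \<pi> \<circ> p \<circ> inv \<pi> = p'"
proof -
  obtain f where f: "bij_betw f (supp p) (supp p')" "\<forall>y\<in>supp p. f (p y) = p' (f y)"
    using supp_intertwine[OF p p' t] by auto
  obtain g where g: "bij_betw g U U'" "\<forall>x\<in>supp p. g x = f x" using bij_extend[OF U(1,2) f(1) U(3,4,5)] by auto
  obtain h where h: "bij_betw h (U \<union> U') (U \<union> U')" "\<forall>x\<in>U. h x = g x"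
    using bij_extend[of "U \<union> U'" "U \<union> U'" g U U'] g(1) U by auto
  define \<pi> where "\<pi> x = (if x \<in> U \<union> U' then h x else x)" for x
  have "\<pi> permutes (U \<union> U')"
  proof (rule bij_imp_permutes)
    show "bij_betw \<pi> (U \<union> U') (U \<union> U')" using h(1) by (subst bij_betw_cong[of _ _ h]) (auto simp: \<pi>_def)
  qed (simp add: \<pi>_def)
  then have perm: "permutation \<pi>" using U by (auto simp: permutation_permutes)
  have bij: "bij \<pi>" using perm permutation_bijective by blast
  have U': "\<pi> x = g x" if "x \<in> U" for x using that h(2) by (simp add: \<pi>_def)
  then have im: "\<pi> ` U = U'" using g(1) by (auto simp: bij_betw_def)
  have s: "\<pi> x = f x" if "x \<in> supp p" for x using that U' g(2) U(3) by auto
  have sim: "\<pi> ` supp p = supp p'" using s f(1) by (auto simp: bij_betw_def)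
  have "\<pi> (p x) = p' (\<pi> x)" for x
  proof (cases "x \<in> supp p")
    case True
    have "orbit p x \<in> cycle_set p" using True by (simp add: cycle_set_def)
    then have "p x \<in> supp p" using cyc_setE(2)[OF _ p, of _ "p x"] orbit.base by metis
    then show ?thesis using s True f(2) by simp
  next
    case False
    then have "\<pi> x \<notin> supp p'" using sim bij by (metis bij_is_inj inj_image_mem_iff)
    then show ?thesis using False by (simp add: supp_def)
  qed
  then have "\<pi> \<circ> p = p' \<circ> \<pi>" by auto
  then have "\<pi> \<circ> p \<circ> inv \<pi> = p' \<circ> (\<pi> \<circ> inv \<pi>)" by (simp add: comp_assoc)
  then have "\<pi> \<circ> p \<circ> inv \<pi> = p'" using bij by (simp add: bij_is_surj surj_iff[THEN iffD1])
  then show ?thesis using perm im by blast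
qed

section \<open>A permutation of every reduced cycle type\<close>

lemma count_reduced_type:
  assumes "permutation p" shows "count (reduced_type p) j = (\<Sum>C\<in>cycle_set p. of_bool (card C - 1 = j))"
  unfolding reduced_type_def using finite_cycle_set[OF assms]
  by (simp add: count_image_mset_eq_card_vimage of_bool_def sum.If_cases Int_def)

text \<open>Grow a cycle of length \<open>i + 1\<close> on the new points \<open>N+1, \<dots>, N+1+i\<close>, one point at a time. Multiplicities
are compared for \<open>j > 0\<close> only, because for \<open>i = 0\<close> the new point is a fixed point.\<close>

lemma add_cycle:
  assumes "p permutes {1..N}"
  shows "\<exists>q. q permutes {1..Suc (N + i)} \<and> card (orbit q (Suc N)) = Suc i \<and>
    (\<forall>j>0. count (reduced_type q) j = count (reduced_type p) j + of_bool (i = j))"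
proof (induction i)
  case 0
  have "p (Suc N) = Suc N" using assms by (simp add: permutes_not_in)
  then have "orbit p (Suc N) = {Suc N}" by (simp add: orbit_eq_singleton_iff)
  moreover have "p permutes {1..Suc N}" using assms by (rule permutes_subset) auto
  ultimately show ?case by (intro exI[of _ p]) auto
next
  case (Suc i)
  then obtain q where q: "q permutes {1..Suc (N + i)}" "card (orbit q (Suc N)) = Suc i"
    "\<And>j. j > 0 \<Longrightarrow> count (reduced_type q) j = count (reduced_type p) j + of_bool (i = j)" by auto
  let ?a = "Suc N" and ?M = "Suc (Suc (N + i))"
  have pq: "permutation q" using q(1) by (rule permutes_atLeastAtMost_permutation)
  have "q ?M = ?M" using q(1) by (simp add: permutes_not_in)
  then have oM: "orbit q ?M = {?M}" by (simp add: orbit_eq_singleton_iff)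
  have sub: "orbit q ?a \<subseteq> {1..Suc (N + i)}" by (rule permutes_orbit_subset[OF q(1)]) simp
  then have M: "?M \<notin> orbit q ?a" by auto
  define q' where "q' = tr ?a ?M \<circ> q"
  have perm: "q' permutes {1..?M}"
    unfolding q'_def by (intro permutes_compose[OF permutes_subset[OF q(1)]] permutes_swap_id) auto
  have pq': "permutation q'" using perm by (rule permutes_atLeastAtMost_permutation)
  have "orbit q' ?a = orbit q ?a \<union> {?M}" using orbit_merge(1)[OF pq M, folded q'_def] oM by simp
  then have c: "card (orbit q' ?a) = Suc (Suc i)" using q(2) M finite_orbit_perm[OF pq] by simp
  have "count (reduced_type q') j = count (reduced_type p) j + of_bool (Suc i = j)" if j: "j > 0" for j
  proof -
    let ?f = "\<lambda>k. of_bool (k - 1 = j) :: nat"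
    have "count (reduced_type q') j + ?f (Suc i) + ?f 1 = count (reduced_type q) j + ?f (Suc i + 1)"
      using merge_sum[OF pq M, of ?f, folded q'_def] j unfolding oM q(2) count_reduced_type[OF pq] count_reduced_type[OF pq'] by simp
    then show ?thesis using q(3)[OF j] j by (simp add: of_bool_def split: if_splits)
  qed
  then show ?case using perm c by auto
qed

lemma representative_exists:
  assumes "0 \<notin># M"
  shows "\<exists>p. p permutes {1..sum_mset M + size M} \<and> reduced_type p = M"
  using assms
proof (induction M)
  case empty
  have "reduced_type id = {#}" by (simp add: reduced_type_def cycle_set_def)
  then show ?case using permutes_id by blast
next
  case (add k M)
  then obtain p where p: "p permutes {1..sum_mset M + size M}" "reduced_type p = M" by auto
  obtain q where q: "q permutes {1..Suc (sum_mset M + size M + k)}"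
    "\<And>j. j > 0 \<Longrightarrow> count (reduced_type q) j = count M j + of_bool (k = j)"
    using add_cycle[OF p(1), of k] p(2) by auto
  have pq: "permutation q" using q(1) by (rule permutes_atLeastAtMost_permutation)
  have "reduced_type q = add_mset k M"
  proof (rule multiset_eqI)
    fix j show "count (reduced_type q) j = count (add_mset k M) j"
    proof (cases "j = 0")
      case True
      then show ?thesis using zero_not_in_reduced_type[OF pq] add.prems by (simp add: not_in_iff)
    qed (use q(2)[of j] in auto)
  qed
  then show ?case using q(1) by (intro exI[of _ q]) (simp add: add.commute add.left_commute)
qed

section \<open>Integer partitions\<close>

lemma zero_notin_parts: "0 \<notin># parts l" using parts[of l] by simp

lemma parts_inject: "parts l = parts m \<longleftrightarrow> l = m" by (rule parts_inject)

lemma parts_Abs: "0 \<notin># M \<Longrightarrow> parts (Abs_int_partition M) = M" by (simp add: Abs_int_partition_inverse)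

definition plen :: "int_partition \<Rightarrow> nat" where "plen l = size (parts l)"

text \<open>A permutation of reduced cycle type \<open>l\<close> that moves all the points \<open>1, \<dots>, |l| + len l\<close>.\<close>

definition repr :: "int_partition \<Rightarrow> nat \<Rightarrow> nat" where
  "repr l = (SOME p. p permutes {1..psize l + plen l} \<and> reduced_type p = parts l)"

lemma repr: "repr l permutes {1..psize l + plen l}" "reduced_type (repr l) = parts l"
  using someI_ex[OF representative_exists[OF zero_notin_parts[of l]]]
  by (auto simp: repr_def psize_def plen_def)

lemma permutation_repr: "permutation (repr l)"
  using repr(1) by (rule permutes_atLeastAtMost_permutation)

lemma card_supp_type:
  "permutation p \<Longrightarrow> reduced_type p = parts l \<Longrightarrow> card (supp p) = psize l + plen l"
  by (simp add: card_supp perm_rank_eq psize_def plen_def size_reduced_type[symmetric])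

lemma supp_repr: "supp (repr l) = {1..psize l + plen l}"
proof (rule card_subset_eq)
  show "supp (repr l) \<subseteq> {1..psize l + plen l}" using supp_subset_iff[OF permutation_repr] repr(1) by blast
qed (simp_all add: card_supp_type permutation_repr repr)

lemma perm_rank_repr: "perm_rank (repr l) = psize l" by (simp add: perm_rank_eq repr psize_def)

lemma plen_le: "plen l \<le> psize l"
proof -
  have "0 \<notin># M \<Longrightarrow> size M \<le> sum_mset M" for M :: "nat multiset" by (induction M) auto
  then show ?thesis using zero_notin_parts[of l] by (simp add: plen_def psize_def)
qed

lemma finite_partitions: "finite {l. psize l \<le> d}"
proof -
  have "parts ` {l. psize l \<le> d} \<subseteq> mset ` {xs. set xs \<subseteq> {..d} \<and> length xs \<le> d}"
  proof
    fix M assume "M \<in> parts ` {l. psize l \<le> d}"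
    then obtain l where l: "psize l \<le> d" "M = parts l" by auto
    obtain xs where xs: "mset xs = M" using ex_mset by blast
    have "size M \<le> d" using plen_le[of l] l by (simp add: plen_def)
    moreover have "x \<le> d" if "x \<in># M" for x
      using l that by (auto simp: psize_def dest!: multi_member_split)
    ultimately have "xs \<in> {xs. set xs \<subseteq> {..d} \<and> length xs \<le> d}" using xs by auto
    then show "M \<in> mset ` {xs. set xs \<subseteq> {..d} \<and> length xs \<le> d}" using xs by blast
  qed
  moreover have "finite {xs. set xs \<subseteq> {..d} \<and> length xs \<le> d}" by (rule finite_lists_length_le) simp
  ultimately have "finite (parts ` {l. psize l \<le> d})" using finite_surj by blast
  then show ?thesis using parts_inject by (auto intro: finite_imageD simp: inj_on_def)
qed

lemma finite_partitions_eq: "finite {l. psize l = d}"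
  by (rule finite_subset[OF _ finite_partitions[of d]]) auto

lemma type_eq_iff: "p permutes {1..n} \<Longrightarrow> reduced_cycle_type n p = l \<longleftrightarrow> reduced_type p = parts l"
  using reduced_cycle_type_eq[of p n] parts_inject by metis

lemma repr_type:
  assumes "psize l + plen l \<le> n"
  shows "repr l permutes {1..n}" "reduced_cycle_type n (repr l) = l"
proof -
  show "repr l permutes {1..n}" by (rule permutes_subset[OF repr(1)]) (use assms in auto)
  then show "reduced_cycle_type n (repr l) = l" by (simp add: type_eq_iff repr)
qed

lemma reduced_cycle_type_bound:
  assumes "p permutes {1..n}" "reduced_cycle_type n p = l"
  shows "psize l + plen l \<le> n" "card (supp p) = psize l + plen l"
proof -
  have p: "permutation p" using assms(1) by (rule permutes_atLeastAtMost_permutation)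
  show 1: "card (supp p) = psize l + plen l" using assms type_eq_iff card_supp_type[OF p] by blast
  have "supp p \<subseteq> {1..n}" using assms(1) supp_subset_iff[OF p] by blast
  then have "card (supp p) \<le> card {1..n}" by (intro card_mono) auto
  then show "psize l + plen l \<le> n" using 1 by simp
qed

section \<open>Structure constants of class sums are integer-valued polynomials\<close>

lemma gchoose_Ints: "(of_int z gchoose k :: rat) \<in> \<int>"
proof (cases "z \<ge> 0")
  case True
  then obtain n where "z = int n" using nonneg_int_cases by blast
  then show ?thesis by (simp flip: binomial_gbinomial)
next
  case False
  then obtain n where n: "int k - z - 1 = int n" using nonneg_int_cases[of "int k - z - 1"] by auto
  have "(of_nat k - of_int z - 1 :: rat) = of_int (int k - z - 1)" by simp
  also have "\<dots> = of_nat n" unfolding n by simp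
  finally have "(of_int z gchoose k :: rat) = (-1) ^ k * of_nat (n choose k)"
    by (subst gbinomial_negated_upper) (simp add: binomial_gbinomial)
  then show ?thesis by simp
qed

definition binom_rat_poly :: "nat \<Rightarrow> nat \<Rightarrow> rat poly" where
  "binom_rat_poly s k = smult (1 / fact k) (\<Prod>i<k. [:- of_nat (s + i), 1:])"

lemma poly_binom: "poly (binom_rat_poly s k) x = (x - of_nat s) gchoose k"
  unfolding binom_rat_poly_def gbinomial_prod_rev
  by (simp add: poly_prod algebra_simps atLeast0LessThan)

text \<open>The polynomial \<open>(t - s)\<close> choose \<open>k\<close>.\<close>

lift_definition binom_poly :: "nat \<Rightarrow> nat \<Rightarrow> intval_poly" is binom_rat_poly
proof -
  fix s k :: nat and m :: int
  have "poly (binom_rat_poly s k) (of_int m) = of_int (m - int s) gchoose k" by (simp add: poly_binom)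
  then show "poly (binom_rat_poly s k) (of_int m) \<in> \<int>" using gchoose_Ints by metis
qed

lemma ieval_0 [simp]: "ieval 0 m = 0" by (simp add: ieval_def zero_intval_poly.rep_eq)
lemma ieval_1 [simp]: "ieval 1 m = 1" by (simp add: ieval_def one_intval_poly.rep_eq)

lemma ieval_eqI: "poly (rat_poly_of f) (of_int m) = of_int k \<Longrightarrow> ieval f m = k"
  by (simp add: ieval_def)

lemma ieval_add [simp]: "ieval (f + g) m = ieval f m + ieval g m"
  by (rule ieval_eqI) (simp add: plus_intval_poly.rep_eq of_int_ieval)

lemma ieval_mult [simp]: "ieval (f * g) m = ieval f m * ieval g m"
  by (rule ieval_eqI) (simp add: times_intval_poly.rep_eq of_int_ieval)

lemma ieval_diff [simp]: "ieval (f - g) m = ieval f m - ieval g m"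
  by (rule ieval_eqI) (simp add: minus_intval_poly.rep_eq of_int_ieval)

lemma ieval_sum [simp]: "ieval (sum f A) m = (\<Sum>a\<in>A. ieval (f a) m)"
  by (induction A rule: infinite_finite_induct) auto

lemma ieval_of_nat [simp]: "ieval (of_nat n) m = int n" by (induction n) auto

lemma ieval_of_int [simp]: "ieval (of_int z) m = z"
proof (cases z rule: int_diff_cases)
  case (diff a b) then show ?thesis by simp
qed

lemma ieval_binom: "s \<le> n \<Longrightarrow> ieval (binom_poly s k) (int n) = int ((n - s) choose k)"
  by (rule ieval_eqI) (simp add: binom_poly.rep_eq poly_binom binomial_gbinomial of_nat_diff)

lemma intval_poly_eqI:
  assumes "\<And>n. n \<ge> N \<Longrightarrow> ieval f (int n) = ieval g (int n)"
  shows "f = g"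
proof -
  have "poly (rat_poly_of f) (of_nat n) = poly (rat_poly_of g) (of_nat n)" if "n \<ge> N" for n
    using of_int_ieval[of f "int n"] of_int_ieval[of g "int n"] assms[OF that] by simp
  then have sub: "of_nat ` {N..} \<subseteq> {x. poly (rat_poly_of f - rat_poly_of g) x = 0}" by auto
  have "infinite (of_nat ` {N..} :: rat set)"
    by (subst finite_image_iff) (auto simp: inj_on_def infinite_Ici)
  then have "infinite {x. poly (rat_poly_of f - rat_poly_of g) x = 0}" using sub finite_subset by blast
  then have "rat_poly_of f - rat_poly_of g = 0" using poly_roots_finite by blast
  then show ?thesis by (simp add: rat_poly_of_inject)
qed

text \<open>Factorizations of \<open>p\<close> into factors of given types, sorted by the set of points that they move. This
does not refer to an ambient symmetric group.\<close>

definition factor_pairs :: "int_partition \<Rightarrow> int_partition \<Rightarrow> (nat \<Rightarrow> nat) \<Rightarrow> nat set \<Rightarrow> ((nat \<Rightarrow> nat) \<times> (nat \<Rightarrow> nat)) set" where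
  "factor_pairs m m' p U = {(q, r). permutation q \<and> permutation r \<and> q \<circ> r = p \<and> reduced_type q = parts m \<and>
     reduced_type r = parts m' \<and> supp q \<union> supp r = U}"

lemma factor_pairs_conj_subset:
  assumes \<pi>: "permutation \<pi>"
  shows "(\<lambda>(q, r). (\<pi> \<circ> q \<circ> inv \<pi>, \<pi> \<circ> r \<circ> inv \<pi>)) ` factor_pairs m m' p U \<subseteq> factor_pairs m m' (\<pi> \<circ> p \<circ> inv \<pi>) (\<pi> ` U)"
proof clarify
  fix q r assume "(q, r) \<in> factor_pairs m m' p U"
  then have *: "permutation q" "permutation r" "q \<circ> r = p" "reduced_type q = parts m" "reduced_type r = parts m'" "supp q \<union> supp r = U"
    by (auto simp: factor_pairs_def)
  have bij: "bij \<pi>" using \<pi> permutation_bijective by blast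
  have "(\<pi> \<circ> q \<circ> inv \<pi>) \<circ> (\<pi> \<circ> r \<circ> inv \<pi>) = \<pi> \<circ> q \<circ> (inv \<pi> \<circ> \<pi>) \<circ> r \<circ> inv \<pi>" by (simp add: comp_assoc)
  also have "\<dots> = \<pi> \<circ> p \<circ> inv \<pi>" using bij *(3) by (simp add: bij_is_inj comp_assoc)
  finally show "(\<pi> \<circ> q \<circ> inv \<pi>, \<pi> \<circ> r \<circ> inv \<pi>) \<in> factor_pairs m m' (\<pi> \<circ> p \<circ> inv \<pi>) (\<pi> ` U)"
    using * bij \<pi> by (auto simp only: factor_pairs_def mem_Collect_eq prod.case reduced_type_conj cycle_set_conj(2)
      permutation_compose permutation_inverse image_Un)
qed

lemma finite_factor_pairs: "finite U \<Longrightarrow> finite (factor_pairs m m' p U)"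
proof (rule finite_subset)
  show "factor_pairs m m' p U \<subseteq> {q. q permutes U} \<times> {r. r permutes U}"
    by (auto simp: factor_pairs_def simp flip: supp_subset_iff)
qed (simp add: finite_permutations)

lemma conj_inj: "bij \<pi> \<Longrightarrow> inj (\<lambda>(q, r). (\<pi> \<circ> q \<circ> inv \<pi>, \<pi> \<circ> r \<circ> inv \<pi>))"
proof (rule injI, clarify)
  fix q r q' r' assume b: "bij \<pi>" and e: "\<pi> \<circ> q \<circ> inv \<pi> = \<pi> \<circ> q' \<circ> inv \<pi>" "\<pi> \<circ> r \<circ> inv \<pi> = \<pi> \<circ> r' \<circ> inv \<pi>"
  have x: "s = s'" if "\<pi> \<circ> s \<circ> inv \<pi> = \<pi> \<circ> s' \<circ> inv \<pi>" for s s'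
  proof
    fix x
    have "(\<pi> \<circ> s \<circ> inv \<pi>) (\<pi> x) = (\<pi> \<circ> s' \<circ> inv \<pi>) (\<pi> x)" unfolding that ..
    then show "s x = s' x" using b by (simp add: bij_is_inj inj_eq)
  qed
  show "q = q' \<and> r = r'" using x e by blast
qed

lemma card_factor_pairs_conj_le:
  assumes \<pi>: "permutation \<pi>" "finite U"
  shows "card (factor_pairs m m' p U) \<le> card (factor_pairs m m' (\<pi> \<circ> p \<circ> inv \<pi>) (\<pi> ` U))"
proof (rule card_inj_on_le)
  show "inj_on (\<lambda>(q, r). (\<pi> \<circ> q \<circ> inv \<pi>, \<pi> \<circ> r \<circ> inv \<pi>)) (factor_pairs m m' p U)"
    using conj_inj[of \<pi>] permutation_bijective[OF \<pi>(1)] inj_on_subset by blast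
qed (use factor_pairs_conj_subset[OF \<pi>(1)] finite_factor_pairs \<pi>(2) in auto)

lemma card_factor_pairs_eq:
  assumes p: "permutation p" "permutation p'" "reduced_type p = reduced_type p'"
    "finite U" "finite U'" "supp p \<subseteq> U" "supp p' \<subseteq> U'" "card U = card U'"
  shows "card (factor_pairs m m' p U) = card (factor_pairs m m' p' U')"
proof (rule antisym)
  obtain \<pi> where "permutation \<pi>" "\<pi> ` U = U'" "\<pi> \<circ> p \<circ> inv \<pi> = p'" using same_type_conjugate[OF assms] by auto
  then show "card (factor_pairs m m' p U) \<le> card (factor_pairs m m' p' U')" using card_factor_pairs_conj_le[of \<pi> U m m' p] assms by simp
  obtain \<pi> where "permutation \<pi>" "\<pi> ` U' = U" "\<pi> \<circ> p' \<circ> inv \<pi> = p"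
    using same_type_conjugate[of p' p U' U] assms by auto
  then show "card (factor_pairs m m' p' U') \<le> card (factor_pairs m m' p U)" using card_factor_pairs_conj_le[of \<pi> U' m m' p'] assms by simp
qed

definition support_size :: "int_partition \<Rightarrow> nat" where "support_size l = psize l + plen l"

text \<open>The number of factorizations whose factors together move \<open>k\<close> points besides those moved by the
product, for a representative of the class \<open>l\<close>.\<close>

definition factor_pair_number :: "int_partition \<Rightarrow> int_partition \<Rightarrow> int_partition \<Rightarrow> nat \<Rightarrow> nat" where
  "factor_pair_number m m' l k = card (factor_pairs m m' (repr l) {1..support_size l + k})"

lemma factor_pairs_empty:
  assumes "factor_pairs m m' p U \<noteq> {}" shows "card U \<le> support_size m + support_size m'" "supp p \<subseteq> U"
proof -
  obtain q r where *: "permutation q" "permutation r" "q \<circ> r = p" "reduced_type q = parts m" "reduced_type r = parts m'" "supp q \<union> supp r = U"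
    using assms by (auto simp: factor_pairs_def)
  show "card U \<le> support_size m + support_size m'"
    using card_Un_le[of "supp q" "supp r"] card_supp_type[OF *(1,4)] card_supp_type[OF *(2,5)] *(6) by (simp add: support_size_def)
  show "supp p \<subseteq> U" using *(3,6) by (auto simp: supp_def)
qed

lemma factor_pair_number_zero: "support_size m + support_size m' < support_size l + k \<Longrightarrow> factor_pair_number m m' l k = 0"
  using factor_pairs_empty(1)[of m m' "repr l" "{1..support_size l + k}"] by (force simp: factor_pair_number_def)

lemma card_supersets:
  assumes "finite A" "S \<subseteq> A"
  shows "card {U. S \<subseteq> U \<and> U \<subseteq> A \<and> card U = card S + k} = (card A - card S) choose k"
proof -
  have fS: "finite S" using assms finite_subset by blast
  have "bij_betw (\<lambda>V. S \<union> V) {V. V \<subseteq> A - S \<and> card V = k} {U. S \<subseteq> U \<and> U \<subseteq> A \<and> card U = card S + k}"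
  proof (rule bij_betw_byWitness[where f' = "\<lambda>U. U - S"])
    show "(\<union>) S ` {V. V \<subseteq> A - S \<and> card V = k} \<subseteq> {U. S \<subseteq> U \<and> U \<subseteq> A \<and> card U = card S + k}"
    proof clarify
      fix V assume V: "V \<subseteq> A - S" "k = card V"
      have "finite V" using V assms finite_subset by blast
      then have "card (S \<union> V) = card S + card V" using V fS by (intro card_Un_disjoint) auto
      then show "S \<subseteq> S \<union> V \<and> S \<union> V \<subseteq> A \<and> card (S \<union> V) = card S + card V" using V assms by auto
    qed
    show "(\<lambda>U. U - S) ` {U. S \<subseteq> U \<and> U \<subseteq> A \<and> card U = card S + k} \<subseteq> {V. V \<subseteq> A - S \<and> card V = k}"
      using fS by (auto simp: card_Diff_subset)
  qed auto
  then have "card {U. S \<subseteq> U \<and> U \<subseteq> A \<and> card U = card S + k} = card {V. V \<subseteq> A - S \<and> card V = k}"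
    using bij_betw_same_card by fastforce
  also have "\<dots> = card (A - S) choose k" using assms by (intro n_subsets) auto
  also have "card (A - S) = card A - card S" using assms fS by (simp add: card_Diff_subset)
  finally show ?thesis .
qed

text \<open>Sort the factorizations by the set \<open>U\<close> of moved points. It contains the support of \<open>p\<close>, and there are
\<open>(n - |supp p|)\<close> choose \<open>k\<close> sets \<open>U\<close> with \<open>k\<close> more points.\<close>

lemma class_product_coeff:
  assumes p: "p permutes {1..n}" and l: "reduced_cycle_type n p = l"
  shows "group_ring_mult n (class_sum n m) (class_sum n m') p =
     (\<Sum>k\<le>support_size m + support_size m'. int (factor_pair_number m m' l k) * int ((n - support_size l) choose k))"
proof -
  let ?K = "support_size m + support_size m'"
  have pp: "permutation p" using p by (rule permutes_atLeastAtMost_permutation)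
  have tl: "reduced_type p = parts l" using l type_eq_iff[OF p] by simp
  have cs: "card (supp p) = support_size l" using reduced_cycle_type_bound[OF p l] by (simp add: support_size_def)
  have sp: "supp p \<subseteq> {1..n}" using p supp_subset_iff[OF pp] by simp
  have pm: "q permutes {1..n} \<longleftrightarrow> permutation q \<and> supp q \<subseteq> {1..n}" for q
    using supp_subset_iff permutes_atLeastAtMost_permutation by metis
  let ?T = "{(q, r). q permutes {1..n} \<and> r permutes {1..n} \<and> q \<circ> r = p}"
  let ?P = "\<Union>U\<in>{U. supp p \<subseteq> U \<and> U \<subseteq> {1..n}}. factor_pairs m m' p U"
  have finT: "finite ?T"
    by (rule finite_subset[of _ "{q. q permutes {1..n}} \<times> {q. q permutes {1..n}}"]) (auto simp: finite_permutations)
  have finU: "finite {U. supp p \<subseteq> U \<and> U \<subseteq> {1..n}}" by (rule finite_subset[of _ "Pow {1..n}"]) auto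
  have PT: "?P = {(q, r). (q, r) \<in> ?T \<and> reduced_type q = parts m \<and> reduced_type r = parts m'}"
  proof (intro set_eqI iffI)
    fix x assume "x \<in> {(q, r). (q, r) \<in> ?T \<and> reduced_type q = parts m \<and> reduced_type r = parts m'}"
    then obtain q r where x: "x = (q, r)" "q permutes {1..n}" "r permutes {1..n}" "q \<circ> r = p"
      "reduced_type q = parts m" "reduced_type r = parts m'" by auto
    have "permutation q" "permutation r" using x(2,3) by (auto intro: permutes_atLeastAtMost_permutation)
    then have "x \<in> factor_pairs m m' p (supp q \<union> supp r)" using x by (auto simp: factor_pairs_def)
    moreover from this have "supp p \<subseteq> supp q \<union> supp r" using factor_pairs_empty(2) by blast
    moreover have "supp q \<union> supp r \<subseteq> {1..n}" using x pm by auto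
    ultimately show "x \<in> ?P" by blast
  qed (auto simp: factor_pairs_def pm simp del: One_nat_def)
  have "group_ring_mult n (class_sum n m) (class_sum n m') p =
    (\<Sum>x\<in>?T. of_bool (reduced_type (fst x) = parts m \<and> reduced_type (snd x) = parts m'))"
    unfolding group_ring_mult_def by (intro sum.cong refl) (auto simp: class_sum_def type_eq_iff)
  also have "\<dots> = int (card ?P)"
    unfolding PT using finT by (simp add: of_bool_def sum.If_cases Int_def case_prod_unfold)
  also have "card ?P = (\<Sum>U\<in>{U. supp p \<subseteq> U \<and> U \<subseteq> {1..n}}. card (factor_pairs m m' p U))"
    by (rule card_UN_disjoint) (use finU in \<open>auto simp: factor_pairs_def intro!: finite_factor_pairs[unfolded factor_pairs_def] intro: finite_subset[OF _ finite_atLeastAtMost]\<close>)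
  also have "\<dots> = (\<Sum>U\<in>{U. supp p \<subseteq> U \<and> U \<subseteq> {1..n}}. factor_pair_number m m' l (card U - card (supp p)))"
  proof (intro sum.cong refl)
    fix U assume U: "U \<in> {U. supp p \<subseteq> U \<and> U \<subseteq> {1..n}}"
    have fU: "finite U" using U finite_subset by blast
    have "card (supp p) \<le> card U" using U fU by (intro card_mono) auto
    then show "card (factor_pairs m m' p U) = factor_pair_number m m' l (card U - card (supp p))"
      unfolding factor_pair_number_def using tl fU U cs supp_repr[of l]
      by (intro card_factor_pairs_eq pp permutation_repr) (auto simp: repr support_size_def)
  qed
  also have "\<dots> = (\<Sum>k\<le>n + ?K. \<Sum>U\<in>{U\<in>{U. supp p \<subseteq> U \<and> U \<subseteq> {1..n}}. card U - card (supp p) = k}. factor_pair_number m m' l (card U - card (supp p)))"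
  proof (rule sum.group[symmetric])
    show "(\<lambda>U. card U - card (supp p)) ` {U. supp p \<subseteq> U \<and> U \<subseteq> {1..n}} \<subseteq> {..n + ?K}"
    proof clarify
      fix U assume "U \<subseteq> {1..n}"
      then have "card U \<le> n" using card_mono[of "{1..n}" U] by simp
      then show "card U - card (supp p) \<le> n + ?K" by linarith
    qed
  qed (use finU in auto)
  also have "\<dots> = (\<Sum>k\<le>n + ?K. factor_pair_number m m' l k * ((n - support_size l) choose k))"
  proof (intro sum.cong refl)
    fix k
    have "{U\<in>{U. supp p \<subseteq> U \<and> U \<subseteq> {1..n}}. card U - card (supp p) = k} = {U. supp p \<subseteq> U \<and> U \<subseteq> {1..n} \<and> card U = card (supp p) + k}"
    proof -
      have "card (supp p) \<le> card U" if "supp p \<subseteq> U" "U \<subseteq> {1..n}" for U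
        using that finite_subset[of U "{1..n}"] by (intro card_mono) auto
      then show ?thesis by auto
    qed
    moreover have "card \<dots> = (n - support_size l) choose k"
      using card_supersets[of "{1..n}" "supp p" k] sp cs by simp
    ultimately show "(\<Sum>U\<in>{U\<in>{U. supp p \<subseteq> U \<and> U \<subseteq> {1..n}}. card U - card (supp p) = k}. factor_pair_number m m' l (card U - card (supp p))) =
      factor_pair_number m m' l k * ((n - support_size l) choose k)" by simp
  qed
  also have "\<dots> = (\<Sum>k\<le>?K. factor_pair_number m m' l k * ((n - support_size l) choose k))"
    by (rule sum.mono_neutral_right) (auto intro!: factor_pair_number_zero)
  finally show ?thesis by simp
qed

text \<open>For large \<open>l\<close> all the counts vanish, and the case distinction makes the finite support evident.\<close>

lift_definition fh_phi :: "int_partition \<Rightarrow> int_partition \<Rightarrow> (int_partition \<Rightarrow>\<^sub>0 intval_poly)" is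
  "\<lambda>m m' l. if support_size l \<le> support_size m + support_size m'
     then \<Sum>k\<le>support_size m + support_size m'. of_nat (factor_pair_number m m' l k) * binom_poly (support_size l) k else 0"
proof -
  fix m m'
  show "finite {l. (if support_size l \<le> support_size m + support_size m'
     then \<Sum>k\<le>support_size m + support_size m'. of_nat (factor_pair_number m m' l k) * binom_poly (support_size l) k else 0) \<noteq> 0}"
    by (rule finite_subset[OF _ finite_partitions[of "support_size m + support_size m'"]]) (auto simp: support_size_def split: if_splits)
qed

lemma sum_class_sum:
  "(\<Sum>l\<in>Poly_Mapping.keys phi. ieval (Poly_Mapping.lookup phi l) (int n) * class_sum n l p) =
    (if p permutes {1..n} then ieval (Poly_Mapping.lookup phi (reduced_cycle_type n p)) (int n) else 0)"
proof (cases "p permutes {1..n}")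
  case True
  have "(\<Sum>l\<in>Poly_Mapping.keys phi. ieval (Poly_Mapping.lookup phi l) (int n) * class_sum n l p) =
    (\<Sum>l\<in>Poly_Mapping.keys phi. if l = reduced_cycle_type n p then ieval (Poly_Mapping.lookup phi l) (int n) else 0)"
    using True by (intro sum.cong refl) (auto simp: class_sum_def)
  also have "\<dots> = ieval (Poly_Mapping.lookup phi (reduced_cycle_type n p)) (int n)"
    by (auto simp: in_keys_iff)
  finally show ?thesis using True by simp
qed (simp add: class_sum_def)

lemma group_ring_mult_outside:
  assumes "\<not> p permutes {1..n}" shows "group_ring_mult n a b p = 0"
proof -
  have "{(q, r). q permutes {1..n} \<and> r permutes {1..n} \<and> q \<circ> r = p} = {}"
    using assms permutes_compose by blast
  then show ?thesis unfolding group_ring_mult_def by (simp only: sum.empty)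
qed

lemma fh_phi:
  "group_ring_mult n (class_sum n m) (class_sum n m') =
     (\<lambda>p. \<Sum>l\<in>Poly_Mapping.keys (fh_phi m m'). ieval (Poly_Mapping.lookup (fh_phi m m') l) (int n) * class_sum n l p)"
proof
  fix p
  show "group_ring_mult n (class_sum n m) (class_sum n m') p =
     (\<Sum>l\<in>Poly_Mapping.keys (fh_phi m m'). ieval (Poly_Mapping.lookup (fh_phi m m') l) (int n) * class_sum n l p)"
  proof (cases "p permutes {1..n}")
    case True
    define l where "l = reduced_cycle_type n p"
    have le: "support_size l \<le> n" using reduced_cycle_type_bound(1)[OF True l_def[symmetric]] by (simp add: support_size_def)
    show ?thesis
      unfolding sum_class_sum class_product_coeff[OF True l_def[symmetric]]
      using True le by (auto simp: fh_phi.rep_eq ieval_binom factor_pair_number_zero simp flip: l_def)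
  qed (simp add: sum_class_sum group_ring_mult_outside)
qed

text \<open>Every class is nonempty in all large symmetric groups, so the values at all large \<open>n\<close> are determined.\<close>

lemma phi_unique:
  assumes "\<And>n p. p permutes {1..n} \<Longrightarrow> ieval (Poly_Mapping.lookup phi (reduced_cycle_type n p)) (int n) =
    ieval (Poly_Mapping.lookup psi (reduced_cycle_type n p)) (int n)"
  shows "phi = psi"
proof (rule poly_mapping_eqI)
  fix l
  show "Poly_Mapping.lookup phi l = Poly_Mapping.lookup psi l"
  proof (rule intval_poly_eqI)
    fix n assume "psize l + plen l \<le> n"
    then show "ieval (Poly_Mapping.lookup phi l) (int n) = ieval (Poly_Mapping.lookup psi l) (int n)"
      using assms[of "repr l" n] repr_type[of l n] by simp
  qed
qed

lemma fh_coeff_eq: "fh_coeff m m' = fh_phi m m'"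
  unfolding fh_coeff_def
proof (rule the_equality)
  show "\<forall>n. group_ring_mult n (class_sum n m) (class_sum n m') =
     (\<lambda>p. \<Sum>l\<in>Poly_Mapping.keys (fh_phi m m'). ieval (Poly_Mapping.lookup (fh_phi m m') l) (int n) * class_sum n l p)"
    using fh_phi by blast
  fix phi assume phi: "\<forall>n. group_ring_mult n (class_sum n m) (class_sum n m') =
     (\<lambda>p. \<Sum>l\<in>Poly_Mapping.keys phi. ieval (Poly_Mapping.lookup phi l) (int n) * class_sum n l p)"
  show "phi = fh_phi m m'"
  proof (rule phi_unique)
    fix n and p :: "nat \<Rightarrow> nat" assume p: "p permutes {1..n}"
    have "(\<Sum>l\<in>Poly_Mapping.keys phi. ieval (Poly_Mapping.lookup phi l) (int n) * class_sum n l p) =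
      (\<Sum>l\<in>Poly_Mapping.keys (fh_phi m m'). ieval (Poly_Mapping.lookup (fh_phi m m') l) (int n) * class_sum n l p)"
      using fun_cong[OF phi[rule_format, of n], of p] fun_cong[OF fh_phi[of n m m'], of p] by simp
    then show "ieval (Poly_Mapping.lookup phi (reduced_cycle_type n p)) (int n) =
      ieval (Poly_Mapping.lookup (fh_phi m m') (reduced_cycle_type n p)) (int n)"
      unfolding sum_class_sum using p by simp
  qed
qed

section \<open>The Farahat--Higman ring and its specializations\<close>

lemma lookup_smul [simp]: "Poly_Mapping.lookup (smul c x) k = c * Poly_Mapping.lookup x k"
  by (simp add: smul_def Poly_Mapping.map.rep_eq when_def)

text \<open>The specialization to the group ring of \<open>S\<^sub>n\<close>: put \<open>t = n\<close> and replace basis elements by class sums.\<close>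

definition ev :: "nat \<Rightarrow> fh \<Rightarrow> (nat \<Rightarrow> nat) \<Rightarrow> int" where
  "ev n x p = (if p permutes {1..n} then ieval (Poly_Mapping.lookup x (reduced_cycle_type n p)) (int n) else 0)"

lemma ev_sum_class: "ev n x p = (\<Sum>l\<in>Poly_Mapping.keys x. ieval (Poly_Mapping.lookup x l) (int n) * class_sum n l p)"
  by (simp add: ev_def sum_class_sum)

lemma ev_eqI: "(\<And>n. ev n x = ev n y) \<Longrightarrow> x = y"
proof (rule phi_unique)
  fix n and p :: "nat \<Rightarrow> nat" assume "\<And>n. ev n x = ev n y" and p: "p permutes {1..n}"
  then have "ev n x p = ev n y p" by simp
  then show "ieval (Poly_Mapping.lookup x (reduced_cycle_type n p)) (int n) =
    ieval (Poly_Mapping.lookup y (reduced_cycle_type n p)) (int n)" using p by (simp add: ev_def)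
qed

lemma ev_add: "ev n (x + y) p = ev n x p + ev n y p" by (simp add: ev_def lookup_add)
lemma ev_zero: "ev n 0 p = 0" by (simp add: ev_def)
lemma ev_smul: "ev n (smul c x) p = ieval c (int n) * ev n x p" by (simp add: ev_def)
lemma ev_sum: "ev n (sum f A) p = (\<Sum>a\<in>A. ev n (f a) p)"
  by (induction A rule: infinite_finite_induct) (simp_all add: ev_add ev_zero)
lemma ev_fhK: "ev n (fhK m) = class_sum n m"
  by (auto simp: fun_eq_iff ev_def fhK_def class_sum_def lookup_single when_def)

lemma ev_outside: "\<not> p permutes {1..n} \<Longrightarrow> ev n x p = 0" by (simp add: ev_def)

lemma ev_fh_coeff: "ev n (fh_coeff m m') p = group_ring_mult n (class_sum n m) (class_sum n m') p"
  unfolding ev_sum_class fh_coeff_eq fh_phi[of n m m'] ..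

abbreviation Sym :: "nat \<Rightarrow> (nat \<Rightarrow> nat) set" where "Sym n \<equiv> {p. p permutes {1..n}}"

lemmas finite_permutations [simp]

lemma group_ring_mult_eq:
  assumes p: "p permutes {1..n}"
  shows "group_ring_mult n a b p = (\<Sum>q\<in>Sym n. a q * b (inv q \<circ> p))"
  unfolding group_ring_mult_def
proof (rule sum.reindex_bij_witness[where i = "\<lambda>q. (q, inv q \<circ> p)" and j = fst])
  fix x assume "x \<in> {(q, r). q permutes {1..n} \<and> r permutes {1..n} \<and> q \<circ> r = p}"
  then obtain q r where x: "x = (q, r)" "q permutes {1..n}" "r permutes {1..n}" "q \<circ> r = p" by auto
  have e: "inv q \<circ> p = r" using permutes_inv_o(2)[OF x(2)] by (simp add: x(4)[symmetric] comp_assoc[symmetric])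
  show "(fst x, inv (fst x) \<circ> p) = x" using e x by simp
  show "fst x \<in> Sym n" using x by simp
  show "a (fst x) * b (inv (fst x) \<circ> p) = (case x of (q, r) \<Rightarrow> a q * b r)" using e x by simp
next
  fix q assume q: "q \<in> Sym n"
  then have "q \<circ> (inv q \<circ> p) = p" using permutes_inv_o(1)[of q] by (simp add: comp_assoc[symmetric])
  moreover have "inv q \<circ> p permutes {1..n}" using q p by (intro permutes_compose permutes_inv) auto
  ultimately show "(q, inv q \<circ> p) \<in> {(q, r). q permutes {1..n} \<and> r permutes {1..n} \<and> q \<circ> r = p}" using q by simp
qed simp

lemma sum_Sym_comp_left: "g permutes {1..n} \<Longrightarrow> (\<Sum>q\<in>Sym n. F (g \<circ> q)) = (\<Sum>q\<in>Sym n. F q)"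
  using setum_permutations_compose_left[of g "{1..n}" F] by simp

lemma group_ring_mult_assoc:
  "group_ring_mult n (group_ring_mult n a b) c = group_ring_mult n a (group_ring_mult n b c)"
proof
  fix p
  show "group_ring_mult n (group_ring_mult n a b) c p = group_ring_mult n a (group_ring_mult n b c) p"
  proof (cases "p permutes {1..n}")
    case True
    have "group_ring_mult n (group_ring_mult n a b) c p = (\<Sum>q\<in>Sym n. (\<Sum>s\<in>Sym n. a s * b (inv s \<circ> q)) * c (inv q \<circ> p))"
      unfolding group_ring_mult_eq[OF True] by (intro sum.cong refl) (simp add: group_ring_mult_eq)
    also have "\<dots> = (\<Sum>s\<in>Sym n. \<Sum>q\<in>Sym n. a s * b (inv s \<circ> q) * c (inv q \<circ> p))"
      unfolding sum_distrib_right by (rule sum.swap)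
    also have "\<dots> = (\<Sum>s\<in>Sym n. a s * group_ring_mult n b c (inv s \<circ> p))"
    proof (rule sum.cong[OF refl])
      fix s assume "s \<in> Sym n"
      then have s: "s permutes {1..n}" by simp
      have sp: "inv s \<circ> p permutes {1..n}" using s True by (intro permutes_compose permutes_inv)
      have "(\<Sum>q\<in>Sym n. a s * b (inv s \<circ> q) * c (inv q \<circ> p)) = (\<Sum>q\<in>Sym n. a s * b (inv s \<circ> (s \<circ> q)) * c (inv (s \<circ> q) \<circ> p))"
        using sum_Sym_comp_left[OF s, of "\<lambda>q. a s * b (inv s \<circ> q) * c (inv q \<circ> p)"] by simp
      also have "\<dots> = (\<Sum>q\<in>Sym n. a s * (b q * c (inv q \<circ> (inv s \<circ> p))))"
      proof (rule sum.cong[OF refl])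
        fix q assume "q \<in> Sym n"
        then have q: "q permutes {1..n}" by simp
        have "inv s \<circ> (s \<circ> q) = q" using permutes_inv_o(2)[OF s] by (simp add: comp_assoc[symmetric])
        moreover have "inv (s \<circ> q) = inv q \<circ> inv s" using o_inv_distrib permutes_bij s q by blast
        ultimately show "a s * b (inv s \<circ> (s \<circ> q)) * c (inv (s \<circ> q) \<circ> p) = a s * (b q * c (inv q \<circ> (inv s \<circ> p)))"
          by (simp add: comp_assoc)
      qed
      finally show "(\<Sum>q\<in>Sym n. a s * b (inv s \<circ> q) * c (inv q \<circ> p)) = a s * group_ring_mult n b c (inv s \<circ> p)"
        by (simp add: group_ring_mult_eq[OF sp] sum_distrib_left)
    qed
    also have "\<dots> = group_ring_mult n a (group_ring_mult n b c) p" by (simp add: group_ring_mult_eq[OF True])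
    finally show ?thesis .
  qed (simp add: group_ring_mult_outside)
qed

lemma group_ring_mult_sum_left:
  "group_ring_mult n (\<lambda>p. \<Sum>i\<in>I. c i * a i p) b p = (\<Sum>i\<in>I. c i * group_ring_mult n (a i) b p)"
proof (cases "p permutes {1..n}")
  case True
  have "group_ring_mult n (\<lambda>p. \<Sum>i\<in>I. c i * a i p) b p = (\<Sum>q\<in>Sym n. \<Sum>i\<in>I. c i * a i q * b (inv q \<circ> p))"
    by (simp add: group_ring_mult_eq[OF True] sum_distrib_right)
  also have "\<dots> = (\<Sum>i\<in>I. \<Sum>q\<in>Sym n. c i * a i q * b (inv q \<circ> p))" by (rule sum.swap)
  finally show ?thesis by (simp add: group_ring_mult_eq[OF True] sum_distrib_left mult.assoc)
qed (simp add: group_ring_mult_outside)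

lemma group_ring_mult_sum_right:
  "group_ring_mult n a (\<lambda>p. \<Sum>i\<in>I. c i * b i p) p = (\<Sum>i\<in>I. c i * group_ring_mult n a (b i) p)"
proof (cases "p permutes {1..n}")
  case True
  have "group_ring_mult n a (\<lambda>p. \<Sum>i\<in>I. c i * b i p) p = (\<Sum>q\<in>Sym n. \<Sum>i\<in>I. c i * (a q * b i (inv q \<circ> p)))"
    by (simp add: group_ring_mult_eq[OF True] sum_distrib_left algebra_simps)
  also have "\<dots> = (\<Sum>i\<in>I. \<Sum>q\<in>Sym n. c i * (a q * b i (inv q \<circ> p)))" by (rule sum.swap)
  finally show ?thesis by (simp add: group_ring_mult_eq[OF True] sum_distrib_left)
qed (simp add: group_ring_mult_outside)

lemma ev_fh_mult: "ev n (fh_mult x y) = group_ring_mult n (ev n x) (ev n y)"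
proof
  fix p
  let ?X = "Poly_Mapping.keys x" and ?Y = "Poly_Mapping.keys y"
  let ?x = "\<lambda>m. ieval (Poly_Mapping.lookup x m) (int n)" and ?y = "\<lambda>m. ieval (Poly_Mapping.lookup y m) (int n)"
  have ex: "ev n x = (\<lambda>p. \<Sum>m\<in>?X. ?x m * class_sum n m p)" "ev n y = (\<lambda>p. \<Sum>m\<in>?Y. ?y m * class_sum n m p)"
    by (auto simp: ev_sum_class)
  have "ev n (fh_mult x y) p = (\<Sum>m\<in>?X. \<Sum>m'\<in>?Y. ?x m * ?y m' * group_ring_mult n (class_sum n m) (class_sum n m') p)"
    by (simp add: fh_mult_def ev_sum ev_smul ev_fh_coeff)
  also have "\<dots> = (\<Sum>m\<in>?X. ?x m * group_ring_mult n (class_sum n m) (ev n y) p)"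
    unfolding ex(2) group_ring_mult_sum_right sum_distrib_left by (simp add: mult.assoc)
  also have "\<dots> = group_ring_mult n (ev n x) (ev n y) p" unfolding ex(1) group_ring_mult_sum_left ..
  finally show "ev n (fh_mult x y) p = group_ring_mult n (ev n x) (ev n y) p" .
qed

definition class_fun :: "nat \<Rightarrow> ((nat \<Rightarrow> nat) \<Rightarrow> int) \<Rightarrow> bool" where
  "class_fun n a \<longleftrightarrow> (\<forall>g p. g permutes {1..n} \<longrightarrow> p permutes {1..n} \<longrightarrow> a (g \<circ> p \<circ> inv g) = a p)"

lemma reduced_cycle_type_conj:
  assumes "g permutes {1..n}" "p permutes {1..n}"
  shows "reduced_cycle_type n (g \<circ> p \<circ> inv g) = reduced_cycle_type n p"
proof -
  have "g \<circ> p \<circ> inv g permutes {1..n}" using assms by (intro permutes_compose permutes_inv)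
  moreover have "reduced_type (g \<circ> p \<circ> inv g) = reduced_type p"
    using assms permutes_bij permutes_atLeastAtMost_permutation by (intro reduced_type_conj) auto
  ultimately show ?thesis using reduced_cycle_type_eq assms(2) parts_inject by metis
qed

lemma class_fun_ev: "class_fun n (ev n x)"
  unfolding class_fun_def ev_def
  by (auto simp: reduced_cycle_type_conj permutes_compose permutes_inv)

text \<open>Class functions are central: substitute \<open>r = q\<^sup>-\<^sup>1 p\<close> and note that \<open>r\<^sup>-\<^sup>1 p\<close> is conjugate to \<open>q\<close>.\<close>

lemma group_ring_mult_commute:
  assumes "class_fun n a" shows "group_ring_mult n a b = group_ring_mult n b a"
proof
  fix p
  show "group_ring_mult n a b p = group_ring_mult n b a p"
  proof (cases "p permutes {1..n}")
    case True
    have "(\<Sum>q\<in>Sym n. a q * b (inv q \<circ> p)) = (\<Sum>r\<in>Sym n. b r * a (inv r \<circ> p))"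
    proof (rule sum.reindex_bij_witness[where i = "\<lambda>r. p \<circ> inv r" and j = "\<lambda>q. inv q \<circ> p"])
      fix q assume "q \<in> Sym n"
      then have q: "q permutes {1..n}" by simp
      have e: "inv (inv q \<circ> p) = inv p \<circ> q"
        using o_inv_distrib[OF permutes_bij[OF permutes_inv[OF q]] permutes_bij[OF True]] permutes_inv_inv[OF q] by simp
      show "p \<circ> inv (inv q \<circ> p) = q" unfolding e using permutes_inv_o[OF True] by (simp add: comp_assoc[symmetric])
      show "inv q \<circ> p \<in> Sym n" using q True by (auto intro: permutes_compose permutes_inv)
      have "a (inv p \<circ> q \<circ> inv (inv p)) = a q"
        using assms True q unfolding class_fun_def by (auto intro: permutes_inv)
      then show "b (inv q \<circ> p) * a (inv (inv q \<circ> p) \<circ> p) = a q * b (inv q \<circ> p)"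
        unfolding e using permutes_inv_inv[OF True] by simp
    next
      fix r assume "r \<in> Sym n"
      then have r: "r permutes {1..n}" by simp
      have e: "inv (p \<circ> inv r) = r \<circ> inv p"
        using o_inv_distrib[OF permutes_bij[OF True] permutes_bij[OF permutes_inv[OF r]]] permutes_inv_inv[OF r] by simp
      show "inv (p \<circ> inv r) \<circ> p = r" unfolding e using permutes_inv_o[OF True] by (simp add: comp_assoc)
      show "p \<circ> inv r \<in> Sym n" using r True by (auto intro: permutes_compose permutes_inv)
    qed
    then show ?thesis by (simp add: group_ring_mult_eq[OF True])
  qed (simp add: group_ring_mult_outside)
qed

lemma reduced_type_empty_iff: "permutation p \<Longrightarrow> reduced_type p = {#} \<longleftrightarrow> p = id"
proof -
  assume p: "permutation p"
  have "reduced_type p = {#} \<longleftrightarrow> perm_rank p = 0"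
    using zero_not_in_reduced_type[OF p] by (auto simp: perm_rank_eq) (metis multiset_nonemptyE)
  then show ?thesis using perm_rank_eq_0_iff[OF p] by simp
qed

lemma class_sum_empty: "p permutes {1..n} \<Longrightarrow> class_sum n empty_partition p = of_bool (p = id)"
  using reduced_type_empty_iff[OF permutes_atLeastAtMost_permutation, of p n]
  by (simp add: class_sum_def type_eq_iff empty_partition_def parts_Abs)

lemma group_ring_mult_one:
  assumes "\<And>p. \<not> p permutes {1..n} \<Longrightarrow> b p = 0"
  shows "group_ring_mult n (class_sum n empty_partition) b = b"
proof
  fix p
  show "group_ring_mult n (class_sum n empty_partition) b p = b p"
  proof (cases "p permutes {1..n}")
    case True
    have "group_ring_mult n (class_sum n empty_partition) b p = (\<Sum>q\<in>Sym n. if q = id then b (inv q \<circ> p) else 0)"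
      unfolding group_ring_mult_eq[OF True] by (intro sum.cong refl) (simp add: class_sum_empty)
    then show ?thesis by (simp add: sum.delta)
  qed (simp add: group_ring_mult_outside assms)
qed

text \<open>A copy of the Farahat--Higman algebra that carries its ring structure. On the type of finitely
supported functions itself, multiplication denotes convolution, which has no meaning here.\<close>

typedef fha = "UNIV :: fh set" by simp

instantiation fha :: comm_ring_1
begin

definition "0 = Abs_fha 0"
definition "1 = Abs_fha (fhK empty_partition)"
definition "x + y = Abs_fha (Rep_fha x + Rep_fha y)"
definition "x - y = Abs_fha (Rep_fha x - Rep_fha y)"
definition "- x = Abs_fha (- Rep_fha x)"
definition "x * y = Abs_fha (fh_mult (Rep_fha x) (Rep_fha y))"

lemma Rep_fha_simps:
  "Rep_fha 0 = 0" "Rep_fha 1 = fhK empty_partition" "Rep_fha (x + y) = Rep_fha x + Rep_fha y"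
  "Rep_fha (x - y) = Rep_fha x - Rep_fha y" "Rep_fha (- x) = - Rep_fha x"
  "Rep_fha (x * y) = fh_mult (Rep_fha x) (Rep_fha y)"
  by (simp_all add: zero_fha_def one_fha_def plus_fha_def minus_fha_def uminus_fha_def times_fha_def Abs_fha_inverse)

lemma fha_eqI: "(\<And>n. ev n (Rep_fha x) = ev n (Rep_fha y)) \<Longrightarrow> x = y"
  using ev_eqI[of "Rep_fha x" "Rep_fha y"] by (simp add: Rep_fha_inject)

instance
proof
  fix a b c :: fha
  show "(a * b) * c = a * (b * c)" by (rule fha_eqI) (simp add: Rep_fha_simps ev_fh_mult group_ring_mult_assoc)
  show "a * b = b * a"
    by (rule fha_eqI, simp only: Rep_fha_simps ev_fh_mult, rule group_ring_mult_commute[OF class_fun_ev])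
  show "1 * a = a"
    by (rule fha_eqI, simp only: Rep_fha_simps ev_fh_mult ev_fhK, rule group_ring_mult_one, rule ev_outside)
  have d: "group_ring_mult n (\<lambda>p. x p + y p) z = (\<lambda>p. group_ring_mult n x z p + group_ring_mult n y z p)" for n x y z
  proof
    fix p show "group_ring_mult n (\<lambda>p. x p + y p) z p = group_ring_mult n x z p + group_ring_mult n y z p"
      by (cases "p permutes {1..n}") (simp_all add: group_ring_mult_eq group_ring_mult_outside distrib_right sum.distrib)
  qed
  have e: "ev n (x + y) = (\<lambda>p. ev n x p + ev n y p)" for n x y by (simp add: fun_eq_iff ev_add)
  show "(a + b) * c = a * c + b * c"
    by (rule fha_eqI) (simp only: Rep_fha_simps ev_fh_mult d e)
  have "fhK empty_partition \<noteq> 0"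

  proof
    assume "fhK empty_partition = 0"
    then have "ieval (Poly_Mapping.lookup (fhK empty_partition) empty_partition) 0 = ieval (Poly_Mapping.lookup 0 empty_partition) 0" by simp
    then show False by (simp add: fhK_def)
  qed
  then show "(0 :: fha) \<noteq> 1" by (metis Rep_fha_simps(1,2))
  show "a + b + c = a + (b + c)" "a + b = b + a" "0 + a = a" "- a + a = 0" "a - b = a + - b"
    unfolding Rep_fha_inject[symmetric] Rep_fha_simps by (simp_all only: ac_simps add_0_left right_minus diff_conv_add_uminus)
qed

end

section \<open>Linear maps between free modules\<close>

abbreviation "lkp \<equiv> Poly_Mapping.lookup"

text \<open>The linear map between free modules with the images \<open>M i\<close> of the basis elements.\<close>

definition lin :: "('i \<Rightarrow> ('j \<Rightarrow>\<^sub>0 'r)) \<Rightarrow> ('i \<Rightarrow>\<^sub>0 'r) \<Rightarrow> ('j \<Rightarrow>\<^sub>0 'r :: comm_ring_1)" where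
  "lin M x = (\<Sum>i\<in>Poly_Mapping.keys x. smul (lkp x i) (M i))"

lemma lookup_lin_superset:
  assumes "finite I" "Poly_Mapping.keys x \<subseteq> I"
  shows "lkp (lin M x) j = (\<Sum>i\<in>I. lkp x i * lkp (M i) j)"
proof -
  have "lkp (lin M x) j = (\<Sum>i\<in>Poly_Mapping.keys x. lkp x i * lkp (M i) j)" by (simp add: lin_def lookup_sum)
  also have "\<dots> = (\<Sum>i\<in>I. lkp x i * lkp (M i) j)"
    by (rule sum.mono_neutral_left) (use assms in \<open>auto simp: in_keys_iff\<close>)
  finally show ?thesis .
qed

lemma lookup_lin: "lkp (lin M x) j = (\<Sum>i\<in>Poly_Mapping.keys x. lkp x i * lkp (M i) j)"
  by (rule lookup_lin_superset) auto

lemma lin_add: "lin M (x + y) = lin M x + lin M y"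
proof (rule poly_mapping_eqI)
  fix j
  let ?I = "Poly_Mapping.keys x \<union> Poly_Mapping.keys y"
  have I: "finite ?I" "Poly_Mapping.keys x \<subseteq> ?I" "Poly_Mapping.keys y \<subseteq> ?I" "Poly_Mapping.keys (x + y) \<subseteq> ?I"
    using keys_add[of x y] by auto
  show "lkp (lin M (x + y)) j = lkp (lin M x + lin M y) j"
    unfolding lookup_add lookup_lin_superset[OF I(1,4)] lookup_lin_superset[OF I(1,2)] lookup_lin_superset[OF I(1,3)]
    by (simp add: algebra_simps sum.distrib)
qed

lemma lin_smul: "lin M (smul c x) = smul c (lin M x)"
proof (rule poly_mapping_eqI)
  fix j
  have "Poly_Mapping.keys (smul c x) \<subseteq> Poly_Mapping.keys x" by (auto simp: in_keys_iff)
  then have "lkp (lin M (smul c x)) j = (\<Sum>i\<in>Poly_Mapping.keys x. lkp (smul c x) i * lkp (M i) j)"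
    by (intro lookup_lin_superset) auto
  then show "lkp (lin M (smul c x)) j = lkp (smul c (lin M x)) j"
    unfolding lookup_smul lookup_lin[of M x] by (simp add: sum_distrib_left mult.assoc)
qed

lemma lin_zero [simp]: "lin M 0 = 0" by (simp add: lin_def)

lemma lin_diff: "lin M (x - y) = lin M x - lin M y"
  using lin_add[of M "x - y" y] by (simp add: algebra_simps)

lemma lin_sum: "lin M (sum f A) = (\<Sum>a\<in>A. lin M (f a))"
  by (induction A rule: infinite_finite_induct) (simp_all add: lin_add)

lemma smul_one [simp]: "smul 1 x = (x :: 'a \<Rightarrow>\<^sub>0 'b :: comm_ring_1)" by (rule poly_mapping_eqI) simp

lemma smul_smul: "smul a (smul b x) = smul (a * b) (x :: 'a \<Rightarrow>\<^sub>0 'b :: comm_ring_1)"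
  by (rule poly_mapping_eqI) (simp add: mult.assoc)

lemma smul_single: "smul c (Poly_Mapping.single i d) = Poly_Mapping.single i (c * d :: 'b :: comm_ring_1)"
  by (rule poly_mapping_eqI) (simp add: lookup_single when_def)

lemma lin_single: "lin M (Poly_Mapping.single i 1) = M i"
  by (rule poly_mapping_eqI) (simp add: lookup_lin)

lemma sum_singles: "x = (\<Sum>i\<in>Poly_Mapping.keys x. Poly_Mapping.single i (lkp x i))"
proof (rule poly_mapping_eqI)
  fix k
  show "lkp x k = lkp (\<Sum>i\<in>Poly_Mapping.keys x. Poly_Mapping.single i (lkp x i)) k"
    by (auto simp: lookup_sum lookup_single when_def in_keys_iff)
qed

lemma sum_smul_singles: "x = (\<Sum>i\<in>Poly_Mapping.keys x. smul (lkp x i) (Poly_Mapping.single i (1 :: 'r :: comm_ring_1)))"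
  by (subst sum_singles) (simp add: smul_single)

lemma linear_eq_lin:
  fixes T :: "('i \<Rightarrow>\<^sub>0 'r :: comm_ring_1) \<Rightarrow> ('j \<Rightarrow>\<^sub>0 'r)"
  assumes "\<And>x y. T (x + y) = T x + T y" "\<And>c x. T (smul c x) = smul c (T x)"
  shows "T x = lin (\<lambda>i. T (Poly_Mapping.single i 1)) x"
proof -
  have T0: "T 0 = 0" using assms(1)[of 0 0] by simp
  have Ts: "T (sum f A) = (\<Sum>a\<in>A. T (f a))" for f :: "'i \<Rightarrow> ('i \<Rightarrow>\<^sub>0 'r)" and A
    by (induction A rule: infinite_finite_induct) (simp_all add: T0 assms(1))
  show ?thesis by (subst (1) sum_smul_singles[of x]) (simp add: Ts assms(2) lin_def)
qed

lemma lin_lin: "lin M (lin M' x) = lin (\<lambda>i. lin M (M' i)) x"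
  unfolding lin_def[of M' x] lin_sum lin_smul by (simp add: lin_def)

lemma range_lin_combination:
  assumes "\<And>j. j \<in> Poly_Mapping.keys y \<Longrightarrow> Poly_Mapping.single j 1 \<in> range (lin M)"
  shows "y \<in> range (lin M)"
proof -
  have "\<forall>j\<in>Poly_Mapping.keys y. \<exists>u. Poly_Mapping.single j 1 = lin M u" using assms by blast
  from bchoice[OF this] obtain u where "\<forall>j\<in>Poly_Mapping.keys y. Poly_Mapping.single j 1 = lin M (u j)" ..
  then have u: "\<And>j. j \<in> Poly_Mapping.keys y \<Longrightarrow> Poly_Mapping.single j 1 = lin M (u j)" by blast
  have "y = (\<Sum>j\<in>Poly_Mapping.keys y. smul (lkp y j) (Poly_Mapping.single j 1))" by (rule sum_smul_singles)
  also have "\<dots> = (\<Sum>j\<in>Poly_Mapping.keys y. smul (lkp y j) (lin M (u j)))"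
    by (rule sum.cong[OF refl], rule arg_cong[OF u])
  also have "\<dots> = lin M (lin u y)" by (simp add: lin_def[of u y] lin_sum lin_smul)
  finally show ?thesis by blast
qed

lemma range_lin_all:
  assumes "\<And>j. Poly_Mapping.single j 1 \<in> range (lin M)"
  shows "surj (lin M)"
  using range_lin_combination[of _ M] assms by blast

lemma range_lin_diff: "a \<in> range (lin M) \<Longrightarrow> b \<in> range (lin M) \<Longrightarrow> a - b \<in> range (lin M)"
  using lin_diff[of M, symmetric] by auto

lemma inj_linI:
  assumes "\<And>x. lin M x = 0 \<Longrightarrow> x = 0" shows "inj (lin M)"
proof (rule injI)
  fix x y assume "lin M x = lin M y"
  then have "x - y = 0" by (intro assms) (simp add: lin_diff)
  then show "x = y" by simp
qed

text \<open>A unitriangular matrix, up to the bijection \<open>\<sigma>\<close> of the bases. The order is given by \<open>f\<close>. For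
injectivity, look at an index of maximal \<open>f\<close> in the finite support of an element of the kernel; for
surjectivity, use induction on \<open>f\<close>.\<close>

lemma lin_triangular_bij:
  fixes M :: "'i \<Rightarrow> ('j \<Rightarrow>\<^sub>0 'r :: comm_ring_1)" and f :: "'j \<Rightarrow> nat"
  assumes \<sigma>: "bij \<sigma>" and diag: "\<And>i. lkp (M i) (\<sigma> i) = 1"
    and tri: "\<And>i j. lkp (M i) j \<noteq> 0 \<Longrightarrow> j = \<sigma> i \<or> f j < f (\<sigma> i)"
  shows "bij (lin M)"
proof (rule bijI)
  show "inj (lin M)"
  proof (rule inj_linI, rule ccontr)
    fix x assume 0: "lin M x = 0" and "x \<noteq> 0"
    then have ne: "Poly_Mapping.keys x \<noteq> {}" by simp
    let ?F = "(\<lambda>i. f (\<sigma> i)) ` Poly_Mapping.keys x"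
    have "Max ?F \<in> ?F" using ne by (intro Max_in) auto
    then obtain i where i: "i \<in> Poly_Mapping.keys x" "f (\<sigma> i) = Max ?F" by auto
    have z: "lkp x i' * lkp (M i') (\<sigma> i) = 0" if "i' \<in> Poly_Mapping.keys x - {i}" for i'
    proof (rule ccontr)
      assume "lkp x i' * lkp (M i') (\<sigma> i) \<noteq> 0"
      then have "lkp (M i') (\<sigma> i) \<noteq> 0" by auto
      then have "\<sigma> i = \<sigma> i' \<or> f (\<sigma> i) < f (\<sigma> i')" by (rule tri)
      moreover have "f (\<sigma> i') \<le> Max ?F" using that by (intro Max_ge) auto
      moreover have "\<sigma> i \<noteq> \<sigma> i'" using that \<sigma> by (auto simp: bij_def inj_eq)
      ultimately show False using i by simp
    qed
    have "lkp (lin M x) (\<sigma> i) = (\<Sum>i'\<in>{i}. lkp x i' * lkp (M i') (\<sigma> i))"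
      unfolding lookup_lin by (rule sum.mono_neutral_right) (use i z in auto)
    then have "lkp x i = 0" using 0 diag by simp
    then show False using i by (simp add: in_keys_iff)
  qed
  show "surj (lin M)"
  proof (rule range_lin_all)
    fix j show "Poly_Mapping.single j 1 \<in> range (lin M)"
    proof (induction "f j" arbitrary: j rule: less_induct)
      case less
      obtain i where i: "j = \<sigma> i" using \<sigma> by (metis bij_pointE)
      define y where "y = M i - Poly_Mapping.single j 1"
      have "y \<in> range (lin M)"
      proof (rule range_lin_combination)
        fix j' assume "j' \<in> Poly_Mapping.keys y"
        then have *: "lkp (M i) j' \<noteq> lkp (Poly_Mapping.single j 1) j'" by (simp add: y_def in_keys_iff lookup_minus)
        then have ne: "j' \<noteq> j" using diag[of i] i by auto
        then have "lkp (M i) j' \<noteq> 0" using * by (simp add: lookup_single)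
        then have "f j' < f j" using tri[of i j'] ne i by auto
        then show "Poly_Mapping.single j' 1 \<in> range (lin M)" by (rule less)
      qed
      moreover have "M i \<in> range (lin M)" using lin_single[of M i] by (metis rangeI)
      ultimately have "M i - y \<in> range (lin M)" by (rule range_lin_diff[rotated])
      then show ?case by (simp add: y_def)
    qed
  qed
qed

lemma restrict_exists:
  fixes x :: "'i \<Rightarrow>\<^sub>0 'r :: zero"
  obtains y where "\<And>i. lkp y i = (if P i then lkp x i else 0)"
proof
  fix i
  have "finite {i. (if P i then lkp x i else 0) \<noteq> 0}"
    by (rule finite_subset[of _ "{i. lkp x i \<noteq> 0}"]) auto
  then show "lkp (Abs_poly_mapping (\<lambda>i. if P i then lkp x i else 0)) i = (if P i then lkp x i else 0)" by simp
qed

text \<open>\<open>T\<close> is the homogeneous top-degree part of \<open>M\<close>. A nonzero element of the kernel of \<open>M\<close> would have a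
top-degree part in the kernel of \<open>T\<close>. Conversely, a preimage under \<open>T\<close> of a basis element of degree \<open>D\<close> can
be taken to be homogeneous, and its image under \<open>M\<close> differs from the basis element by terms of lower
degree.\<close>

lemma lin_filtered_bij:
  fixes M T :: "'i \<Rightarrow> ('j \<Rightarrow>\<^sub>0 'r :: comm_ring_1)"
  assumes T: "bij (lin T)" and hom: "\<And>i j. lkp (T i) j \<noteq> 0 \<Longrightarrow> dj j = (di i :: nat)"
    and top: "\<And>i j. di i \<le> dj j \<Longrightarrow> lkp (M i) j = lkp (T i) j"
  shows "bij (lin M)"
proof (rule bijI)
  have part: "lkp (lin T y) j = (if dj j = D then lkp (lin T x) j else 0)"
    if "\<And>i. lkp y i = (if di i = D then lkp x i else 0)" for x y D j
  proof -
    have "Poly_Mapping.keys y \<subseteq> Poly_Mapping.keys x" using that by (auto simp: in_keys_iff split: if_splits)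
    then have "lkp (lin T y) j = (\<Sum>i\<in>Poly_Mapping.keys x. lkp y i * lkp (T i) j)"
      by (intro lookup_lin_superset) auto
    also have "\<dots> = (\<Sum>i\<in>Poly_Mapping.keys x. if dj j = D then lkp x i * lkp (T i) j else 0)"
    proof (rule sum.cong[OF refl])
      fix i show "lkp y i * lkp (T i) j = (if dj j = D then lkp x i * lkp (T i) j else 0)"
        using hom[of i j] by (cases "lkp (T i) j = 0") (auto simp: that)
    qed
    finally show ?thesis by (simp add: lookup_lin)
  qed
  show "inj (lin M)"
  proof (rule inj_linI, rule ccontr)
    fix x assume 0: "lin M x = 0" and "x \<noteq> 0"
    then have ne: "Poly_Mapping.keys x \<noteq> {}" by simp
    define D where "D = Max (di ` Poly_Mapping.keys x)"
    have "D \<in> di ` Poly_Mapping.keys x" unfolding D_def using ne by (intro Max_in) auto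
    then obtain i0 where i0: "i0 \<in> Poly_Mapping.keys x" "di i0 = D" by auto
    have le: "di i \<le> D" if "i \<in> Poly_Mapping.keys x" for i unfolding D_def using that by (intro Max_ge) auto
    obtain y where y: "\<And>i. lkp y i = (if di i = D then lkp x i else 0)"
      using restrict_exists[of "\<lambda>i. di i = D" x] by metis
    have "lin T y = 0"
    proof (rule poly_mapping_eqI)
      fix j
      have "lkp (lin T x) j = lkp (lin M x) j" if "dj j = D"
        unfolding lookup_lin using top le that by (intro sum.cong refl) simp
      then show "lkp (lin T y) j = lkp 0 j" using part[OF y, of j] 0 by simp
    qed
    then have "y = 0" using T by (metis bij_def injD lin_zero)
    then have "lkp x i0 = 0" using y[of i0] i0 by simp
    then show False using i0 by (simp add: in_keys_iff)
  qed
  show "surj (lin M)"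
  proof (rule range_lin_all)
    fix j show "Poly_Mapping.single j 1 \<in> range (lin M)"
    proof (induction "dj j" arbitrary: j rule: less_induct)
      case less
      obtain x where x: "lin T x = Poly_Mapping.single j 1" using T by (metis bij_pointE)
      obtain y where y: "\<And>i. lkp y i = (if di i = dj j then lkp x i else 0)"
        using restrict_exists[of "\<lambda>i. di i = dj j" x] by metis
      define z where "z = lin M y - Poly_Mapping.single j 1"
      have "z \<in> range (lin M)"
      proof (rule range_lin_combination)
        fix j' assume j': "j' \<in> Poly_Mapping.keys z"
        have "dj j' < dj j"
        proof (rule ccontr)
          assume ge: "\<not> dj j' < dj j"
          have "lkp (lin M y) j' = lkp (lin T y) j'"
            unfolding lookup_lin using ge y by (intro sum.cong refl) (auto simp: top in_keys_iff split: if_splits)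
          also have "\<dots> = lkp (Poly_Mapping.single j 1) j'" unfolding part[OF y] x by (simp add: lookup_single when_def)
          finally show False using j' by (simp add: z_def in_keys_iff lookup_minus)
        qed
        then show "Poly_Mapping.single j' 1 \<in> range (lin M)" by (rule less)
      qed
      then have "lin M y - z \<in> range (lin M)" by (intro range_lin_diff) auto
      then show ?case by (simp add: z_def)
    qed
  qed
qed

section \<open>Evaluation homomorphisms on polynomial rings\<close>

definition monomial_value :: "(nat \<Rightarrow> 's :: comm_monoid_mult) \<Rightarrow> (nat \<Rightarrow>\<^sub>0 nat) \<Rightarrow> 's" where
  "monomial_value v a = (\<Prod>k\<in>Poly_Mapping.keys a. v k ^ lkp a k)"

lemma monomial_value_superset:
  assumes "finite I" "Poly_Mapping.keys a \<subseteq> I" shows "monomial_value v a = (\<Prod>k\<in>I. v k ^ lkp a k)"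
  unfolding monomial_value_def by (rule prod.mono_neutral_left) (use assms in \<open>auto simp: in_keys_iff\<close>)

lemma monomial_value_add: "monomial_value v (a + b) = monomial_value v a * monomial_value v b"
proof -
  let ?I = "Poly_Mapping.keys a \<union> Poly_Mapping.keys b"
  have I: "finite ?I" "Poly_Mapping.keys a \<subseteq> ?I" "Poly_Mapping.keys b \<subseteq> ?I" "Poly_Mapping.keys (a + b) \<subseteq> ?I"
    using keys_add[of a b] by auto
  show ?thesis unfolding monomial_value_superset[OF I(1,2)] monomial_value_superset[OF I(1,3)] monomial_value_superset[OF I(1,4)]
    by (simp add: lookup_add power_add prod.distrib)
qed

lemma monomial_value_zero [simp]: "monomial_value v 0 = 1" by (simp add: monomial_value_def)

definition ring_hom_fun :: "('r :: comm_ring_1 \<Rightarrow> 's :: comm_ring_1) \<Rightarrow> bool" where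
  "ring_hom_fun h \<longleftrightarrow> h 1 = 1 \<and> (\<forall>x y. h (x + y) = h x + h y) \<and> (\<forall>x y. h (x * y) = h x * h y)"

lemma ring_hom_fun_simps:
  assumes "ring_hom_fun h"
  shows "h 1 = 1" "h (x + y) = h x + h y" "h (x * y) = h x * h y" "h 0 = 0"
    "h (sum f A) = (\<Sum>a\<in>A. h (f a))" "h (prod f A) = (\<Prod>a\<in>A. h (f a))" "h (x ^ n) = h x ^ n"
proof -
  show *: "h 1 = 1" "\<And>x y. h (x + y) = h x + h y" "\<And>x y. h (x * y) = h x * h y" using assms by (auto simp: ring_hom_fun_def)
  show 0: "h 0 = 0" using *(2)[of 0 0] by simp
  show "h (sum f A) = (\<Sum>a\<in>A. h (f a))" by (induction A rule: infinite_finite_induct) (simp_all add: 0 *)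
  show "h (prod f A) = (\<Prod>a\<in>A. h (f a))" by (induction A rule: infinite_finite_induct) (simp_all add: *)
  show "h (x ^ n) = h x ^ n" by (induction n) (simp_all add: *)
qed

definition peval :: "('r \<Rightarrow> 's) \<Rightarrow> (nat \<Rightarrow> 's) \<Rightarrow> ((nat \<Rightarrow>\<^sub>0 nat) \<Rightarrow>\<^sub>0 'r :: comm_ring_1) \<Rightarrow> 's :: comm_ring_1" where
  "peval \<phi> v f = (\<Sum>a\<in>Poly_Mapping.keys f. \<phi> (lkp f a) * monomial_value v a)"

lemma peval_add: "ring_hom_fun \<phi> \<Longrightarrow> peval \<phi> v (f + g) = peval \<phi> v f + peval \<phi> v g"
  unfolding peval_def by (rule setsum_keys_plus_distrib) (simp_all add: ring_hom_fun_simps distrib_right)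

lemma peval_single: "ring_hom_fun \<phi> \<Longrightarrow> peval \<phi> v (Poly_Mapping.single a c) = \<phi> c * monomial_value v a"
  by (simp add: peval_def ring_hom_fun_simps)

lemma peval_sum: "ring_hom_fun \<phi> \<Longrightarrow> peval \<phi> v (sum f A) = (\<Sum>a\<in>A. peval \<phi> v (f a))"
  by (induction A rule: infinite_finite_induct) (simp_all add: peval_add, simp_all add: peval_def)

lemma peval_ring_hom:
  assumes "ring_hom_fun \<phi>" shows "ring_hom_fun (peval \<phi> v)"
  unfolding ring_hom_fun_def
proof (intro conjI allI)
  have "peval \<phi> v (Poly_Mapping.single 0 1) = 1" unfolding peval_single[OF assms] by (simp add: ring_hom_fun_simps[OF assms])
  then show "peval \<phi> v 1 = 1" by simp
  show "peval \<phi> v (f + g) = peval \<phi> v f + peval \<phi> v g" for f g by (rule peval_add[OF assms])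
  fix f g :: "(nat \<Rightarrow>\<^sub>0 nat) \<Rightarrow>\<^sub>0 'a"
  have "f * g = (\<Sum>a\<in>Poly_Mapping.keys f. \<Sum>b\<in>Poly_Mapping.keys g. Poly_Mapping.single (a + b) (lkp f a * lkp g b))"
    by (subst (1) sum_singles[of f], subst (1) sum_singles[of g]) (simp add: sum_product mult_single)
  then have "peval \<phi> v (f * g) = (\<Sum>a\<in>Poly_Mapping.keys f. \<Sum>b\<in>Poly_Mapping.keys g. \<phi> (lkp f a * lkp g b) * monomial_value v (a + b))"
    by (simp add: peval_sum[OF assms] peval_single[OF assms])
  also have "\<dots> = (\<Sum>a\<in>Poly_Mapping.keys f. \<Sum>b\<in>Poly_Mapping.keys g. (\<phi> (lkp f a) * monomial_value v a) * (\<phi> (lkp g b) * monomial_value v b))"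
    by (intro sum.cong refl) (simp add: monomial_value_add ring_hom_fun_simps[OF assms] algebra_simps)
  finally show "peval \<phi> v (f * g) = peval \<phi> v f * peval \<phi> v g" by (simp add: peval_def sum_product)
qed

text \<open>A homomorphism on polynomials is determined by the constants and the variables.\<close>

lemma ring_hom_peval:
  assumes "ring_hom_fun h" shows "h (peval \<phi> v f) = peval (\<lambda>c. h (\<phi> c)) (\<lambda>k. h (v k)) f"
  by (simp add: peval_def monomial_value_def ring_hom_fun_simps[OF assms])

section \<open>The homomorphism from symmetric functions\<close>

text \<open>The image of \<open>e\<^sub>r\<close>, the formal sum of all permutations of rank \<open>r\<close>.\<close>

definition rank_sum :: "nat \<Rightarrow> fha" where "rank_sum r = Abs_fha (\<Sum>m\<in>{m. psize m = r}. fhK m)"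

text \<open>The structure map from scalars.\<close>

definition iota :: "intval_poly \<Rightarrow> fha" where "iota c = Abs_fha (smul c (fhK empty_partition))"

lemma Rep_rank_sum: "Rep_fha (rank_sum r) = (\<Sum>m\<in>{m. psize m = r}. fhK m)" by (simp add: rank_sum_def Abs_fha_inverse)
lemma Rep_iota: "Rep_fha (iota c) = smul c (fhK empty_partition)" by (simp add: iota_def Abs_fha_inverse)

lemma ev_rank_sum: "p permutes {1..n} \<Longrightarrow> ev n (Rep_fha (rank_sum r)) p = of_bool (perm_rank p = r)"
  unfolding Rep_rank_sum ev_sum ev_fhK class_sum_def
  by (simp add: finite_partitions_eq sum.delta' reduced_cycle_type_psize of_bool_def)

lemma Rep_iota_mult: "Rep_fha (iota c * x) = smul c (Rep_fha x)"
proof (rule ev_eqI)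
  fix n
  show "ev n (Rep_fha (iota c * x)) = ev n (smul c (Rep_fha x))"
  proof
    fix p
    have "ev n (Rep_fha (iota c * x)) p = group_ring_mult n (\<lambda>p. \<Sum>i\<in>{()}. ieval c (int n) * class_sum n empty_partition p) (ev n (Rep_fha x)) p"
      by (simp add: Rep_fha_simps ev_fh_mult Rep_iota ev_smul[abs_def] ev_fhK)
    also have "\<dots> = ieval c (int n) * group_ring_mult n (class_sum n empty_partition) (ev n (Rep_fha x)) p"
      unfolding group_ring_mult_sum_left by simp
    also have "group_ring_mult n (class_sum n empty_partition) (ev n (Rep_fha x)) = ev n (Rep_fha x)"
      by (rule group_ring_mult_one) (rule ev_outside)
    finally show "ev n (Rep_fha (iota c * x)) p = ev n (smul c (Rep_fha x)) p" by (simp add: ev_smul)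
  qed
qed

lemma smul_add_left: "smul (a + b) x = smul a x + smul b (x :: 'a \<Rightarrow>\<^sub>0 'b :: comm_ring_1)"
  by (rule poly_mapping_eqI) (simp add: lookup_add distrib_right)

lemma iota_hom: "ring_hom_fun iota"
  unfolding ring_hom_fun_def
proof (intro conjI allI)
  show "iota 1 = 1" by (simp add: Rep_fha_inject[symmetric] Rep_iota Rep_fha_simps)
  show "iota (x + y) = iota x + iota y" for x y by (simp add: Rep_fha_inject[symmetric] Rep_iota Rep_fha_simps smul_add_left)
  show "iota (x * y) = iota x * iota y" for x y
    unfolding Rep_fha_inject[symmetric] Rep_iota_mult unfolding Rep_iota by (simp add: smul_smul)
qed

definition Psi_hom :: "symfun \<Rightarrow> fha" where "Psi_hom = peval iota (\<lambda>k. rank_sum (k + 1))"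

lemma Psi_hom_hom: "ring_hom_fun Psi_hom" unfolding Psi_hom_def by (rule peval_ring_hom[OF iota_hom])

lemma smul_eq_mult: "smul c f = Poly_Mapping.single 0 c * (f :: symfun)"
  unfolding smul_def by (rule mult_map_scale_conv_mult)

lemma Psi_hom_smul: "Rep_fha (Psi_hom (smul c f)) = smul c (Rep_fha (Psi_hom f))"
proof -
  have "Psi_hom (Poly_Mapping.single 0 c) = iota c" unfolding Psi_hom_def peval_single[OF iota_hom] by simp
  then show ?thesis unfolding smul_eq_mult ring_hom_fun_simps(3)[OF Psi_hom_hom] Rep_iota_mult[symmetric] by simp
qed

lemma Psi_hom_esym: "r \<ge> 1 \<Longrightarrow> Psi_hom (esym r) = rank_sum r"
  unfolding esym_def Psi_hom_def by (simp add: peval_single[OF iota_hom] monomial_value_def ring_hom_fun_simps[OF iota_hom])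

section \<open>Monomials and partitions\<close>

definition mset_of_mono :: "(nat \<Rightarrow>\<^sub>0 nat) \<Rightarrow> nat multiset" where
  "mset_of_mono a = (\<Sum>k\<in>Poly_Mapping.keys a. replicate_mset (lkp a k) (Suc k))"

lemma count_mset_of_mono: "count (mset_of_mono a) j = (if j = 0 then 0 else lkp a (j - 1))"
proof -
  have "count (mset_of_mono a) j = (\<Sum>k\<in>Poly_Mapping.keys a. if j = Suc k then lkp a k else 0)"
    by (simp add: mset_of_mono_def count_sum)
  also have "\<dots> = (if j = 0 then 0 else \<Sum>k\<in>Poly_Mapping.keys a. if k = j - 1 then lkp a k else 0)"
    by (cases j) (auto intro!: sum.cong)
  finally show ?thesis by (auto simp: in_keys_iff)
qed

text \<open>The monomial \<open>e\<^sub>1\<^sup>a e\<^sub>2\<^sup>b \<dots>\<close> corresponds to the partition with \<open>a\<close> parts 1, \<open>b\<close> parts 2, and so on.\<close>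

definition part_of_mono :: "(nat \<Rightarrow>\<^sub>0 nat) \<Rightarrow> int_partition" where
  "part_of_mono a = Abs_int_partition (mset_of_mono a)"

lemma parts_part_of_mono: "parts (part_of_mono a) = mset_of_mono a"
  unfolding part_of_mono_def by (rule parts_Abs) (simp add: count_mset_of_mono not_in_iff)

lemma bij_part_of_mono: "bij part_of_mono"
proof (rule bijI)
  show "inj part_of_mono"
  proof (rule injI, rule poly_mapping_eqI)
    fix a b k assume "part_of_mono a = part_of_mono b"
    then have "count (mset_of_mono a) (Suc k) = count (mset_of_mono b) (Suc k)" by (metis parts_part_of_mono)
    then show "lkp a k = lkp b k" by (simp add: count_mset_of_mono)
  qed
  show "surj part_of_mono"
  proof (rule surjI)
    fix l :: int_partition
    let ?a = "Abs_poly_mapping (\<lambda>k. count (parts l) (Suc k))"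
    have "finite {k. count (parts l) (Suc k) \<noteq> 0}"
      by (rule finite_subset[of _ "(\<lambda>k. k - 1) ` set_mset (parts l)"]) (force simp: image_iff)+
    then have a: "lkp ?a = (\<lambda>k. count (parts l) (Suc k))" by (rule lookup_Abs_poly_mapping)
    have "mset_of_mono ?a = parts l"
      by (rule multiset_eqI) (use zero_notin_parts[of l] in \<open>auto simp: count_mset_of_mono a not_in_iff\<close>)
    then show "part_of_mono ?a = l" using parts_inject parts_part_of_mono by metis
  qed
qed

definition conj_part :: "int_partition \<Rightarrow> int_partition" where
  "conj_part l = Abs_int_partition (conjugate (row_lengths l))"

lemma parts_conj: "parts (conj_part l) = conjugate (row_lengths l)"
  unfolding conj_part_def by (rule parts_Abs[OF zero_notin_conjugate])

lemma mset_row_lengths: "mset (row_lengths l) = parts l" by (simp add: row_lengths_def)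

lemma descending_row_lengths: "descending (row_lengths l)"
proof -
  have "sorted_wrt (\<ge>) (row_lengths l)" unfolding row_lengths_def sorted_wrt_rev by simp
  moreover have "0 \<notin> set (row_lengths l)" using zero_notin_parts[of l] by (simp add: row_lengths_def)
  ultimately show ?thesis by (simp add: descending_def)
qed

lemma sum_row_lengths: "sum_list (row_lengths l) = psize l"
  by (metis mset_row_lengths psize_def sum_mset_sum_list)

lemma psize_conj: "psize (conj_part l) = psize l"
  by (simp add: psize_def[of "conj_part l"] parts_conj sum_conjugate[OF descending_row_lengths] sum_row_lengths)

lemma row_lengths_unique: "descending rs \<Longrightarrow> mset rs = parts l \<Longrightarrow> row_lengths l = rs"
proof -
  assume d: "descending rs" and m: "mset rs = parts l"
  have "sorted (rev rs)" using d by (simp add: descending_def sorted_wrt_rev)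
  moreover have "sorted (rev (row_lengths l))" using descending_row_lengths[of l] by (simp add: descending_def sorted_wrt_rev)
  ultimately have "rev (row_lengths l) = rev rs" using m mset_row_lengths[of l] by (metis mset_rev properties_for_sort)
  then show ?thesis by simp
qed

lemma bij_conj_part: "bij conj_part"
proof (rule bijI)
  show "inj conj_part"
  proof (rule injI)
    fix l m assume "conj_part l = conj_part m"
    then have "conjugate (row_lengths l) = conjugate (row_lengths m)" by (metis parts_conj)
    then have "row_lengths l = row_lengths m" by (rule conjugate_inj[OF descending_row_lengths descending_row_lengths])
    then show "l = m" by (metis mset_row_lengths parts_inject)
  qed
  show "surj conj_part"
  proof -
    have "\<exists>l. m = conj_part l" for m
    proof -
      obtain rs where rs: "descending rs" "conjugate rs = parts m" using conjugate_surj[OF zero_notin_parts] by blast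
      have "parts (Abs_int_partition (mset rs)) = mset rs" using rs(1) by (intro parts_Abs) (simp add: descending_def)
      then have "row_lengths (Abs_int_partition (mset rs)) = rs" using rs(1) by (intro row_lengths_unique) simp_all
      then have "conj_part (Abs_int_partition (mset rs)) = m" using rs(2) parts_inject parts_conj by metis
      then show ?thesis by metis
    qed
    then show ?thesis by (simp add: surj_def)
  qed
qed

section \<open>Products of the generators in terms of class sums\<close>

text \<open>In \<open>S\<^sub>n\<close> a product of the generators is an iterated convolution with sums of permutations of fixed
rank.\<close>

lemma ev_prod_rank_sum:
  assumes "p permutes {1..n}"
  shows "ev n (Rep_fha (prod_list (map rank_sum rs))) p = foldr (rank_op n) rs delta p"
  using assms
proof (induction rs arbitrary: p)
  case Nil
  then show ?case by (simp add: Rep_fha_simps ev_fhK class_sum_empty delta_def)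
next
  case (Cons r rs)
  have "ev n (Rep_fha (prod_list (map rank_sum (r # rs)))) p =
    (\<Sum>q\<in>Sym n. ev n (Rep_fha (rank_sum r)) q * ev n (Rep_fha (prod_list (map rank_sum rs))) (inv q \<circ> p))"
    by (simp add: Rep_fha_simps ev_fh_mult group_ring_mult_eq[OF Cons.prems])
  also have "\<dots> = (\<Sum>q\<in>Sym n. of_bool (perm_rank q = r) * foldr (rank_op n) rs delta (inv q \<circ> p))"
  proof (rule sum.cong[OF refl])
    fix q assume "q \<in> Sym n"
    then have q: "q permutes {1..n}" by simp
    have "inv q \<circ> p permutes {1..n}" using q Cons.prems by (intro permutes_compose permutes_inv)
    then show "ev n (Rep_fha (rank_sum r)) q * ev n (Rep_fha (prod_list (map rank_sum rs))) (inv q \<circ> p) =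
      of_bool (perm_rank q = r) * foldr (rank_op n) rs delta (inv q \<circ> p)" using ev_rank_sum[OF q] Cons.IH by metis
  qed
  finally show ?case unfolding foldr_Cons o_apply rank_op_def[of n r "foldr (rank_op n) rs delta"] .
qed

lemma prod_list_rank_sum_mono: "prod_list (map rank_sum (row_lengths (part_of_mono a))) = monomial_value (\<lambda>k. rank_sum (k + 1)) a"
proof -
  have "prod_list (map rank_sum (row_lengths (part_of_mono a))) = prod_mset (image_mset rank_sum (mset_of_mono a))"
    by (metis mset_map mset_row_lengths parts_part_of_mono prod_mset_prod_list)
  also have "\<dots> = (\<Prod>k\<in>Poly_Mapping.keys a. rank_sum (Suc k) ^ lkp a k)"
  proof -
    have "prod_mset (image_mset rank_sum (\<Sum>k\<in>K. replicate_mset (lkp a k) (Suc k))) = (\<Prod>k\<in>K. rank_sum (Suc k) ^ lkp a k)" if "finite K" for K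
      using that by (induction K) auto
    then show ?thesis by (simp add: mset_of_mono_def)
  qed
  finally show ?thesis by (simp add: monomial_value_def)
qed

definition Psi_mono :: "(nat \<Rightarrow>\<^sub>0 nat) \<Rightarrow> fh" where
  "Psi_mono a = Rep_fha (Psi_hom (Poly_Mapping.single a 1))"

lemma Psi_mono_eq: "Psi_mono a = Rep_fha (prod_list (map rank_sum (row_lengths (part_of_mono a))))"
  unfolding Psi_mono_def Psi_hom_def peval_single[OF iota_hom] prod_list_rank_sum_mono by (simp add: ring_hom_fun_simps[OF iota_hom])

definition mono_deg :: "(nat \<Rightarrow>\<^sub>0 nat) \<Rightarrow> nat" where "mono_deg a = psize (part_of_mono a)"

lemma ieval_Psi_mono:
  assumes "support_size l \<le> n"
  shows "ieval (lkp (Psi_mono a) l) (int n) =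
    (\<Sum>\<beta>\<in>exponents n (mono_deg a). elem_coeff (row_lengths (part_of_mono a)) \<beta> * JM_prod n \<beta> delta (repr l))"
proof -
  have r: "repr l permutes {1..n}" "reduced_cycle_type n (repr l) = l" using repr_type assms by (auto simp: support_size_def)
  have "ieval (lkp (Psi_mono a) l) (int n) = ev n (Psi_mono a) (repr l)" using r by (simp add: ev_def)
  also have "\<dots> = foldr (rank_op n) (row_lengths (part_of_mono a)) delta (repr l)"
    unfolding Psi_mono_eq by (rule ev_prod_rank_sum[OF r(1)])
  finally show ?thesis by (simp add: foldr_rank_op sum_row_lengths mono_deg_def)
qed

lemma JM_prod_extend:
  assumes "\<beta> \<in> exponents N d" "N \<le> N'" shows "JM_prod N' \<beta> f = JM_prod N \<beta> f"
proof -
  have "JM_prod (N + k) \<beta> f = JM_prod N \<beta> f" for k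
    by (induction k) (use assms(1) in \<open>simp_all add: exponents_def\<close>)
  from this[of "N' - N"] show ?thesis using assms(2) by simp
qed

text \<open>The coefficient of the monomial symmetric function of \<open>k\<close> in the product of elementary symmetric
functions for \<open>a\<close>.\<close>

definition elem_mono_coeff :: "(nat \<Rightarrow>\<^sub>0 nat) \<Rightarrow> int_partition \<Rightarrow> int" where
  "elem_mono_coeff a k = elem_coeff (row_lengths (part_of_mono a)) (mset_expo (parts k))"

text \<open>The coefficient of the representative of \<open>l\<close> in the monomial symmetric function of \<open>k\<close> in the
Jucys--Murphy elements.\<close>

definition mono_class_coeff :: "int_partition \<Rightarrow> int_partition \<Rightarrow> int" where
  "mono_class_coeff k l = (\<Sum>\<beta>\<in>{\<beta>\<in>exponents (support_size l) (psize l). exponent_type (support_size l) \<beta> = parts k}. JM_prod (support_size l) \<beta> delta (repr l))"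

lemma mset_expo_parts: "exponent_type (plen l) (mset_expo (parts l)) = parts l" "mset_expo (parts l) \<in> exponents (plen l) (psize l)"
  using mset_expo[OF zero_notin_parts] by (simp_all add: plen_def psize_def)

lemma exponents_outside: "\<beta> \<in> exponents N d \<Longrightarrow> i > N \<Longrightarrow> \<beta> i = 0" by (simp add: exponents_def)

text \<open>In top degree, the factorizations that are counted are minimal. They involve moved points of the
product only, so their number does not change with \<open>n\<close>, and the coefficient polynomial is constant.\<close>

lemma Psi_mono_top:
  assumes "psize l = mono_deg a"
  shows "lkp (Psi_mono a) l = of_int (\<Sum>k\<in>{k. psize k = mono_deg a}. elem_mono_coeff a k * mono_class_coeff k l)"
proof (rule intval_poly_eqI)
  fix n assume n: "n \<ge> support_size l"
  let ?d = "mono_deg a" and ?N = "support_size l" and ?rs = "row_lengths (part_of_mono a)"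
  let ?t = "\<lambda>\<beta>. Abs_int_partition (exponent_type ?N \<beta>)"
  have N: "?N = psize l + plen l" by (simp add: support_size_def)
  have sub: "exponents ?N ?d \<subseteq> exponents n ?d" using exponent_type_mono(2) n by blast
  have pt: "parts (?t \<beta>) = exponent_type ?N \<beta>" for \<beta>
    by (rule parts_Abs) (simp add: exponent_type_def)
  (* exponents at points that repr l fixes do not contribute, so n can be replaced by the size of the support *)
  have z: "JM_prod n \<beta> delta (repr l) = 0" if b: "\<beta> \<in> exponents n ?d - exponents ?N ?d" for \<beta>
  proof (rule ccontr)
    assume nz: "JM_prod n \<beta> delta (repr l) \<noteq> 0"
    have bn: "\<beta> \<in> exponents n ?d" using b by simp
    have "{i. \<beta> i > 0} \<subseteq> supp (repr l)" using JM_prod_minimal[OF bn nz] assms perm_rank_repr by simp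
    then have s: "{i. \<beta> i > 0} \<subseteq> {1..?N}" by (simp add: supp_repr N)
    then have z: "\<beta> i = 0" if "i \<notin> {1..?N}" for i
    proof -
      have "i \<notin> {i. \<beta> i > 0}" using subsetD[OF s, of i] that by (rule contrapos_nn[rotated])
      then show ?thesis by simp
    qed
    have "sum \<beta> {1..n} = sum \<beta> {1..?N}" by (rule sum.mono_neutral_right) (use n z in auto)
    then have "\<beta> \<in> exponents ?N ?d" using bn z by (auto simp: exponents_def)
    then show False using b by simp
  qed
  have "ieval (lkp (Psi_mono a) l) (int n) = (\<Sum>\<beta>\<in>exponents ?N ?d. elem_coeff ?rs \<beta> * JM_prod n \<beta> delta (repr l))"
    unfolding ieval_Psi_mono[OF n] by (rule sum.mono_neutral_right) (use sub z finite_exponents in auto)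
  also have "\<dots> = (\<Sum>\<beta>\<in>exponents ?N ?d. elem_coeff ?rs \<beta> * JM_prod ?N \<beta> delta (repr l))"
    using JM_prod_extend n by (intro sum.cong refl) metis
  also have "\<dots> = (\<Sum>k\<in>{k. psize k = ?d}. \<Sum>\<beta>\<in>{\<beta>\<in>exponents ?N ?d. ?t \<beta> = k}. elem_coeff ?rs \<beta> * JM_prod ?N \<beta> delta (repr l))"
  proof (rule sum.group[symmetric])
    show "?t ` exponents ?N ?d \<subseteq> {k. psize k = ?d}"
      by (auto simp: psize_def pt sum_mset_exponent_type exponents_def)
  qed (simp_all add: finite_exponents finite_partitions_eq)
  also have "\<dots> = (\<Sum>k\<in>{k. psize k = ?d}. elem_mono_coeff a k * mono_class_coeff k l)"
  proof (rule sum.cong[OF refl])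
    fix k assume "k \<in> {k. psize k = ?d}"
    have e: "{\<beta>\<in>exponents ?N ?d. ?t \<beta> = k} = {\<beta>\<in>exponents ?N (psize l). exponent_type ?N \<beta> = parts k}"
      using pt parts_inject assms by metis
    have "elem_coeff ?rs \<beta> = elem_mono_coeff a k" if "\<beta> \<in> {\<beta>\<in>exponents ?N (psize l). exponent_type ?N \<beta> = parts k}" for \<beta>
      unfolding elem_mono_coeff_def using that mset_expo_parts[of k] by (intro elem_coeff_exponent_type) auto
    then show "(\<Sum>\<beta>\<in>{\<beta>\<in>exponents ?N ?d. ?t \<beta> = k}. elem_coeff ?rs \<beta> * JM_prod ?N \<beta> delta (repr l)) = elem_mono_coeff a k * mono_class_coeff k l"
      unfolding e mono_class_coeff_def sum_distrib_left by (intro sum.cong refl) simp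
  qed
  finally show "ieval (lkp (Psi_mono a) l) (int n) = ieval (of_int (\<Sum>k\<in>{k. psize k = mono_deg a}. elem_mono_coeff a k * mono_class_coeff k l)) (int n)"
    by simp
qed

text \<open>The rank is subadditive.\<close>

lemma Psi_mono_above:
  assumes "psize l > mono_deg a"
  shows "lkp (Psi_mono a) l = 0"
proof (rule intval_poly_eqI)
  fix n assume n: "n \<ge> support_size l"
  have "JM_prod n \<beta> delta (repr l) = 0" if b: "\<beta> \<in> exponents n (mono_deg a)" for \<beta>
    using JM_prod_nonzero_permutes[OF b, of n "repr l"] exponents_outside[OF b] assms perm_rank_repr[of l] by auto
  then show "ieval (lkp (Psi_mono a) l) (int n) = ieval 0 (int n)" unfolding ieval_Psi_mono[OF n] by simp
qed

section \<open>Bijectivity and uniqueness of Psi\<close>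

lemma elem_mono_coeff_lead: "elem_mono_coeff a (conj_part (part_of_mono a)) = 1"
proof -
  let ?l = "conj_part (part_of_mono a)" and ?rs = "row_lengths (part_of_mono a)"
  show ?thesis unfolding elem_mono_coeff_def
  proof (rule elem_coeff_leading[OF descending_row_lengths])
    show "mset_expo (parts ?l) \<in> exponents (plen ?l) (sum_list ?rs)"
      using mset_expo_parts(2)[of ?l] by (simp add: sum_row_lengths psize_conj)
    show "exponent_type (plen ?l) (mset_expo (parts ?l)) = conjugate ?rs" using mset_expo_parts(1)[of ?l] by (simp only: parts_conj)
  qed
qed

lemma elem_mono_coeff_tri:
  assumes "elem_mono_coeff a k \<noteq> 0" "psize k = mono_deg a" "k \<noteq> conj_part (part_of_mono a)"
  shows "sum_sq (parts k) < sum_sq (parts (conj_part (part_of_mono a)))"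
proof -
  let ?rs = "row_lengths (part_of_mono a)"
  have e: "mset_expo (parts k) \<in> exponents (plen k) (sum_list ?rs)"
    using mset_expo_parts(2)[of k] assms(2) by (simp add: sum_row_lengths mono_deg_def)
  have "sum_sq (parts k) \<le> sum_sq (conjugate ?rs) \<and> (sum_sq (parts k) = sum_sq (conjugate ?rs) \<longrightarrow> parts k = conjugate ?rs)"
    using elem_coeff_nonzero[OF descending_row_lengths e] assms(1) unfolding elem_mono_coeff_def mset_expo_parts(1) by blast
  moreover have "parts k \<noteq> conjugate ?rs" using assms(3) by (metis parts_conj parts_inject)
  ultimately show ?thesis by (auto simp: parts_conj)
qed

lemma mono_class_coeff_nonzero:
  assumes "mono_class_coeff k l \<noteq> 0" shows "k = l \<or> plen l < plen k"
proof -
  have N: "support_size l = psize l + plen l" by (simp add: support_size_def)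
  obtain \<beta> where b: "\<beta> \<in> exponents (support_size l) (psize l)" "exponent_type (support_size l) \<beta> = parts k" "JM_prod (support_size l) \<beta> delta (repr l) \<noteq> 0"
    using assms unfolding mono_class_coeff_def by (auto elim!: sum.not_neutral_contains_not_neutral)
  have c: "card (cycle_set (repr l)) = plen l" by (simp add: size_reduced_type[symmetric] repr plen_def)
  have d: "card {i. \<beta> i > 0} = plen k" using size_exponent_type[OF b(1)] b(2) by (simp add: plen_def)
  have min: "plen l \<le> plen k" "plen l = plen k \<longrightarrow> \<beta> = max_exponent (repr l)"
    using JM_prod_minimal[OF b(1,3) perm_rank_repr] c d by auto
  have "k = l" if "plen l = plen k"
    using min that b(2) exponent_type_max_exponent(1)[of "repr l" "support_size l"] repr N parts_inject by metis
  then show ?thesis using min by linarith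
qed

lemma mono_class_coeff_diag: "mono_class_coeff l l = 1"
proof -
  let ?N = "support_size l"
  have N: "?N = psize l + plen l" by (simp add: support_size_def)
  have r: "repr l permutes {1..?N}" unfolding N by (rule repr)
  have c: "card (cycle_set (repr l)) = plen l" by (simp add: size_reduced_type[symmetric] repr plen_def)
  have m: "max_exponent (repr l) \<in> {\<beta>\<in>exponents ?N (psize l). exponent_type ?N \<beta> = parts l}"
    using exponent_type_max_exponent[OF r] by (simp add: perm_rank_repr repr)
  have "mono_class_coeff l l = (\<Sum>\<beta>\<in>{max_exponent (repr l)}. JM_prod ?N \<beta> delta (repr l))"
    unfolding mono_class_coeff_def
  proof (rule sum.mono_neutral_right)
    show "finite {\<beta>\<in>exponents ?N (psize l). exponent_type ?N \<beta> = parts l}" using finite_exponents by simp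
    show "{max_exponent (repr l)} \<subseteq> {\<beta>\<in>exponents ?N (psize l). exponent_type ?N \<beta> = parts l}" using m by blast
    show "\<forall>\<beta>\<in>{\<beta>\<in>exponents ?N (psize l). exponent_type ?N \<beta> = parts l} - {max_exponent (repr l)}. JM_prod ?N \<beta> delta (repr l) = 0"
    proof (rule ballI, rule ccontr)
      fix \<beta> assume b: "\<beta> \<in> {\<beta>\<in>exponents ?N (psize l). exponent_type ?N \<beta> = parts l} - {max_exponent (repr l)}"
        and nz: "JM_prod ?N \<beta> delta (repr l) \<noteq> 0"
      have be: "\<beta> \<in> exponents ?N (psize l)" using b by blast
      have "card {i. \<beta> i > 0} = plen l" using size_exponent_type[OF be] b by (simp add: plen_def)
      then have "\<beta> = max_exponent (repr l)" using JM_prod_minimal[OF be nz perm_rank_repr] c by auto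
      then show False using b by blast
    qed
  qed
  also have "\<dots> = 1" using JM_prod_max_exponent[OF r perm_rank_repr] by simp
  finally show ?thesis .
qed

definition elem_to_mono :: "(nat \<Rightarrow>\<^sub>0 nat) \<Rightarrow> (int_partition \<Rightarrow>\<^sub>0 intval_poly)" where
  "elem_to_mono a = (\<Sum>k\<in>{k. psize k = mono_deg a}. Poly_Mapping.single k (of_int (elem_mono_coeff a k)))"

definition mono_to_class :: "int_partition \<Rightarrow> (int_partition \<Rightarrow>\<^sub>0 intval_poly)" where
  "mono_to_class k = (\<Sum>l\<in>{l. psize l = psize k}. Poly_Mapping.single l (of_int (mono_class_coeff k l)))"

lemma lookup_elem_to_mono: "lkp (elem_to_mono a) k = (if psize k = mono_deg a then of_int (elem_mono_coeff a k) else 0)"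
  by (auto simp: elem_to_mono_def lookup_sum lookup_single when_def finite_partitions_eq sum.delta)

lemma lookup_mono_to_class: "lkp (mono_to_class k) l = (if psize l = psize k then of_int (mono_class_coeff k l) else 0)"
  by (auto simp: mono_to_class_def lookup_sum lookup_single when_def finite_partitions_eq sum.delta)

lemma bij_elem_to_mono: "bij (lin elem_to_mono)"
proof (rule lin_triangular_bij[where \<sigma> = "conj_part \<circ> part_of_mono" and f = "\<lambda>k. sum_sq (parts k)"])
  show "bij (conj_part \<circ> part_of_mono)" by (rule bij_comp[OF bij_part_of_mono bij_conj_part])
  show "lkp (elem_to_mono a) ((conj_part \<circ> part_of_mono) a) = 1" for a
    by (simp add: lookup_elem_to_mono psize_conj mono_deg_def elem_mono_coeff_lead)
  show "k = (conj_part \<circ> part_of_mono) a \<or> sum_sq (parts k) < sum_sq (parts ((conj_part \<circ> part_of_mono) a))"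
    if "lkp (elem_to_mono a) k \<noteq> 0" for a k
  proof -
    have "elem_mono_coeff a k \<noteq> 0" "psize k = mono_deg a" using that by (auto simp: lookup_elem_to_mono split: if_splits)
    then show ?thesis using elem_mono_coeff_tri[of a k] by auto
  qed
qed

lemma bij_mono_to_class: "bij (lin mono_to_class)"
proof (rule lin_triangular_bij[where \<sigma> = id and f = plen])
  show "lkp (mono_to_class k) (id k) = 1" for k by (simp add: lookup_mono_to_class mono_class_coeff_diag)
  show "l = id k \<or> plen l < plen (id k)" if "lkp (mono_to_class k) l \<noteq> 0" for k l
  proof -
    have "mono_class_coeff k l \<noteq> 0" using that by (auto simp: lookup_mono_to_class split: if_splits)
    then show ?thesis using mono_class_coeff_nonzero[of k l] by auto
  qed
qed simp

lemma bij_Psi_mono: "bij (lin Psi_mono)"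
proof (rule lin_filtered_bij[where T = "\<lambda>a. lin mono_to_class (elem_to_mono a)" and di = mono_deg and dj = psize])
  have top: "lkp (lin mono_to_class (elem_to_mono a)) l = (if psize l = mono_deg a then of_int (\<Sum>k\<in>{k. psize k = mono_deg a}. elem_mono_coeff a k * mono_class_coeff k l) else 0)" for a l
  proof -
    have "lkp (lin mono_to_class (elem_to_mono a)) l = (\<Sum>k\<in>{k. psize k = mono_deg a}. lkp (elem_to_mono a) k * lkp (mono_to_class k) l)"
      by (rule lookup_lin_superset) (auto simp: finite_partitions_eq in_keys_iff lookup_elem_to_mono split: if_splits)
    also have "\<dots> = (\<Sum>k\<in>{k. psize k = mono_deg a}. if psize l = mono_deg a then of_int (elem_mono_coeff a k * mono_class_coeff k l) else 0)"
      by (intro sum.cong refl) (auto simp: lookup_elem_to_mono lookup_mono_to_class)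
    finally show ?thesis by simp
  qed
  have "lin (\<lambda>a. lin mono_to_class (elem_to_mono a)) = lin mono_to_class \<circ> lin elem_to_mono" by (auto simp: fun_eq_iff lin_lin)
  then show "bij (lin (\<lambda>a. lin mono_to_class (elem_to_mono a)))" using bij_comp[OF bij_elem_to_mono bij_mono_to_class] by simp
  show "psize l = mono_deg a" if "lkp (lin mono_to_class (elem_to_mono a)) l \<noteq> 0" for a l using that by (simp add: top split: if_splits)
  show "lkp (Psi_mono a) l = lkp (lin mono_to_class (elem_to_mono a)) l" if "mono_deg a \<le> psize l" for a l
    using that Psi_mono_top[of l a] Psi_mono_above[of a l] by (auto simp: top)
qed

definition Psi_map :: "symfun \<Rightarrow> fh" where "Psi_map f = Rep_fha (Psi_hom f)"

lemma Psi_map_lin: "Psi_map = lin Psi_mono"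
proof
  fix f
  have "Psi_map f = lin (\<lambda>a. Psi_map (Poly_Mapping.single a 1)) f"
    by (rule linear_eq_lin) (simp_all add: Psi_map_def Psi_hom_smul ring_hom_fun_simps[OF Psi_hom_hom] Rep_fha_simps)
  then show "Psi_map f = lin Psi_mono f" by (simp add: Psi_map_def Psi_mono_def[abs_def])
qed

lemma is_Psi_Psi_map: "is_Psi Psi_map"
  unfolding is_Psi_def
proof (intro conjI allI impI)
  show "bij Psi_map" unfolding Psi_map_lin by (rule bij_Psi_mono)
  show "Psi_map (f + g) = Psi_map f + Psi_map g" for f g by (simp add: Psi_map_def ring_hom_fun_simps[OF Psi_hom_hom] Rep_fha_simps)
  show "Psi_map (smul c f) = smul c (Psi_map f)" for c f by (simp add: Psi_map_def Psi_hom_smul)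
  show "Psi_map (f * g) = fh_mult (Psi_map f) (Psi_map g)" for f g by (simp add: Psi_map_def ring_hom_fun_simps[OF Psi_hom_hom] Rep_fha_simps)
  show "Psi_map 1 = fhK empty_partition" by (simp add: Psi_map_def ring_hom_fun_simps[OF Psi_hom_hom] Rep_fha_simps)
  show "Psi_map (esym r) = (\<Sum>m \<in> {m. psize m = r}. fhK m)" if "r \<ge> 1" for r
    using that by (simp add: Psi_map_def Psi_hom_esym Rep_rank_sum)
qed

text \<open>Every monomial is a product of the \<open>e\<^sub>r\<close>, so the conditions on \<open>Psi\<close> determine it.\<close>

lemma single_eq_monomial_value: "Poly_Mapping.single a (1 :: intval_poly) = monomial_value (\<lambda>k. esym (Suc k)) a"
proof -
  have p: "Poly_Mapping.single (Poly_Mapping.single k 1) (1 :: intval_poly) ^ n = Poly_Mapping.single (Poly_Mapping.single k n) 1" for k n :: nat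
    by (induction n) (simp_all add: mult_single single_add[symmetric])
  have "(\<Prod>k\<in>K. Poly_Mapping.single (Poly_Mapping.single k (lkp a k)) (1 :: intval_poly)) =
    Poly_Mapping.single (\<Sum>k\<in>K. Poly_Mapping.single k (lkp a k)) 1" for K
    by (induction K rule: infinite_finite_induct) (simp_all add: mult_single)
  then show ?thesis unfolding monomial_value_def esym_def by (simp add: p sum_singles[of a, symmetric] del: One_nat_def)
qed

lemma is_Psi_unique:
  assumes "is_Psi P" shows "P = Psi_map"
proof
  fix f
  have P: "\<And>f g. P (f + g) = P f + P g" "\<And>c f. P (smul c f) = smul c (P f)" "\<And>f g. P (f * g) = fh_mult (P f) (P g)"
    "P 1 = fhK empty_partition" "\<And>r. r \<ge> 1 \<Longrightarrow> P (esym r) = (\<Sum>m \<in> {m. psize m = r}. fhK m)"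
    using assms by (auto simp: is_Psi_def)
  define h where "h f = Abs_fha (P f)" for f
  have h: "ring_hom_fun h" unfolding ring_hom_fun_def h_def
    by (simp add: P Rep_fha_inject[symmetric] Rep_fha_simps Abs_fha_inverse)
  have hs: "h (esym (Suc k)) = Psi_hom (esym (Suc k))" for k
    using Psi_hom_esym[of "Suc k"] by (simp add: h_def P rank_sum_def)
  have "h (Poly_Mapping.single a 1) = Psi_hom (Poly_Mapping.single a 1)" for a
    unfolding single_eq_monomial_value monomial_value_def by (simp add: ring_hom_fun_simps[OF h] ring_hom_fun_simps[OF Psi_hom_hom] hs)
  then have "P (Poly_Mapping.single a 1) = Psi_mono a" for a
    unfolding h_def Psi_mono_def by (metis Abs_fha_inverse UNIV_I)
  moreover have "P f = lin (\<lambda>a. P (Poly_Mapping.single a 1)) f" by (rule linear_eq_lin) (simp_all add: P)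
  ultimately show "P f = Psi_map f" by (simp add: Psi_map_lin)
qed

lemma Psi_eq: "Psi = Psi_map"
  unfolding Psi_def using is_Psi_Psi_map is_Psi_unique by (rule the_equality)

lemma Psi_map_character: "Psi_map (character_symfun m) = fhK m"
  unfolding character_symfun_def Psi_eq using is_Psi_Psi_map by (simp add: is_Psi_def bij_is_surj surj_f_inv_f)

section \<open>Action on tabloids\<close>

type_synonym tvec = "tabloid \<Rightarrow>\<^sub>0 complex"

text \<open>The action permutes the basis of tabloids and is linear.\<close>

lemma perm_act_lin: "perm_act p = lin (\<lambda>X. Poly_Mapping.single (\<lambda>i. p ` X i) 1)"
  by (auto simp: fun_eq_iff perm_act_def lin_def smul_single)

lemma perm_act_single: "perm_act p (Poly_Mapping.single X c) = Poly_Mapping.single (\<lambda>i. p ` X i) c"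
  by (cases "c = 0") (simp_all add: perm_act_def)

lemma perm_act_comp: "perm_act p (perm_act q v) = perm_act (p \<circ> q) v"
  unfolding perm_act_lin lin_lin lin_single by (simp add: image_image)

lemma perm_act_id: "perm_act id v = v"
  unfolding perm_act_def by (simp add: sum_singles[symmetric])

lemma perm_act_sum: "perm_act p (sum f A) = (\<Sum>a\<in>A. perm_act p (f a))" unfolding perm_act_lin by (rule lin_sum)
lemma perm_act_smul: "perm_act p (smul c v) = smul c (perm_act p v)" unfolding perm_act_lin by (rule lin_smul)
lemma perm_act_add: "perm_act p (v + w) = perm_act p v + perm_act p w" unfolding perm_act_lin by (rule lin_add)

lemma smul_add_right: "smul a (x + y) = smul a x + smul a (y :: 'a \<Rightarrow>\<^sub>0 'b :: comm_ring_1)"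
  by (rule poly_mapping_eqI) (simp add: lookup_add distrib_left)

lemma smul_sum: "smul a (sum f A) = (\<Sum>i\<in>A. smul a (f i :: 'a \<Rightarrow>\<^sub>0 'b :: comm_ring_1))"
  by (rule poly_mapping_eqI) (simp add: lookup_sum sum_distrib_left)

lemma sum_smul_left: "smul (sum f A) x = (\<Sum>i\<in>A. smul (f i) (x :: 'a \<Rightarrow>\<^sub>0 'b :: comm_ring_1))"
  by (rule poly_mapping_eqI) (simp add: lookup_sum sum_distrib_right)

lemma smul_zero_left: "smul 0 x = (0 :: 'a \<Rightarrow>\<^sub>0 'b :: comm_ring_1)"
  by (rule poly_mapping_eqI) simp

lemma group_ring_act_smul: "group_ring_act n a (smul c v) = smul c (group_ring_act n a v)"
  by (simp add: group_ring_act_def perm_act_smul smul_sum smul_smul mult.commute)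

lemma group_ring_act_add: "group_ring_act n a (v + w) = group_ring_act n a v + group_ring_act n a w"
  by (simp add: group_ring_act_def perm_act_add smul_add_right sum.distrib)

lemma group_ring_act_zero: "group_ring_act n a 0 = 0"
  using group_ring_act_smul[of n a 0 0] by (simp add: smul_zero_left)

lemma group_ring_act_mult:
  "group_ring_act n (group_ring_mult n a b) v = group_ring_act n a (group_ring_act n b v)"
proof -
  have "group_ring_act n (group_ring_mult n a b) v =
    (\<Sum>s\<in>Sym n. \<Sum>q\<in>Sym n. smul (of_int (a q * b (inv q \<circ> s))) (perm_act s v))"
    unfolding group_ring_act_def
    by (intro sum.cong refl) (simp add: group_ring_mult_eq sum_smul_left)
  also have "\<dots> = (\<Sum>q\<in>Sym n. \<Sum>s\<in>Sym n. smul (of_int (a q * b (inv q \<circ> s))) (perm_act s v))" by (rule sum.swap)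
  also have "\<dots> = (\<Sum>q\<in>Sym n. smul (of_int (a q)) (perm_act q (group_ring_act n b v)))"
  proof (rule sum.cong[OF refl])
    fix q assume "q \<in> Sym n"
    then have q: "q permutes {1..n}" by simp
    have "(\<Sum>s\<in>Sym n. smul (of_int (a q * b (inv q \<circ> s))) (perm_act s v)) =
      (\<Sum>s\<in>Sym n. smul (of_int (a q * b (inv q \<circ> (q \<circ> s)))) (perm_act (q \<circ> s) v))"
      using sum_Sym_comp_left[OF q, of "\<lambda>s. smul (of_int (a q * b (inv q \<circ> s))) (perm_act s v)"] by simp
    also have "\<dots> = (\<Sum>s\<in>Sym n. smul (of_int (a q)) (smul (of_int (b s)) (perm_act q (perm_act s v))))"
    proof (rule sum.cong[OF refl])
      fix s :: "nat \<Rightarrow> nat"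
      have "inv q \<circ> (q \<circ> s) = s" using permutes_inv_o(2)[OF q] by (simp add: comp_assoc[symmetric])
      then show "smul (of_int (a q * b (inv q \<circ> (q \<circ> s)))) (perm_act (q \<circ> s) v) =
        smul (of_int (a q)) (smul (of_int (b s)) (perm_act q (perm_act s v)))"
        by (simp only: smul_smul perm_act_comp of_int_mult)
    qed
    finally show "(\<Sum>s\<in>Sym n. smul (of_int (a q * b (inv q \<circ> s))) (perm_act s v)) =
      smul (of_int (a q)) (perm_act q (group_ring_act n b v))"
      by (simp add: group_ring_act_def perm_act_sum perm_act_smul smul_sum)
  qed
  finally show ?thesis unfolding group_ring_act_def[of n a] .
qed

section \<open>Diagrams and tableaux\<close>

lemma diagram_Sigma: "diagram l = (SIGMA i:{..<length (row_lengths l)}. {..<row_lengths l ! i})"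
  by (auto simp: diagram_def)

lemma finite_diagram: "finite (diagram l)" by (simp add: diagram_Sigma)

lemma card_diagram: "card (diagram l) = psize l"
proof -
  have "card (diagram l) = (\<Sum>i<length (row_lengths l). row_lengths l ! i)" by (simp add: diagram_Sigma)
  also have "\<dots> = sum_list (row_lengths l)" by (simp add: sum_list_sum_nth atLeast0LessThan)
  finally show ?thesis by (simp add: sum_row_lengths)
qed

lemma tableau_exists: "\<exists>T. is_tableau l T"
  unfolding is_tableau_def using finite_diagram card_diagram by (intro finite_same_card_bij) auto

lemma diagram_down:
  assumes "(i, j) \<in> diagram l" "i' \<le> i" "j' \<le> j" shows "(i', j') \<in> diagram l"
proof -
  have ij: "i < length (row_lengths l)" "j < row_lengths l ! i" using assms(1) by (auto simp: diagram_def)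
  have "row_lengths l ! i \<le> row_lengths l ! i'"
  proof (cases "i' = i")
    case False
    then show ?thesis using descending_row_lengths[of l] ij assms(2) by (auto simp: descending_def sorted_wrt_iff_nth_less)
  qed simp
  then show ?thesis using ij assms by (auto simp: diagram_def)
qed

definition rowf :: "int_partition \<Rightarrow> (nat \<times> nat \<Rightarrow> nat) \<Rightarrow> nat \<Rightarrow> nat" where
  "rowf l T x = fst (inv_into (diagram l) T x)"

definition colf :: "int_partition \<Rightarrow> (nat \<times> nat \<Rightarrow> nat) \<Rightarrow> nat \<Rightarrow> nat" where
  "colf l T x = snd (inv_into (diagram l) T x)"

lemma rowf_T: "is_tableau l T \<Longrightarrow> b \<in> diagram l \<Longrightarrow> rowf l T (T b) = fst b \<and> colf l T (T b) = snd b"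
  by (simp add: is_tableau_def bij_betw_def rowf_def colf_def)

lemma tableau_image:
  assumes T: "is_tableau l T"
  shows "T ` {b\<in>diagram l. fst b = i} = {x\<in>{1..psize l}. rowf l T x = i}"
    "T ` {b\<in>diagram l. snd b = i} = {x\<in>{1..psize l}. colf l T x = i}"
    "x \<in> {1..psize l} \<Longrightarrow> \<exists>b\<in>diagram l. x = T b"
proof -
  have im: "T ` diagram l = {1..psize l}" using T by (simp add: is_tableau_def bij_betw_def)
  show "T ` {b\<in>diagram l. fst b = i} = {x\<in>{1..psize l}. rowf l T x = i}"
    "T ` {b\<in>diagram l. snd b = i} = {x\<in>{1..psize l}. colf l T x = i}"
    unfolding im[symmetric] using rowf_T[OF T] by auto
  show "x \<in> {1..psize l} \<Longrightarrow> \<exists>b\<in>diagram l. x = T b" unfolding im[symmetric] by auto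
qed

lemma tableau_inj: "is_tableau l T \<Longrightarrow> inj_on (\<lambda>x. (rowf l T x, colf l T x)) {1..psize l}"
  by (rule inj_onI) (metis (no_types, lifting) Pair_inject prod.expand rowf_T tableau_image(3))

lemma tableau_down:
  assumes T: "is_tableau l T" and x: "x \<in> {1..psize l}" and ij: "i \<le> rowf l T x" "j \<le> colf l T x"
  shows "\<exists>y\<in>{1..psize l}. rowf l T y = i \<and> colf l T y = j"
proof -
  obtain b where b: "b \<in> diagram l" "x = T b" using tableau_image(3)[OF T x] by blast
  have "(fst b, snd b) \<in> diagram l" using b by simp
  then have d: "(i, j) \<in> diagram l" by (rule diagram_down) (use ij rowf_T[OF T b(1)] b in auto)
  moreover have "T (i, j) \<in> {1..psize l}" using d T by (auto simp: is_tableau_def bij_betw_def)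
  ultimately show ?thesis using rowf_T[OF T d] by auto
qed

lemma esym_value_reindex:
  assumes "bij_betw T B X" "\<And>b. b \<in> B \<Longrightarrow> c' (T b) = c b"
  shows "esym_value r c' X = esym_value r c B"
proof -
  have inj: "inj_on T B" and im: "T ` B = X" using assms(1) by (auto simp: bij_betw_def)
  have "bij_betw ((`) T) {S. S \<subseteq> B \<and> card S = r} {S. S \<subseteq> X \<and> card S = r}"
  proof (rule bij_betw_imageI)
    show "inj_on ((`) T) {S. S \<subseteq> B \<and> card S = r}"
    proof (rule inj_onI)
      fix S S' assume "S \<in> {S. S \<subseteq> B \<and> card S = r}" "S' \<in> {S. S \<subseteq> B \<and> card S = r}" "T ` S = T ` S'"
      then show "S = S'" using inj_on_image_eq_iff[OF inj, of S S'] by simp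
    qed
    show "(`) T ` {S. S \<subseteq> B \<and> card S = r} = {S. S \<subseteq> X \<and> card S = r}"
    proof (intro set_eqI iffI)
      fix S assume "S \<in> (`) T ` {S. S \<subseteq> B \<and> card S = r}"
      then show "S \<in> {S. S \<subseteq> X \<and> card S = r}" using im inj by (auto simp: card_image inj_on_subset)
    next
      fix S assume S: "S \<in> {S. S \<subseteq> X \<and> card S = r}"
      then have "S \<subseteq> T ` B" using im by blast
      then obtain S' where S': "S' \<subseteq> B" "S = T ` S'" by (auto simp: subset_image_iff)
      then have "card S' = r" using S inj by (auto simp: card_image inj_on_subset)
      then show "S \<in> (`) T ` {S. S \<subseteq> B \<and> card S = r}" using S' by blast
    qed
  qed
  then have "esym_value r c' X = (\<Sum>S\<in>{S. S \<subseteq> B \<and> card S = r}. prod c' (T ` S))"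
    unfolding esym_value_def by (rule sum.reindex_bij_betw[symmetric])
  also have "\<dots> = (\<Sum>S\<in>{S. S \<subseteq> B \<and> card S = r}. prod c S)"
  proof (rule sum.cong[OF refl])
    fix S assume S: "S \<in> {S. S \<subseteq> B \<and> card S = r}"
    then have "inj_on T S" using inj by (auto intro: inj_on_subset)
    then show "prod c' (T ` S) = prod c S" using S assms(2) by (subst prod.reindex) (auto intro!: prod.cong)
  qed
  finally show ?thesis by (simp add: esym_value_def)
qed

section \<open>Rearranging columns\<close>

lemma down_closed_lessThan:
  assumes "finite S" "\<And>x y. x \<in> S \<Longrightarrow> y \<le> x \<Longrightarrow> y \<in> S"
  shows "S = {..<card S :: nat}"
proof (cases "S = {}")
  case False
  have "S = {..Max S}" using assms Max_in[OF assms(1) False] by (auto intro: Max_ge)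
  then have "S = {..<Suc (Max S)}" by (simp add: lessThan_Suc_atMost)
  then show ?thesis by (metis card_lessThan)
qed simp

text \<open>If any two points in the same column of the tableau have different rows \<open>\<rho>\<close> in another tableau of
the same shape, then a permutation within the columns makes the rows equal. A column of height \<open>h\<close> has
at most \<open>min h k\<close> points with \<open>\<rho> < k\<close>. Since both tableaux have the same number of points in the first \<open>k\<close>
rows, the bound is attained in every column. For \<open>k = h\<close> this shows that \<open>\<rho>\<close> takes each value below \<open>h\<close>
once on the column.\<close>

lemma column_rearrangement:
  fixes X :: "nat set"
  assumes fin: "finite X" and inj: "inj_on (\<lambda>x. (rw x, cl x)) X"
    and down: "\<And>x i j. x \<in> X \<Longrightarrow> i \<le> rw x \<Longrightarrow> j \<le> cl x \<Longrightarrow> \<exists>y\<in>X. rw y = i \<and> cl y = j"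
    and sizes: "\<And>i :: nat. card {x\<in>X. \<rho> x = i} = card {x\<in>X. rw x = i}"
    and col: "\<And>x y. x \<in> X \<Longrightarrow> y \<in> X \<Longrightarrow> cl x = cl y \<Longrightarrow> \<rho> x = \<rho> y \<Longrightarrow> x = y"
  shows "\<exists>q\<in>stab X cl. \<forall>x\<in>X. \<rho> x = rw (inv q x)"
proof -
  define C where "C j = {x\<in>X. cl x = j}" for j
  have fC: "finite (C j)" for j using fin by (simp add: C_def)
  have injr: "inj_on rw (C j)" for j using inj by (auto simp: C_def inj_on_def)
  have inj\<rho>: "inj_on \<rho> (C j)" for j using col by (auto simp: C_def inj_on_def)
  have rwC: "rw ` C j = {..<card (C j)}" for j
  proof -
    have "rw ` C j = {..<card (rw ` C j)}"
    proof (rule down_closed_lessThan)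
      show "finite (rw ` C j)" using fC by simp
      fix x y assume "x \<in> rw ` C j" "y \<le> x"
      then obtain z where "z \<in> X" "cl z = j" "y \<le> rw z" by (auto simp: C_def)
      then show "y \<in> rw ` C j" using down[of z y j] by (auto simp: C_def)
    qed
    then show ?thesis using card_image[OF injr] by metis
  qed
  have tot: "card {x\<in>X. f x < k} = (\<Sum>j\<in>cl ` X. card {x\<in>C j. f x < k})" for f :: "nat \<Rightarrow> nat" and k
  proof -
    have "{x\<in>X. f x < k} = (\<Union>j\<in>cl ` X. {x\<in>C j. f x < k})" by (auto simp: C_def)
    then show ?thesis using fin by (simp only:) (rule card_UN_disjoint, auto simp: C_def)
  qed
  have tot2: "card {x\<in>X. f x < k} = (\<Sum>i<k. card {x\<in>X. f x = i})" for f :: "nat \<Rightarrow> nat" and k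
  proof -
    have "{x\<in>X. f x < k} = (\<Union>i<k. {x\<in>X. f x = i})" by auto
    then show ?thesis using fin by (simp only:) (rule card_UN_disjoint, auto)
  qed
  have rmin: "card {x\<in>C j. rw x < k} = min (card (C j)) k" for j k
  proof -
    have "rw ` {x\<in>C j. rw x < k} = {..<card (C j)} \<inter> {..<k}" unfolding rwC[symmetric] by auto
    also have "\<dots> = {..<min (card (C j)) k}" by auto
    finally have "card (rw ` {x\<in>C j. rw x < k}) = min (card (C j)) k" by simp
    then show ?thesis using card_image[of rw "{x\<in>C j. rw x < k}"] injr[of j] by (simp add: inj_on_subset)
  qed
  have rhole: "card {x\<in>C j. \<rho> x < k} \<le> min (card (C j)) k" for j k
  proof -
    have "card {x\<in>C j. \<rho> x < k} \<le> card (C j)" using fC by (intro card_mono) auto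
    moreover have "card {x\<in>C j. \<rho> x < k} \<le> card {..<k}"
      by (rule card_inj_on_le[of \<rho>]) (use inj\<rho>[of j] in \<open>auto intro: inj_on_subset\<close>)
    ultimately show ?thesis by simp
  qed
  have eq: "card {x\<in>C j. \<rho> x < k} = min (card (C j)) k" if j: "j \<in> cl ` X" for j k
  proof -
    have "(\<Sum>j\<in>cl ` X. card {x\<in>C j. \<rho> x < k}) = (\<Sum>j\<in>cl ` X. min (card (C j)) k)"
      unfolding rmin[symmetric] tot[symmetric] tot2 using sizes by simp
    then show ?thesis by (rule sum_mono_inv) (use rhole j fin in auto)
  qed
  have lt: "\<rho> x < card (C (cl x))" if x: "x \<in> X" for x
  proof -
    have "card {y\<in>C (cl x). \<rho> y < card (C (cl x))} = card (C (cl x))" using eq[of "cl x" "card (C (cl x))"] x by simp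
    then have "{y\<in>C (cl x). \<rho> y < card (C (cl x))} = C (cl x)" using fC by (intro card_subset_eq) auto
    then show ?thesis using x by (auto simp: C_def)
  qed
  have "\<exists>y\<in>X. cl y = cl x \<and> rw y = \<rho> x" if x: "x \<in> X" for x
  proof -
    have "\<rho> x \<in> rw ` C (cl x)" unfolding rwC using lt[OF x] by simp
    then show ?thesis by (auto simp: C_def)
  qed
  then obtain g where g: "\<And>x. x \<in> X \<Longrightarrow> g x \<in> X \<and> cl (g x) = cl x \<and> rw (g x) = \<rho> x" by metis
  define h where "h x = (if x \<in> X then g x else x)" for x
  have h: "h permutes X"
  proof (rule inj_imp_permutes)
    show "inj_on h X"
    proof (rule inj_onI)
      fix x y assume xy: "x \<in> X" "y \<in> X" "h x = h y"
      then have "g x = g y" by (simp add: h_def)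
      then show "x = y" using g[OF xy(1)] g[OF xy(2)] col[OF xy(1,2)] by metis
    qed
  qed (use fin g in \<open>auto simp: h_def\<close>)
  have "h \<in> stab X cl" using h g by (auto simp: stab_def h_def)
  then have "inv h \<in> stab X cl" by (rule stab_inv)
  moreover have "\<forall>x\<in>X. \<rho> x = rw (inv (inv h) x)" using g permutes_inv_inv[OF h] by (simp add: h_def)
  ultimately show ?thesis by blast
qed

section \<open>Class functions act on polytabloids by scalars\<close>

text \<open>The tabloid of the tableau \<open>s \<circ> T\<close>.\<close>

definition tabloid_at :: "int_partition \<Rightarrow> (nat \<times> nat \<Rightarrow> nat) \<Rightarrow> (nat \<Rightarrow> nat) \<Rightarrow> tabloid" where
  "tabloid_at l T s i = s ` {x\<in>{1..psize l}. rowf l T x = i}"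

lemma tabloid_of_comp: "is_tableau l T \<Longrightarrow> tabloid_of l (s \<circ> T) = tabloid_at l T s"
  unfolding fun_eq_iff tabloid_of_def tabloid_at_def image_comp[symmetric] by (simp only: tableau_image(1) simp_thms)

lemma tabloid_at_comp: "(\<lambda>i. p ` tabloid_at l T s i) = tabloid_at l T (p \<circ> s)" by (simp add: tabloid_at_def image_comp fun_eq_iff)

lemma tabloid_at_comp_cong: "tabloid_at l T s = tabloid_at l T s' \<Longrightarrow> tabloid_at l T (q \<circ> s) = tabloid_at l T (q \<circ> s')"
  unfolding tabloid_at_comp[symmetric] by simp

lemma tabloid_at_eq_iff:
  assumes s: "s permutes {1..psize l}" "s' permutes {1..psize l}"
  shows "tabloid_at l T s = tabloid_at l T s' \<longleftrightarrow> (\<forall>x\<in>{1..psize l}. rowf l T (inv s x) = rowf l T (inv s' x))"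
proof -
  have mem: "x \<in> tabloid_at l T s i \<longleftrightarrow> x \<in> {1..psize l} \<and> rowf l T (inv s x) = i" if s: "s permutes {1..psize l}" for s x i
  proof
    assume "x \<in> tabloid_at l T s i"
    then obtain y where "y \<in> {1..psize l}" "rowf l T y = i" "x = s y" by (auto simp: tabloid_at_def)
    then show "x \<in> {1..psize l} \<and> rowf l T (inv s x) = i" using permutes_in_image[OF s] permutes_inverses(2)[OF s] by simp
  next
    assume a: "x \<in> {1..psize l} \<and> rowf l T (inv s x) = i"
    then have "inv s x \<in> {1..psize l}" using permutes_in_image[OF permutes_inv[OF s]] by simp
    then have "s (inv s x) \<in> tabloid_at l T s i" using a unfolding tabloid_at_def by blast
    then show "x \<in> tabloid_at l T s i" using permutes_inverses(1)[OF s] by simp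
  qed
  show ?thesis
  proof
    assume e: "tabloid_at l T s = tabloid_at l T s'"
    show "\<forall>x\<in>{1..psize l}. rowf l T (inv s x) = rowf l T (inv s' x)"
      using mem[OF s(1)] mem[OF s(2)] unfolding e by blast
  next
    assume "\<forall>x\<in>{1..psize l}. rowf l T (inv s x) = rowf l T (inv s' x)"
    then show "tabloid_at l T s = tabloid_at l T s'" using mem[OF s(1)] mem[OF s(2)] by (intro ext set_eqI) auto
  qed
qed

lemma column_stabilizer_eq:
  assumes T: "is_tableau l T"
  shows "column_stabilizer l T = stab {1..psize l} (colf l T)"
proof (intro set_eqI iffI)
  let ?X = "{1..psize l}"
  fix p assume "p \<in> column_stabilizer l T"
  then have p: "p permutes ?X" "\<And>j. p ` {x\<in>?X. colf l T x = j} = {x\<in>?X. colf l T x = j}"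
    unfolding column_stabilizer_def tableau_image(2)[OF T] by auto
  have "colf l T (p x) = colf l T x" for x
  proof (cases "x \<in> ?X")
    case True
    then have "p x \<in> p ` {y\<in>?X. colf l T y = colf l T x}" by blast
    then show ?thesis unfolding p(2) by blast
  qed (use p(1) in \<open>simp add: permutes_not_in\<close>)
  then show "p \<in> stab ?X (colf l T)" using p(1) by (simp add: stab_def)
next
  let ?X = "{1..psize l}"
  fix p assume p: "p \<in> stab ?X (colf l T)"
  have sub: "q ` {x\<in>?X. colf l T x = j} \<subseteq> {x\<in>?X. colf l T x = j}" if "q \<in> stab ?X (colf l T)" for q j
    using stabD[OF that] permutes_in_image by fastforce
  have "p ` {x\<in>?X. colf l T x = j} = {x\<in>?X. colf l T x = j}" for j
  proof
    show "{x\<in>?X. colf l T x = j} \<subseteq> p ` {x\<in>?X. colf l T x = j}"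
    proof
      fix x assume "x \<in> {x\<in>?X. colf l T x = j}"
      then have "inv p x \<in> {x\<in>?X. colf l T x = j}" using sub[OF stab_inv[OF p]] by blast
      then have "p (inv p x) \<in> p ` {x\<in>?X. colf l T x = j}" by (rule imageI)
      then show "x \<in> p ` {x\<in>?X. colf l T x = j}" unfolding permutes_inverses(1)[OF stabD(1)[OF p]] .
    qed
  qed (rule sub[OF p])
  then show "p \<in> column_stabilizer l T"
    unfolding column_stabilizer_def tableau_image(2)[OF T] using stabD(1)[OF p] by simp
qed

lemma polytabloid_eq:
  assumes T: "is_tableau l T"
  shows "polytabloid l T = (\<Sum>q\<in>stab {1..psize l} (colf l T). Poly_Mapping.single (tabloid_at l T q) (of_int (sign q)))"
  unfolding polytabloid_def column_stabilizer_eq[OF T] tabloid_of_comp[OF T] ..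

lemma eq_uminus_zero:
  fixes v :: "'a \<Rightarrow>\<^sub>0 complex" assumes "v = - v" shows "v = 0"
proof (rule poly_mapping_eqI)
  fix k
  have "lkp v k = - lkp v k" using arg_cong[OF assms, of "\<lambda>v. lkp v k"] by simp
  then show "lkp v k = lkp 0 k" by simp
qed

text \<open>If two points are in one column of \<open>T\<close> and in one row of the tabloid, then their transposition fixes the
tabloid but changes the sign, so the signed sum vanishes. Otherwise the tabloid is a column
rearrangement of that of \<open>T\<close>.\<close>

lemma antisymmetrized_tabloid:
  assumes T: "is_tableau l T" and p: "p permutes {1..psize l}"
  shows "\<exists>c. (\<Sum>q\<in>stab {1..psize l} (colf l T). Poly_Mapping.single (tabloid_at l T (q \<circ> p)) (of_int (sign q))) =
    smul c (polytabloid l T)"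
proof -
  let ?X = "{1..psize l}" and ?C = "stab {1..psize l} (colf l T)"
  let ?K = "\<Sum>q\<in>?C. Poly_Mapping.single (tabloid_at l T (q \<circ> p)) (of_int (sign q) :: complex)"
  have fin: "finite ?X" by simp
  define \<rho> where "\<rho> x = rowf l T (inv p x)" for x
  show ?thesis
  proof (cases "\<exists>x\<in>?X. \<exists>y\<in>?X. x \<noteq> y \<and> colf l T x = colf l T y \<and> \<rho> x = \<rho> y")
    case True
    then obtain x y where xy: "x \<in> ?X" "y \<in> ?X" "x \<noteq> y" "colf l T x = colf l T y" "\<rho> x = \<rho> y" by blast
    have t: "tr x y \<in> ?C" by (rule stab_tr[OF xy(1,2,4)])
    have "tabloid_at l T (tr x y \<circ> p) = tabloid_at l T p"
    proof (subst tabloid_at_eq_iff)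
      show "tr x y \<circ> p permutes ?X" using p permutes_swap_id[OF xy(1,2)] by (rule permutes_compose)
      have "inv (tr x y \<circ> p) = inv p \<circ> tr x y" using o_inv_distrib[of "tr x y" p] permutes_bij[OF p] by simp
      then show "\<forall>z\<in>?X. rowf l T (inv (tr x y \<circ> p) z) = rowf l T (inv p z)"
        using xy(5) by (auto simp: \<rho>_def Transposition.transpose_def)
    qed (rule p)
    then have e: "tabloid_at l T (q \<circ> tr x y \<circ> p) = tabloid_at l T (q \<circ> p)" for q
      unfolding comp_assoc by (rule tabloid_at_comp_cong)
    have "?K = (\<Sum>q\<in>?C. Poly_Mapping.single (tabloid_at l T (q \<circ> tr x y \<circ> p)) (of_int (sign (q \<circ> tr x y))))"
      by (rule stab_sum_comp_right[OF t, symmetric])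
    also have "\<dots> = (\<Sum>q\<in>?C. - Poly_Mapping.single (tabloid_at l T (q \<circ> p)) (of_int (sign q)))"
    proof (rule sum.cong[OF refl])
      fix q assume "q \<in> ?C"
      then have "sign (q \<circ> tr x y) = - sign q"
        using stab_permutation[OF fin] xy(3) by (simp add: sign_compose permutation_swap_id sign_swap_id)
      then show "Poly_Mapping.single (tabloid_at l T (q \<circ> tr x y \<circ> p)) (of_int (sign (q \<circ> tr x y)) :: complex) =
        - Poly_Mapping.single (tabloid_at l T (q \<circ> p)) (of_int (sign q))" unfolding e by (simp add: single_uminus)
    qed
    finally have K: "?K = - ?K" by (simp add: sum_negf)
    then have "?K = 0" by (rule eq_uminus_zero)
    then show ?thesis using smul_zero_left by metis
  next
    case False
    have sizes: "card {x\<in>?X. \<rho> x = i} = card {x\<in>?X. rowf l T x = i}" for i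
    proof -
      have "bij_betw p {x\<in>?X. rowf l T x = i} {x\<in>?X. \<rho> x = i}"
      proof (rule bij_betw_byWitness[where f' = "inv p"])
        show "p ` {x\<in>?X. rowf l T x = i} \<subseteq> {x\<in>?X. \<rho> x = i}"
        proof (rule image_subsetI)
          fix x assume x: "x \<in> {x\<in>?X. rowf l T x = i}"
          then have "p x \<in> ?X" using permutes_in_image[OF p, of x] by blast
          then show "p x \<in> {x\<in>?X. \<rho> x = i}" using x by (simp add: \<rho>_def permutes_inverses(2)[OF p])
        qed
        show "inv p ` {x\<in>?X. \<rho> x = i} \<subseteq> {x\<in>?X. rowf l T x = i}"
        proof (rule image_subsetI)
          fix x assume x: "x \<in> {x\<in>?X. \<rho> x = i}"
          then have "inv p x \<in> ?X" using permutes_in_image[OF permutes_inv[OF p], of x] by blast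
          then show "inv p x \<in> {x\<in>?X. rowf l T x = i}" using x by (simp add: \<rho>_def)
        qed
      qed (simp_all add: permutes_inverses[OF p])
      then show ?thesis by (rule bij_betw_same_card[symmetric])
    qed
    obtain q0 where q0: "q0 \<in> ?C" "\<forall>x\<in>?X. \<rho> x = rowf l T (inv q0 x)"

    proof -
      have "\<exists>q\<in>?C. \<forall>x\<in>?X. \<rho> x = rowf l T (inv q x)"
      proof (rule column_rearrangement[OF fin tableau_inj[OF T] _ sizes])
        show "\<exists>y\<in>?X. rowf l T y = i \<and> colf l T y = j"
          if "x \<in> ?X" "i \<le> rowf l T x" "j \<le> colf l T x" for x i j using tableau_down[OF T that] .
        show "x = y" if "x \<in> ?X" "y \<in> ?X" "colf l T x = colf l T y" "\<rho> x = \<rho> y" for x y using False that by blast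
      qed
      then show thesis using that by blast
    qed
    have pq: "q0 permutes ?X" by (rule stabD(1)[OF q0(1)])
    have "tabloid_at l T p = tabloid_at l T q0" unfolding tabloid_at_eq_iff[OF p pq] using q0(2) by (simp add: \<rho>_def)
    then have e: "tabloid_at l T (q \<circ> p) = tabloid_at l T (q \<circ> q0)" for q by (rule tabloid_at_comp_cong)
    have "?K = (\<Sum>q\<in>?C. smul (of_int (sign q0)) (Poly_Mapping.single (tabloid_at l T (q \<circ> q0)) (of_int (sign (q \<circ> q0)))))"
    proof (rule sum.cong[OF refl])
      fix q assume "q \<in> ?C"
      then have "sign (q \<circ> q0) = sign q * sign q0"
        using stab_permutation[OF fin] q0(1) by (simp add: sign_compose)
      then have "of_int (sign q) = (of_int (sign q0) * of_int (sign (q \<circ> q0)) :: complex)"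
        by (metis mult.commute of_int_mult sign_left_idempotent)
      then show "Poly_Mapping.single (tabloid_at l T (q \<circ> p)) (of_int (sign q) :: complex) =
        smul (of_int (sign q0)) (Poly_Mapping.single (tabloid_at l T (q \<circ> q0)) (of_int (sign (q \<circ> q0))))"
        unfolding e smul_single by simp
    qed
    also have "\<dots> = (\<Sum>q\<in>?C. smul (of_int (sign q0)) (Poly_Mapping.single (tabloid_at l T q) (of_int (sign q))))"
      by (rule stab_sum_comp_right[OF q0(1)])
    also have "\<dots> = smul (of_int (sign q0)) (polytabloid l T)" unfolding polytabloid_eq[OF T] smul_sum ..
    finally show ?thesis by blast
  qed
qed

lemma act_polytabloid:
  assumes T: "is_tableau l T"
  shows "group_ring_act (psize l) a (polytabloid l T) =
    (\<Sum>q\<in>stab {1..psize l} (colf l T). \<Sum>p\<in>Sym (psize l). Poly_Mapping.single (tabloid_at l T (p \<circ> q)) (of_int (a p * sign q)))"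
proof -
  have "group_ring_act (psize l) a (polytabloid l T) = (\<Sum>p\<in>Sym (psize l). \<Sum>q\<in>stab {1..psize l} (colf l T).
     Poly_Mapping.single (tabloid_at l T (p \<circ> q)) (of_int (a p * sign q)))"
    unfolding group_ring_act_def polytabloid_eq[OF T] perm_act_sum perm_act_single tabloid_at_comp smul_sum smul_single of_int_mult ..
  also have "\<dots> = (\<Sum>q\<in>stab {1..psize l} (colf l T). \<Sum>p\<in>Sym (psize l). Poly_Mapping.single (tabloid_at l T (p \<circ> q)) (of_int (a p * sign q)))"
    by (rule sum.swap)
  finally show ?thesis .
qed

text \<open>A class function commutes with the signed sum over the column stabilizer, so it can be applied to the
tabloid of \<open>T\<close> first.\<close>

lemma class_fun_act_scalar:
  assumes T: "is_tableau l T" and a: "class_fun (psize l) a"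
  shows "\<exists>c. group_ring_act (psize l) a (polytabloid l T) = smul c (polytabloid l T)"
proof -
  let ?n = "psize l" and ?C = "stab {1..psize l} (colf l T)"
  have "group_ring_act ?n a (polytabloid l T) = (\<Sum>q\<in>?C. \<Sum>p\<in>Sym ?n. Poly_Mapping.single (tabloid_at l T (q \<circ> p)) (of_int (a p * sign q)))"
    unfolding act_polytabloid[OF T]
  proof (rule sum.cong[OF refl])
    fix q assume q: "q \<in> ?C"
    have qp: "q permutes {1..?n}" by (rule stabD(1)[OF q])
    show "(\<Sum>p\<in>Sym ?n. Poly_Mapping.single (tabloid_at l T (p \<circ> q)) (of_int (a p * sign q) :: complex)) =
      (\<Sum>p\<in>Sym ?n. Poly_Mapping.single (tabloid_at l T (q \<circ> p)) (of_int (a p * sign q)))"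
    proof (rule sum.reindex_bij_witness[where i = "\<lambda>p. q \<circ> p \<circ> inv q" and j = "\<lambda>p. inv q \<circ> p \<circ> q"])
      fix p assume "p \<in> Sym ?n"
      then have p: "p permutes {1..?n}" by simp
      have c: "q \<circ> (inv q \<circ> r) = r" "inv q \<circ> (q \<circ> r) = r" for r :: "nat \<Rightarrow> nat"
        using permutes_inv_o[OF qp] by (simp_all add: comp_assoc[symmetric])
      show "q \<circ> (inv q \<circ> p \<circ> q) \<circ> inv q = p" "inv q \<circ> (q \<circ> p \<circ> inv q) \<circ> q = p"
        using permutes_inv_o[OF qp] by (simp_all add: comp_assoc c)
      show "inv q \<circ> p \<circ> q \<in> Sym ?n" "q \<circ> p \<circ> inv q \<in> Sym ?n"
        using qp p by (auto intro!: permutes_compose permutes_inv)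
      have "a (inv q \<circ> p \<circ> inv (inv q)) = a p" using a p qp unfolding class_fun_def by (auto intro: permutes_inv)
      then have "a (inv q \<circ> p \<circ> q) = a p" using permutes_inv_inv[OF qp] by simp
      moreover have "q \<circ> (inv q \<circ> p \<circ> q) = p \<circ> q" by (simp add: comp_assoc c)
      ultimately show "Poly_Mapping.single (tabloid_at l T (q \<circ> (inv q \<circ> p \<circ> q))) (of_int (a (inv q \<circ> p \<circ> q) * sign q) :: complex) =
        Poly_Mapping.single (tabloid_at l T (p \<circ> q)) (of_int (a p * sign q))" by (simp only:)
    qed
  qed
  also have "\<dots> = (\<Sum>p\<in>Sym ?n. smul (of_int (a p)) (\<Sum>q\<in>?C. Poly_Mapping.single (tabloid_at l T (q \<circ> p)) (of_int (sign q))))"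
    unfolding smul_sum smul_single of_int_mult by (rule sum.swap)
  finally have 1: "group_ring_act ?n a (polytabloid l T) = \<dots>" .
  have "\<forall>p\<in>Sym ?n. \<exists>c. (\<Sum>q\<in>?C. Poly_Mapping.single (tabloid_at l T (q \<circ> p)) (of_int (sign q))) = smul c (polytabloid l T)"
    using antisymmetrized_tabloid[OF T] by blast
  from bchoice[OF this] obtain c where
    c: "\<forall>p\<in>Sym ?n. (\<Sum>q\<in>?C. Poly_Mapping.single (tabloid_at l T (q \<circ> p)) (of_int (sign q))) = smul (c p) (polytabloid l T)" ..
  have "group_ring_act ?n a (polytabloid l T) = (\<Sum>p\<in>Sym ?n. smul (of_int (a p) * c p) (polytabloid l T))"
    unfolding 1 by (rule sum.cong[OF refl]) (simp only: bspec[OF c] smul_smul)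
  then show ?thesis unfolding sum_smul_left[symmetric] by blast
qed

text \<open>The scalar by which a class function acts on the polytabloid of \<open>T\<close>, read off at the tabloid of \<open>T\<close>,
where the polytabloid has coefficient 1.\<close>

definition omega :: "int_partition \<Rightarrow> (nat \<times> nat \<Rightarrow> nat) \<Rightarrow> ((nat \<Rightarrow> nat) \<Rightarrow> int) \<Rightarrow> complex" where
  "omega l T a = lkp (group_ring_act (psize l) a (polytabloid l T)) (tabloid_at l T id)"

lemma tabloid_at_comp_id_iff:
  assumes "p permutes {1..psize l}" "q permutes {1..psize l}"
  shows "tabloid_at l T (p \<circ> q) = tabloid_at l T id \<longleftrightarrow> p \<circ> q \<in> stab {1..psize l} (rowf l T)"
proof -
  have pq: "p \<circ> q permutes {1..psize l}" using assms(2,1) by (rule permutes_compose)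
  have "tabloid_at l T (p \<circ> q) = tabloid_at l T id \<longleftrightarrow> (\<forall>x\<in>{1..psize l}. rowf l T (inv (p \<circ> q) x) = rowf l T x)"
    unfolding tabloid_at_eq_iff[OF pq permutes_id] by simp
  also have "\<dots> \<longleftrightarrow> (\<forall>x. rowf l T (inv (p \<circ> q) x) = rowf l T x)"
    using permutes_not_in[OF permutes_inv[OF pq]] by metis
  also have "\<dots> \<longleftrightarrow> inv (p \<circ> q) \<in> stab {1..psize l} (rowf l T)" using permutes_inv[OF pq] by (simp add: stab_def)
  also have "\<dots> \<longleftrightarrow> p \<circ> q \<in> stab {1..psize l} (rowf l T)" using stab_inv permutes_inv_inv[OF pq] by metis
  finally show ?thesis .
qed

text \<open>The permutation \<open>p\<close> contributes to the coefficient of the tabloid of \<open>T\<close> through those \<open>q\<close> in the column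
stabilizer for which \<open>p \<circ> q\<close> is in the row stabilizer.\<close>

lemma omega_eq:
  assumes T: "is_tableau l T"
  shows "omega l T a = of_int (\<Sum>h\<in>stab {1..psize l} (rowf l T). \<Sum>q\<in>stab {1..psize l} (colf l T). sign q * a (h \<circ> q))"
proof -
  let ?n = "psize l" and ?C = "stab {1..psize l} (colf l T)" and ?R = "stab {1..psize l} (rowf l T)"
  have "omega l T a = of_int (\<Sum>q\<in>?C. \<Sum>p\<in>Sym ?n. if p \<circ> q \<in> ?R then a p * sign q else 0)"
    unfolding omega_def act_polytabloid[OF T] lookup_sum of_int_sum
    by (intro sum.cong refl) (use stabD(1) in \<open>auto simp: lookup_single when_def tabloid_at_comp_id_iff\<close>)
  also have "(\<Sum>q\<in>?C. \<Sum>p\<in>Sym ?n. if p \<circ> q \<in> ?R then a p * sign q else 0) = (\<Sum>q\<in>?C. \<Sum>h\<in>?R. a (h \<circ> inv q) * sign q)"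
  proof (rule sum.cong[OF refl])
    fix q assume q: "q \<in> ?C"
    have qp: "q permutes {1..?n}" by (rule stabD(1)[OF q])
    have "(\<Sum>p\<in>Sym ?n. if p \<circ> q \<in> ?R then a p * sign q else 0) = (\<Sum>p\<in>{p\<in>Sym ?n. p \<circ> q \<in> ?R}. a p * sign q)"
      by (rule sum.inter_filter[symmetric]) simp
    also have "\<dots> = (\<Sum>h\<in>?R. a (h \<circ> inv q) * sign q)"
    proof (rule sum.reindex_bij_witness[where i = "\<lambda>h. h \<circ> inv q" and j = "\<lambda>p. p \<circ> q"])
      have c: "(r \<circ> q) \<circ> inv q = r" "(r \<circ> inv q) \<circ> q = r" for r :: "nat \<Rightarrow> nat"
        using permutes_inv_o[OF qp] by (simp_all add: comp_assoc)
      fix p :: "nat \<Rightarrow> nat"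
      show "(p \<circ> q) \<circ> inv q = p" "(p \<circ> inv q) \<circ> q = p" "a ((p \<circ> q) \<circ> inv q) * sign q = a p * sign q" by (simp_all only: c)
      show "p \<in> ?R \<Longrightarrow> p \<circ> inv q \<in> {p\<in>Sym ?n. p \<circ> q \<in> ?R}"
        unfolding mem_Collect_eq c by (intro conjI permutes_compose permutes_inv[OF qp] stabD(1))
    qed simp
    finally show "(\<Sum>p\<in>Sym ?n. if p \<circ> q \<in> ?R then a p * sign q else 0) = (\<Sum>h\<in>?R. a (h \<circ> inv q) * sign q)" .
  qed
  also have "\<dots> = (\<Sum>h\<in>?R. \<Sum>q\<in>?C. a (h \<circ> inv q) * sign q)" by (rule sum.swap)
  also have "\<dots> = (\<Sum>h\<in>?R. \<Sum>q\<in>?C. sign q * a (h \<circ> q))"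
  proof (rule sum.cong[OF refl])
    fix h
    show "(\<Sum>q\<in>?C. a (h \<circ> inv q) * sign q) = (\<Sum>q\<in>?C. sign q * a (h \<circ> q))"
    proof (rule sum.reindex_bij_witness[where i = inv and j = inv])
      fix q assume q: "q \<in> ?C"
      show "inv (inv q) = q" using permutes_inv_inv[OF stabD(1)[OF q]] .
      show "inv q \<in> ?C" by (rule stab_inv[OF q])
      have "sign (inv q) = sign q" using stab_permutation[OF _ q] by (intro sign_inverse) simp
      then show "sign (inv q) * a (h \<circ> inv q) = a (h \<circ> inv q) * sign q" by simp
    next
      fix q assume q: "q \<in> ?C"
      show "inv (inv q) = q" using permutes_inv_inv[OF stabD(1)[OF q]] .
      show "inv q \<in> ?C" by (rule stab_inv[OF q])
    qed
  qed
  finally show ?thesis .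
qed

text \<open>Only the identity preserves both rows and columns.\<close>

lemma polytabloid_coeff:
  assumes T: "is_tableau l T" shows "lkp (polytabloid l T) (tabloid_at l T id) = 1"
proof -
  let ?X = "{1..psize l}"
  let ?C = "stab ?X (colf l T)"
  have e: "tabloid_at l T q = tabloid_at l T id \<longleftrightarrow> q = id" if q: "q \<in> ?C" for q
  proof
    assume "tabloid_at l T q = tabloid_at l T id"
    then have "q \<in> stab ?X (rowf l T)" using tabloid_at_comp_id_iff[of q l id T] stabD(1)[OF q] by simp
    then have rc: "rowf l T (q x) = rowf l T x" "colf l T (q x) = colf l T x" for x using stabD(2) q by blast+
    have "q x = x" for x
    proof (cases "x \<in> ?X")
      case True
      then have "q x \<in> ?X" using permutes_in_image[OF stabD(1)[OF q]] by simp
      moreover have "(rowf l T (q x), colf l T (q x)) = (rowf l T x, colf l T x)" by (simp only: rc)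
      ultimately show ?thesis using inj_onD[OF tableau_inj[OF T]] True by blast
    qed (use stabD(1)[OF q] in \<open>simp add: permutes_not_in\<close>)
    then show "q = id" by auto
  qed simp
  have "lkp (polytabloid l T) (tabloid_at l T id) = (\<Sum>q\<in>?C. if q = id then 1 else 0)"
    unfolding polytabloid_eq[OF T] lookup_sum
    by (intro sum.cong refl) (auto simp: lookup_single when_def e)
  then show ?thesis using finite_stab[of ?X "colf l T"] stab_id[of ?X "colf l T"] by (simp add: sum.delta)
qed

lemma act_eq_omega:
  assumes T: "is_tableau l T" and a: "class_fun (psize l) a"
  shows "group_ring_act (psize l) a (polytabloid l T) = smul (omega l T a) (polytabloid l T)"
proof -
  obtain c where c: "group_ring_act (psize l) a (polytabloid l T) = smul c (polytabloid l T)"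
    using class_fun_act_scalar[OF T a] by blast
  have "omega l T a = c" unfolding omega_def c using polytabloid_coeff[OF T] by simp
  then show ?thesis using c by simp
qed

section \<open>Evaluation at contents\<close>

text \<open>Class functions act on the polytabloid by scalars, and the scalars of a composition multiply.\<close>

lemma omega_ring_hom:
  assumes T: "is_tableau l T"
  shows "ring_hom_fun (\<lambda>x. omega l T (ev (psize l) (Rep_fha x)))"
  unfolding ring_hom_fun_def
proof (intro conjI allI)
  let ?n = "psize l"
  have "group_ring_act ?n (class_sum ?n empty_partition) (polytabloid l T) =
     (\<Sum>p\<in>Sym ?n. if p = id then perm_act id (polytabloid l T) else 0)"
    unfolding group_ring_act_def by (intro sum.cong refl) (auto simp: class_sum_empty smul_zero_left)
  also have "\<dots> = polytabloid l T" by (simp add: sum.delta perm_act_id)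
  finally show "omega l T (ev ?n (Rep_fha 1)) = 1"
    using polytabloid_coeff[OF T] by (simp add: omega_def Rep_fha_simps ev_fhK)
  show "omega l T (ev ?n (Rep_fha (x + y))) = omega l T (ev ?n (Rep_fha x)) + omega l T (ev ?n (Rep_fha y))" for x y
    unfolding omega_eq[OF T] Rep_fha_simps ev_add by (simp add: distrib_left sum.distrib)
  show "omega l T (ev ?n (Rep_fha (x * y))) = omega l T (ev ?n (Rep_fha x)) * omega l T (ev ?n (Rep_fha y))" for x y
  proof -
    have "group_ring_act ?n (ev ?n (Rep_fha (x * y))) (polytabloid l T) =
      smul (omega l T (ev ?n (Rep_fha y)) * omega l T (ev ?n (Rep_fha x))) (polytabloid l T)"
      unfolding Rep_fha_simps ev_fh_mult group_ring_act_mult act_eq_omega[OF T class_fun_ev] group_ring_act_smul smul_smul ..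
    then show ?thesis unfolding omega_def[of l T "ev ?n (Rep_fha (x * y))"]
      using polytabloid_coeff[OF T] by (simp add: mult.commute)
  qed
qed

text \<open>The entries of \<open>T\<close> label the boxes of the diagram, so the signed sum over the stabilizers applies.\<close>

lemma omega_rank_sum:
  assumes T: "is_tableau l T"
  shows "omega l T (ev (psize l) (Rep_fha (rank_sum r))) = of_int (esym_value r content (diagram l))"
proof -
  let ?X = "{1..psize l}"
  have "(\<Sum>h\<in>stab ?X (rowf l T). \<Sum>q\<in>stab ?X (colf l T). sign q * ev (psize l) (Rep_fha (rank_sum r)) (h \<circ> q)) =
    young_sum ?X (rowf l T) (colf l T) r"
    unfolding young_sum_def
  proof (intro sum.cong refl)
    fix h q assume hq: "h \<in> stab ?X (rowf l T)" "q \<in> stab ?X (colf l T)"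
    have "h \<circ> q permutes ?X" using permutes_compose[OF stabD(1)[OF hq(2)] stabD(1)[OF hq(1)]] .
    then show "sign q * ev (psize l) (Rep_fha (rank_sum r)) (h \<circ> q) = sign q * of_bool (perm_rank (h \<circ> q) = r)"
      by (simp only: ev_rank_sum)
  qed
  also have "\<dots> = esym_value r (\<lambda>x. int (colf l T x) - int (rowf l T x)) ?X"
    by (rule young_sum_eq[OF _ tableau_inj[OF T] tableau_down[OF T]]) auto
  also have "\<dots> = esym_value r content (diagram l)"
  proof (rule esym_value_reindex)
    show "bij_betw T (diagram l) ?X" using T by (simp add: is_tableau_def)
    show "int (colf l T (T b)) - int (rowf l T (T b)) = content b" if "b \<in> diagram l" for b
      using rowf_T[OF T that] by (simp add: content_def)
  qed
  finally show ?thesis unfolding omega_eq[OF T] by simp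
qed

lemma omega_iota:
  assumes T: "is_tableau l T"
  shows "omega l T (ev (psize l) (Rep_fha (iota c))) = of_int (ieval c (int (psize l)))"
proof -
  let ?n = "int (psize l)" and ?w = "\<lambda>x. omega l T (ev (psize l) (Rep_fha x))"
  have "?w (iota c) = of_int (ieval c ?n) * ?w 1"
    unfolding omega_eq[OF T] Rep_iota Rep_fha_simps ev_smul by (simp add: sum_distrib_left algebra_simps)
  then show ?thesis using ring_hom_fun_simps(1)[OF omega_ring_hom[OF T]] by simp
qed

text \<open>Both sides are ring homomorphisms in \<open>f\<close> that agree on the constants and the \<open>e\<^sub>r\<close>.\<close>

lemma omega_Psi_hom:
  assumes T: "is_tableau l T"
  shows "omega l T (ev (psize l) (Rep_fha (Psi_hom f))) = of_int (symfun_eval f content (diagram l) (int (psize l)))"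
  unfolding Psi_hom_def ring_hom_peval[OF omega_ring_hom[OF T]] omega_rank_sum[OF T] omega_iota[OF T]
  by (simp add: peval_def monomial_value_def symfun_eval_def)

lemma class_sum_act:
  assumes T: "is_tableau l T"
  shows "group_ring_act (psize l) (class_sum (psize l) m) (polytabloid l T) =
    smul (of_int (symfun_eval (character_symfun m) content (diagram l) (int (psize l)))) (polytabloid l T)"
proof -
  have "ev (psize l) (Rep_fha (Psi_hom (character_symfun m))) = class_sum (psize l) m"
    using Psi_map_character[of m] by (simp add: Psi_map_def ev_fhK)
  then show ?thesis using act_eq_omega[OF T class_fun_ev] omega_Psi_hom[OF T, of "character_symfun m"] by metis
qed

lemma module_smul: "module (smul :: complex \<Rightarrow> tvec \<Rightarrow> tvec)"
  by unfold_locales (simp_all add: smul_add_right smul_add_left smul_smul)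

theorem theorem3p13:
  fixes n :: nat and l m :: int_partition
  assumes "psize l = n"
    and "\<exists>p. p permutes {1..n} \<and> reduced_cycle_type n p = m"
  shows "central_character l m =
    of_int (symfun_eval (character_symfun m) content (diagram l) (int n))"
proof -
  let ?c = "of_int (symfun_eval (character_symfun m) content (diagram l) (int n)) :: complex"
  let ?act = "group_ring_act (psize l) (class_sum (psize l) m)"
  interpret tv: module "smul :: complex \<Rightarrow> tvec \<Rightarrow> tvec" by (rule module_smul)
  obtain T where T: "is_tableau l T" using tableau_exists by blast
  have in_specht: "polytabloid l T \<in> specht l"
    unfolding specht_def by (rule tv.span_base) (use T in blast)
  have scalar: "?act v = smul ?c v" if "v \<in> specht l" for v
    using that unfolding specht_def
  proof (induction rule: tv.span_induct_alt)
    case base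
    show ?case by (simp add: group_ring_act_zero)
  next
    case (step c x y)
    then obtain T' where "is_tableau l T'" "x = polytabloid l T'" by blast
    then have "?act x = smul ?c x" using class_sum_act[of l T' m] assms(1) by simp
    then show ?case using step by (simp add: group_ring_act_add group_ring_act_smul smul_add_right smul_smul mult.commute)
  qed
  show ?thesis
    unfolding central_character_def
  proof (rule the_equality)
    show "\<forall>v\<in>specht l. ?act v = smul ?c v" using scalar by blast
    fix c assume "\<forall>v\<in>specht l. ?act v = smul c v"
    then have "smul c (polytabloid l T) = smul ?c (polytabloid l T)" using in_specht scalar by metis
    then have "lkp (smul c (polytabloid l T)) (tabloid_at l T id) = lkp (smul ?c (polytabloid l T)) (tabloid_at l T id)" by simp
    then show "c = ?c" using polytabloid_coeff[OF T] by simp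
  qed
qed

end
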